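(* Suppose that $V$ satisfies (V) with $V_{loc}\equiv0$, that $f$ satisfies (F1)--(F5) (conditions listed in the context), and let $\mu=0$. Let $(K_n)$ be a sequence of functions each satisfying (K), with $K_n\to0$ in $L^\infty(\mathbb{R}^N)$. If, for each $n$, $u_n$ is a ground state solution of $$(-\Delta)^{\alpha/2}u+V(x)u=f(x,u)-K_n(x)|u|^{q-2}u\quad\text{on }\mathbb{R}^N\setminus\{0\},$$ then there is a sequence $(z_n)\subset\mathbb{Z}^N$ such that $$u_n(\cdot-z_n)\to u_0\quad\text{in }H^{\alpha/2}(\mathbb{R}^N),$$ where $u_0$ is a ground state solution of the equation with $K\equiv0$, i.e. of $(-\Delta)^{\alpha/2}u+V(x)u=f(x,u)$ on $\mathbb{R}^N\setminus\{0\}$.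
   Context: Setting: $\alpha\in(0,2)$, $N\ge 1$ is an integer with $N>\alpha$, $2^*_\alpha:=\frac{2N}{N-\alpha}$, and all functions are real-valued. The operator $(-\Delta)^{\alpha/2}$ is the fractional Laplacian, i.e. the Fourier multiplier with symbol $|\xi|^\alpha$. $H^{\alpha/2}(\mathbb{R}^N)$ is the space of $u\in L^2(\mathbb{R}^N)$ with $\iint_{\mathbb{R}^N\times\mathbb{R}^N}\frac{|u(x)-u(y)|^2}{|x-y|^{N+\alpha}}\,dx\,dy<\infty$, with its usual Hilbert structure. Constant: $$c_{N,\alpha}:=\frac{2^\alpha\,\Gamma\left(\frac{N+\alpha}{2}\right)}{2\pi^{N/2}\,|\Gamma(-\alpha/2)|}.$$ Conditions on $f:\mathbb{R}^N\times\mathbb{R}\to\mathbb{R}$, with $F(x,u):=\int_0^u f(x,s)\,ds$: (F1) $f$ is measurable, $\mathbb{Z}^N$-periodic in $x$ and continuous in $u\in\mathbb{R}$ for a.e. $x$; there are $c>0$ and $2<q<p<2^*_\alpha$ such that $|f(x,u)|\le c(1+|u|^{p-1})$ for all $u\in\mathbb{R}$, $x\in\mathbb{R}^N$ (this $q$ is the exponent appearing in the equation). (F2) $f(x,u)=o(|u|)$ uniformly in $x$ as $|u|\to0^+$. (F3) $F(x,u)/|u|^q\to\infty$ uniformly in $x$ as $|u|\to\infty$. (F4) $u\mapsto f(x,u)/|u|^{q-1}$ is increasing on $(-\infty,0)$ and on $(0,\infty)$. (F5) For a.e. $x$ the function $f(x,\cdot)$ is of class $C^1$, and there are $2<r\le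 p$ and $b,c>0$ such that $f(x,u)u-2F(x,u)\ge b|u|^r$ and $|f'_u(x,u)|\le c(1+|u|^{p-2})$ for all $u\in\mathbb{R}$ and a.e. $x\in\mathbb{R}^N$ (with $p$ as in (F1)). Condition (K): $K\in L^\infty(\mathbb{R}^N)$ is $\mathbb{Z}^N$-periodic and $K(x)\ge0$ for a.e. $x\in\mathbb{R}^N$. Condition (V): $V\in L^\infty(\mathbb{R}^N)$ is a sum $V=V_{loc}+V_{per}$, where $V_{per}\in L^\infty(\mathbb{R}^N)$ is $\mathbb{Z}^N$-periodic, $V_{loc}(x)\to0$ as $|x|\to\infty$, $V_{loc}\in L^s(\mathbb{R}^N)$ for some $s\ge\frac N\alpha$, and $\operatorname{ess\,inf}_{x\in\mathbb{R}^N}V(x)>0$. For given $K$ (and $\mu=0$, where $\mu$ is the coefficient of a Hardy-type term $-\frac{\mu}{|x|^\alpha}u$ that is absent here) the energy functional $\mathcal{J}:H^{\alpha/2}(\mathbb{R}^N)\to\mathbb{R}$ (of class $C^1$; its critical points are the weak solutions of the equation) is $$\mathcal{J}(u)=\frac{c_{N,\alpha}}2\iint_{\mathbb{R}^N\times\mathbb{R}^N}\frac{|u(x)-u(y)|^2}{|x-y|^{N+\alpha}}\,dx\,dy+\frac12\int_{\mathbb{R}^N}V(x)|u|^2\,dx-\int_{\mathbb{R}^N}\Big(F(x,u)-\frac1qK(x)|u|^q\Big)dx ,$$ and its Nehari manifold is $\mathcal{N}:=\{u\in H^{\alpha/2}(\mathbb{R}^N)\setminus\{0\}:\ \mathcal{J}'(u)(u)=0\}$.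 A ground state solution is a critical point $u\in\mathcal{N}$ of $\mathcal{J}$ with $\mathcal{J}(u)=\inf_{\mathcal{N}}\mathcal{J}$.
   Formalization: The convergence is proved along a subsequence of (u_n) only; for the full sequence the claim fails, e.g. V=1, f=|u|^{p-2}u, K_n=0 and u_n=(-1)^n w with w a ground state. *)

theory Defs
  imports "HOL-Analysis.Analysis" "HOL-Probability.Essential_Supremum"
begin

section \<open>Function spaces on $\mathbb{R}^N$, where $N$ is the cardinality of the index type\<close>

text \<open>
  Functions are Lebesgue measurable representatives; two of them are the same element of a
  function space if they agree almost everywhere. Everything below respects this identification.
\<close>

definition int_lattice :: "(real ^ 'n) set" where
  "int_lattice = {z. \<forall>i. z $ i \<in> \<int>}"

text \<open>Periodicity of an element of \<open>L\<^sup>\<infinity>\<close>, hence only almost everywhere for each period.\<close>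

definition ae_periodic :: "(real ^ 'n \<Rightarrow> real) \<Rightarrow> bool" where
  "ae_periodic g \<longleftrightarrow> (\<forall>z\<in>int_lattice. AE x in lebesgue. g (x + z) = g x)"

definition Linf_norm :: "(real ^ 'n \<Rightarrow> real) \<Rightarrow> ereal" where
  "Linf_norm g = esssup lebesgue (\<lambda>x. ereal \<bar>g x\<bar>)"

definition Linf :: "(real ^ 'n \<Rightarrow> real) set" where
  "Linf = {g. g \<in> borel_measurable lebesgue \<and> Linf_norm g < \<infinity>}"

definition Lspace :: "real \<Rightarrow> (real ^ 'n \<Rightarrow> real) set" where
  "Lspace s = {g. g \<in> borel_measurable lebesgue \<and> integrable lebesgue (\<lambda>x. \<bar>g x\<bar> powr s)}"

text \<open>The counterpart of \<^const>\<open>esssup\<close>, which is a \<^const>\<open>Limsup\<close> over the same filter.\<close>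

definition essinf_lebesgue :: "(real ^ 'n \<Rightarrow> real) \<Rightarrow> ereal" where
  "essinf_lebesgue g = Liminf (ae_filter lebesgue) (\<lambda>x. ereal (g x))"

text \<open>On the diagonal the denominator is \<open>0\<close> and the quotient is \<open>0\<close>; the diagonal is a null set.\<close>

definition gagliardo_kernel ::
    "real \<Rightarrow> (real ^ 'n \<Rightarrow> real) \<Rightarrow> (real ^ 'n) \<times> (real ^ 'n) \<Rightarrow> real" where
  "gagliardo_kernel \<alpha> u =
     (\<lambda>(x, y). \<bar>u x - u y\<bar>\<^sup>2 / norm (x - y) powr (real CARD('n) + \<alpha>))"

definition gagliardo :: "real \<Rightarrow> (real ^ 'n \<Rightarrow> real) \<Rightarrow> real" where
  "gagliardo \<alpha> u = integral\<^sup>L (lebesgue \<Otimes>\<^sub>M lebesgue) (gagliardo_kernel \<alpha> u)"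

definition frac_sobolev :: "real \<Rightarrow> (real ^ 'n \<Rightarrow> real) set" where
  "frac_sobolev \<alpha> =
     {u. u \<in> borel_measurable lebesgue \<and> integrable lebesgue (\<lambda>x. \<bar>u x\<bar>\<^sup>2)
       \<and> integrable (lebesgue \<Otimes>\<^sub>M lebesgue) (gagliardo_kernel \<alpha> u)}"

text \<open>Only meaningful for elements of \<^const>\<open>frac_sobolev\<close>.\<close>

definition frac_sobolev_norm :: "real \<Rightarrow> (real ^ 'n \<Rightarrow> real) \<Rightarrow> real" where
  "frac_sobolev_norm \<alpha> u = sqrt ((\<integral>x. \<bar>u x\<bar>\<^sup>2 \<partial>lebesgue) + gagliardo \<alpha> u)"

text \<open>
  \<open>L\<close> is the Frechet derivative at \<open>u\<close> of the functional \<open>J\<close> on \<open>H\<^bsup>\<alpha>/2\<^esup>\<close>. The space depends on the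
  real parameter \<open>\<alpha>\<close> and is not a type, so \<^const>\<open>has_derivative\<close> cannot be used.
\<close>

definition has_frechet_derivative ::
    "real \<Rightarrow> ((real ^ 'n \<Rightarrow> real) \<Rightarrow> real) \<Rightarrow> (real ^ 'n \<Rightarrow> real) \<Rightarrow> ((real ^ 'n \<Rightarrow> real) \<Rightarrow> real) \<Rightarrow> bool"
  where
  "has_frechet_derivative \<alpha> J u L \<longleftrightarrow>
     (\<forall>v\<in>frac_sobolev \<alpha>. \<forall>w\<in>frac_sobolev \<alpha>. L (\<lambda>x. v x + w x) = L v + L w) \<and>
     (\<forall>v\<in>frac_sobolev \<alpha>. \<forall>t. L (\<lambda>x. t * v x) = t * L v) \<and>
     (\<exists>C. \<forall>v\<in>frac_sobolev \<alpha>. \<bar>L v\<bar> \<le> C * frac_sobolev_norm \<alpha> v) \<and>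
     (\<forall>\<epsilon>>0. \<exists>\<delta>>0. \<forall>h\<in>frac_sobolev \<alpha>. frac_sobolev_norm \<alpha> h < \<delta> \<longrightarrow>
        \<bar>J (\<lambda>x. u x + h x) - J u - L h\<bar> \<le> \<epsilon> * frac_sobolev_norm \<alpha> h)"


section \<open>Conditions on the data\<close>

definition critical_exponent :: "'n itself \<Rightarrow> real \<Rightarrow> real" where
  "critical_exponent _ \<alpha> = 2 * real CARD('n) / (real CARD('n) - \<alpha>)"

definition primitive :: "(real ^ 'n \<Rightarrow> real \<Rightarrow> real) \<Rightarrow> real ^ 'n \<Rightarrow> real \<Rightarrow> real" where
  "primitive f x u = (LBINT s=ereal 0..ereal u. f x s)"

definition cond_F1 :: "real \<Rightarrow> real \<Rightarrow> real \<Rightarrow> (real ^ 'n \<Rightarrow> real \<Rightarrow> real) \<Rightarrow> bool" where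
  "cond_F1 \<alpha> q p f \<longleftrightarrow>
     case_prod f \<in> borel_measurable (lebesgue :: ((real ^ 'n) \<times> real) measure) \<and>
     (\<forall>z\<in>int_lattice. \<forall>x u. f (x + z) u = f x u) \<and>
     (AE x in lebesgue. continuous_on UNIV (f x)) \<and>
     2 < q \<and> q < p \<and> p < critical_exponent TYPE('n) \<alpha> \<and>
     (\<exists>c>0. \<forall>x u. \<bar>f x u\<bar> \<le> c * (1 + \<bar>u\<bar> powr (p - 1)))"

definition cond_F2 :: "(real ^ 'n \<Rightarrow> real \<Rightarrow> real) \<Rightarrow> bool" where
  "cond_F2 f \<longleftrightarrow> (\<forall>\<epsilon>>0. \<exists>\<delta>>0. \<forall>x u. 0 < \<bar>u\<bar> \<and> \<bar>u\<bar> < \<delta> \<longrightarrow> \<bar>f x u\<bar> \<le> \<epsilon> * \<bar>u\<bar>)"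

definition cond_F3 :: "real \<Rightarrow> (real ^ 'n \<Rightarrow> real \<Rightarrow> real) \<Rightarrow> bool" where
  "cond_F3 q f \<longleftrightarrow> (\<forall>M. \<exists>R>0. \<forall>x u. \<bar>u\<bar> > R \<longrightarrow> primitive f x u / \<bar>u\<bar> powr q \<ge> M)"

text \<open>``Increasing'' is taken in the weak sense, which also covers the strict one.\<close>

definition cond_F4 :: "real \<Rightarrow> (real ^ 'n \<Rightarrow> real \<Rightarrow> real) \<Rightarrow> bool" where
  "cond_F4 q f \<longleftrightarrow>
     (\<forall>x. mono_on {..<0} (\<lambda>u. f x u / \<bar>u\<bar> powr (q - 1)) \<and>
          mono_on {0<..} (\<lambda>u. f x u / \<bar>u\<bar> powr (q - 1)))"

definition cond_F5 :: "real \<Rightarrow> (real ^ 'n \<Rightarrow> real \<Rightarrow> real) \<Rightarrow> bool" where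
  "cond_F5 p f \<longleftrightarrow>
     (AE x in lebesgue. f x C1_differentiable_on UNIV) \<and>
     (\<exists>r b c. 2 < r \<and> r \<le> p \<and> 0 < b \<and> 0 < c \<and>
        (AE x in lebesgue. \<forall>u.
            f x u * u - 2 * primitive f x u \<ge> b * \<bar>u\<bar> powr r \<and>
            \<bar>deriv (f x) u\<bar> \<le> c * (1 + \<bar>u\<bar> powr (p - 2))))"

definition cond_K :: "(real ^ 'n \<Rightarrow> real) \<Rightarrow> bool" where
  "cond_K K \<longleftrightarrow> K \<in> Linf \<and> ae_periodic K \<and> (AE x in lebesgue. K x \<ge> 0)"

definition cond_V ::
    "real \<Rightarrow> (real ^ 'n \<Rightarrow> real) \<Rightarrow> (real ^ 'n \<Rightarrow> real) \<Rightarrow> (real ^ 'n \<Rightarrow> real) \<Rightarrow> bool" where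
  "cond_V \<alpha> V Vloc Vper \<longleftrightarrow>
     V \<in> Linf \<and> (AE x in lebesgue. V x = Vloc x + Vper x) \<and>
     Vper \<in> Linf \<and> ae_periodic Vper \<and>
     (Vloc \<longlongrightarrow> 0) at_infinity \<and> (\<exists>s \<ge> real CARD('n) / \<alpha>. Vloc \<in> Lspace s) \<and>
     essinf_lebesgue V > 0"


section \<open>Energy functional and ground states\<close>

definition frac_const :: "'n itself \<Rightarrow> real \<Rightarrow> real" where
  "frac_const _ \<alpha> =
     2 powr \<alpha> * Gamma ((real CARD('n) + \<alpha>) / 2)
       / (2 * pi powr (real CARD('n) / 2) * \<bar>Gamma (- \<alpha> / 2)\<bar>)"

text \<open>
  The energy of the equation
  \<open>(-\<Delta>)\<^bsup>\<alpha>/2\<^esup> u + V(x) u = f(x,u) - K(x) |u|\<^bsup>q-2\<^esup> u\<close>, whose weak solutions are by definition the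
  critical points of this functional on \<open>H\<^bsup>\<alpha>/2\<^esup>\<close>.
\<close>

definition energy ::
    "real \<Rightarrow> real \<Rightarrow> (real ^ 'n \<Rightarrow> real) \<Rightarrow> (real ^ 'n \<Rightarrow> real \<Rightarrow> real) \<Rightarrow> (real ^ 'n \<Rightarrow> real)
      \<Rightarrow> (real ^ 'n \<Rightarrow> real) \<Rightarrow> real" where
  "energy \<alpha> q V f K u =
     frac_const TYPE('n) \<alpha> / 2 * gagliardo \<alpha> u
     + 1 / 2 * (\<integral>x. V x * \<bar>u x\<bar>\<^sup>2 \<partial>lebesgue)
     - (\<integral>x. primitive f x (u x) - 1 / q * K x * \<bar>u x\<bar> powr q \<partial>lebesgue)"

definition nehari ::
    "real \<Rightarrow> real \<Rightarrow> (real ^ 'n \<Rightarrow> real) \<Rightarrow> (real ^ 'n \<Rightarrow> real \<Rightarrow> real) \<Rightarrow> (real ^ 'n \<Rightarrow> real)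
      \<Rightarrow> (real ^ 'n \<Rightarrow> real) set" where
  "nehari \<alpha> q V f K =
     {u \<in> frac_sobolev \<alpha>. \<not> (AE x in lebesgue. u x = 0) \<and>
        (\<exists>L. has_frechet_derivative \<alpha> (energy \<alpha> q V f K) u L \<and> L u = 0)}"

text \<open>
  The infimum is taken in \<^typ>\<open>ereal\<close>, since the real-valued \<^const>\<open>Inf\<close> is unspecified for sets that
  are not bounded below.
\<close>

definition ground_state ::
    "real \<Rightarrow> real \<Rightarrow> (real ^ 'n \<Rightarrow> real) \<Rightarrow> (real ^ 'n \<Rightarrow> real \<Rightarrow> real) \<Rightarrow> (real ^ 'n \<Rightarrow> real)
      \<Rightarrow> (real ^ 'n \<Rightarrow> real) \<Rightarrow> bool" where
  "ground_state \<alpha> q V f K u \<longleftrightarrow>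
     u \<in> nehari \<alpha> q V f K \<and>
     has_frechet_derivative \<alpha> (energy \<alpha> q V f K) u (\<lambda>_. 0) \<and>
     ereal (energy \<alpha> q V f K u) = (INF v\<in>nehari \<alpha> q V f K. ereal (energy \<alpha> q V f K v))"

end

theory Submission
  imports Defs "HOL-Library.Diagonal_Subsequence"
begin

text \<open>
  Write \<open>J\<^sub>n\<close> for the energy with coefficient \<open>K\<^sub>n\<close>, \<open>J\<^sub>0\<close> for the one with \<open>K = 0\<close>, and \<open>B\<close> for the quadratic
  form of the linear part, so that \<open>J\<^sub>n(u) = B(u, u) / 2 - \<integral>F(x, u) + (1/q) \<integral>K\<^sub>n \<bar>u\<bar>\<^sup>q\<close>. On the Nehari manifold,
  subtracting \<open>(1/q) J\<^sub>n'(u)u = 0\<close> cancels the term with \<open>K\<^sub>n\<close> (\<open>energy_on_nehari\<close>):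
  \<open>J\<^sub>n(u) = (1/2 - 1/q) B(u, u) + \<integral>(f(x, u)u / q - F(x, u))\<close>. By (F4) and (F5) the last integrand is
  nonnegative (\<open>Ambrosetti_Rabinowitz\<close>). Everything rests on this formula, in which neither term can increase
  when one passes to a weak limit.

  Upper bound for the levels. Let \<open>v\<close> lie on the Nehari manifold of \<open>J\<^sub>0\<close>. By (F4), \<open>J\<^sub>0\<close> restricted to the ray
  through \<open>v\<close> is maximal at \<open>v\<close> (\<open>energy_ray_le\<close>), and by (F3) it is negative at some \<open>T v\<close>. For large \<open>n\<close> the
  energy \<open>J\<^sub>n\<close> is negative at \<open>T v\<close> as well, so its maximum on the ray is attained at a point \<open>t v\<close> of the Nehari
  manifold with \<open>t < T\<close>. Hence \<open>J\<^sub>n(u\<^sub>n) \<le> J\<^sub>n(t v) \<le> J\<^sub>0(v) + o(1)\<close> (\<open>ground_level_upper_bound\<close>). In particular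
  the levels are bounded, and by the formula above so are the norms of the \<open>u\<^sub>n\<close>.

  Nontrivial limit. By Sobolev's inequality \<open>\<integral>\<bar>u\<bar>\<^sup>p\<close> is bounded away from zero on all Nehari manifolds
  (\<open>nehari_Lp_lower_bound\<close>). By Lions' lemma (\<open>nonvanishing\<close>) some unit cube then carries a fixed amount of the
  \<open>L\<^sup>2\<close> mass of \<open>u\<^sub>n\<close>. Translating this cube to the origin, which leaves the periodic problem invariant, and
  applying Rellich's theorem (\<open>AE_convergent_subsequence\<close>), one obtains a subsequence of the translates \<open>w\<^sub>n\<close> that
  converges almost everywhere and weakly to some \<open>u\<^sub>0 \<noteq> 0\<close>. This \<open>u\<^sub>0\<close> is a critical point of \<open>J\<^sub>0\<close>
  (\<open>critical_limit\<close>).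

  Conclusion. The formula gives \<open>J\<^sub>0(u\<^sub>0) \<le> liminf J\<^sub>n(w\<^sub>n)\<close>, and the upper bound gives
  \<open>limsup J\<^sub>n(w\<^sub>n) \<le> J\<^sub>0(v)\<close> for every \<open>v\<close> on the Nehari manifold of \<open>J\<^sub>0\<close>. So \<open>u\<^sub>0\<close> is a ground state. With
  \<open>v = u\<^sub>0\<close> there is equality throughout, hence \<open>B(w\<^sub>n, w\<^sub>n)\<close> tends to \<open>B(u\<^sub>0, u\<^sub>0)\<close>, and together with weak
  convergence this is convergence in norm (\<open>energy_limit\<close>).

  Sobolev's inequality, Lions' lemma and Rellich's theorem are all derived from averages over dyadic cubes.
  The \<open>L\<^sup>2\<close> distance of \<open>u\<close> to its averages at scale \<open>2\<^sup>-\<^sup>k\<close> is of order \<open>2\<^sup>-\<^sup>\<alpha>\<^sup>k\<^sup>/\<^sup>2\<close> (\<open>avg_deviation\<close>). On functions that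
  are constant on the cubes of that scale the \<open>L\<^sup>p\<close> norm costs only a power of \<open>2\<^sup>k\<close> over the \<open>L\<^sup>2\<close> norm, and the
  product of the two factors decays precisely for subcritical \<open>p\<close> (\<open>avg_deviation_Lp\<close>).
\<close>


section \<open>Integration lemmas\<close>

lemma sigma_finite_lebesgue: "sigma_finite_measure (lebesgue :: 'a::euclidean_space measure)"
proof
  obtain A :: "'a set set" where A: "countable A" "A \<subseteq> sets lborel" "\<Union>A = space lborel"
      "\<forall>a\<in>A. emeasure lborel a \<noteq> \<infinity>"
    using lborel.sigma_finite_countable by blast
  have "A \<subseteq> sets lebesgue" using A(2) by auto
  moreover have "\<forall>a\<in>A. emeasure lebesgue a \<noteq> \<infinity>"
    using A(2,4) by auto
  ultimately show "\<exists>A::'a set set. countable A \<and> A \<subseteq> sets lebesgue \<and> \<Union>A = space lebesgue \<and> (\<forall>a\<in>A. emeasure lebesgue a \<noteq> \<infinity>)"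
    using A by (intro exI[of _ A]) auto
qed

interpretation leb: sigma_finite_measure "lebesgue :: 'a::euclidean_space measure"
  by (rule sigma_finite_lebesgue)

interpretation leb2: pair_sigma_finite "lebesgue :: 'a::euclidean_space measure"
    "lebesgue :: 'b::euclidean_space measure" ..

lemma distr_lebesgue_translation:
  "distr lebesgue lebesgue (\<lambda>x::'a::euclidean_space. x + z) = lebesgue"
proof -
  have "lebesgue = density (distr lebesgue lebesgue (\<lambda>x::'a. z + (\<Sum>j\<in>Basis. (1 * (x \<bullet> j)) *\<^sub>R j)))
          (\<lambda>_. ennreal (\<Prod>j\<in>(Basis::'a set). \<bar>1::real\<bar>))"
    using lebesgue_affine_euclidean[of "\<lambda>_::'a. 1" z] by (simp only: one_neq_zero not_False_eq_True if_True)
  then show ?thesis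
    by (simp only: mult_1 abs_one prod.neutral_const ennreal_1 density_1 euclidean_representation add.commute)
qed

lemma measurable_lebesgue_translation:
  "(\<lambda>x::'a::euclidean_space. x + z) \<in> lebesgue \<rightarrow>\<^sub>M lebesgue"
  using lebesgue_affine_measurable[of "\<lambda>_::'a. 1" z] by (simp add: euclidean_representation add.commute)

lemma integral_lebesgue_translation:
  fixes g :: "'a::euclidean_space \<Rightarrow> real"
  assumes "g \<in> borel_measurable lebesgue"
  shows "(\<integral>x. g (x + z) \<partial>lebesgue) = (\<integral>x. g x \<partial>lebesgue)"
    and "integrable lebesgue (\<lambda>x. g (x + z)) \<longleftrightarrow> integrable lebesgue g"
proof -
  show "(\<integral>x. g (x + z) \<partial>lebesgue) = (\<integral>x. g x \<partial>lebesgue)"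
    using integral_distr[OF measurable_lebesgue_translation[of z] assms]
    by (simp add: distr_lebesgue_translation)
  show "integrable lebesgue (\<lambda>x. g (x + z)) \<longleftrightarrow> integrable lebesgue g"
    using integrable_distr_eq[OF measurable_lebesgue_translation[of z] assms]
    by (simp add: distr_lebesgue_translation)
qed

lemma AE_lebesgue_translation:
  assumes "AE x in lebesgue. P (x::'a::euclidean_space)"
  shows "AE x in lebesgue. P (x + z)"
proof -
  have "AE x in distr lebesgue lebesgue (\<lambda>x. x + z). P x"
    using assms by (simp only: distr_lebesgue_translation)
  then show ?thesis by (rule AE_distrD[OF measurable_lebesgue_translation])
qed

lemma distr_lebesgue_pair_translation:
  "distr (lebesgue \<Otimes>\<^sub>M lebesgue) (lebesgue \<Otimes>\<^sub>M lebesgue) (\<lambda>(x::'a::euclidean_space, y::'a). (x + z, y + z))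
     = lebesgue \<Otimes>\<^sub>M lebesgue"
  using pair_measure_distr[OF measurable_lebesgue_translation[of z] measurable_lebesgue_translation[of z]]
  by (simp add: distr_lebesgue_translation sigma_finite_lebesgue)

lemma AE_pair_fstI:
  assumes "AE x in lebesgue. P (x::'a::euclidean_space)"
  shows "AE z in lebesgue \<Otimes>\<^sub>M (lebesgue :: 'b::euclidean_space measure). P (fst z)"
proof -
  obtain N where N: "{x. \<not> P x} \<subseteq> N" "N \<in> null_sets lebesgue"
    using assms by (auto elim!: AE_E simp: null_sets_def)
  have "N \<times> UNIV \<in> null_sets (lebesgue \<Otimes>\<^sub>M (lebesgue :: 'b measure))"
    using N(2) by (intro null_setsI) (auto simp: leb.emeasure_pair_measure_Times null_sets_def)
  then show ?thesis by (rule AE_I') (use N(1) in auto)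
qed

lemma AE_pair_sndI:
  assumes "AE x in lebesgue. P (x::'b::euclidean_space)"
  shows "AE z in (lebesgue :: 'a::euclidean_space measure) \<Otimes>\<^sub>M lebesgue. P (snd z)"
proof -
  obtain N where N: "{x. \<not> P x} \<subseteq> N" "N \<in> null_sets lebesgue"
    using assms by (auto elim!: AE_E simp: null_sets_def)
  have "UNIV \<times> N \<in> null_sets ((lebesgue :: 'a measure) \<Otimes>\<^sub>M lebesgue)"
    using N(2) by (intro null_setsI) (auto simp: leb.emeasure_pair_measure_Times null_sets_def)
  then show ?thesis by (rule AE_I') (use N(1) in auto)
qed

text \<open>
  The common substitute for dominated convergence below: the part of \<open>h n\<close> above the fixed integrable
  function is uniformly small in mean, and the truncation of \<open>h n\<close> at that function converges by
  dominated convergence.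
\<close>

lemma almost_dominated_convergence:
  fixes h g :: "nat \<Rightarrow> 'a \<Rightarrow> real"
  assumes meas: "\<And>n. h n \<in> borel_measurable M"
    and lim: "AE x in M. (\<lambda>n. h n x) \<longlonglongrightarrow> 0"
    and g: "\<And>n. integrable M (g n)" "\<And>n x. 0 \<le> g n x" "\<And>n. integral\<^sup>L M (g n) \<le> B"
    and dom: "\<And>\<epsilon>. \<epsilon> > 0 \<Longrightarrow> \<exists>\<Phi>. integrable M \<Phi> \<and> (\<forall>n. AE x in M. \<bar>h n x\<bar> \<le> \<epsilon> * g n x + \<Phi> x)"
  shows "\<And>n. integrable M (h n)" and "(\<lambda>n. \<integral>x. \<bar>h n x\<bar> \<partial>M) \<longlonglongrightarrow> 0"
proof -
  show int: "integrable M (h n)" for n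
  proof -
    obtain \<Phi> where \<Phi>: "integrable M \<Phi>" "AE x in M. \<bar>h n x\<bar> \<le> 1 * g n x + \<Phi> x"
      using dom[of 1] by force
    show ?thesis
      using \<Phi> g(1)[of n] meas[of n]
      by (intro Bochner_Integration.integrable_bound[where f="\<lambda>x. 1 * g n x + \<Phi> x" and g="h n"]) auto
  qed
  have B: "B \<ge> 0"
  proof -
    have "0 \<le> integral\<^sup>L M (g 0)" by (rule Bochner_Integration.integral_nonneg) (rule g(2))
    then show ?thesis using g(3)[of 0] by linarith
  qed
  show "(\<lambda>n. \<integral>x. \<bar>h n x\<bar> \<partial>M) \<longlonglongrightarrow> 0"
  proof (rule LIMSEQ_I)
    fix r :: real assume r: "r > 0"
    define e where "e = r / (2 * (B + 1))"
    have e: "e > 0" "e * B < r / 2" using r B by (auto simp: e_def field_simps)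
    obtain \<Phi> where \<Phi>: "integrable M \<Phi>" "\<And>n. AE x in M. \<bar>h n x\<bar> \<le> e * g n x + \<Phi> x"
      using dom[OF e(1)] by blast
    define m where "m = (\<lambda>n x. min \<bar>h n x\<bar> \<bar>\<Phi> x\<bar>)"
    have mm: "m n \<in> borel_measurable M" for n
      unfolding m_def using meas[of n] \<Phi>(1) by measurable
    have int_m: "integrable M (m n)" for n
      by (rule Bochner_Integration.integrable_bound[OF \<Phi>(1)]) (use mm in \<open>auto simp: m_def\<close>)
    have "(\<lambda>n. \<integral>x. m n x \<partial>M) \<longlonglongrightarrow> (\<integral>x. 0 \<partial>M)"
    proof (rule integral_dominated_convergence[where w="\<lambda>x. \<bar>\<Phi> x\<bar>"])
      show "AE x in M. (\<lambda>n. m n x) \<longlonglongrightarrow> 0"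
        using lim
      proof eventually_elim
        case (elim x)
        then have "(\<lambda>n. min \<bar>h n x\<bar> \<bar>\<Phi> x\<bar>) \<longlonglongrightarrow> min \<bar>0\<bar> \<bar>\<Phi> x\<bar>" by (intro tendsto_intros)
        then show ?case by (simp add: m_def)
      qed
    qed (use mm \<Phi>(1) in \<open>auto simp: m_def\<close>)
    then have "(\<lambda>n. \<integral>x. m n x \<partial>M) \<longlonglongrightarrow> 0" by simp
    then obtain N where N: "\<And>n. n \<ge> N \<Longrightarrow> \<bar>\<integral>x. m n x \<partial>M\<bar> < r / 2"
      using r by (fastforce dest!: LIMSEQ_D[of _ _ "r/2"])
    have "norm ((\<integral>x. \<bar>h n x\<bar> \<partial>M) - 0) < r" if "n \<ge> N" for n
    proof -
      have "(\<integral>x. \<bar>h n x\<bar> \<partial>M) \<le> (\<integral>x. e * g n x + m n x \<partial>M)"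
      proof (rule integral_mono_AE)
        show "AE x in M. \<bar>h n x\<bar> \<le> e * g n x + m n x"
          using \<Phi>(2)[of n]
        proof eventually_elim
          case (elim x)
          have "e * g n x \<ge> 0" using e g(2) by simp
          with elim show ?case by (auto simp: m_def min_def)
        qed
      qed (use int g(1) int_m in auto)
      also have "\<dots> = e * (\<integral>x. g n x \<partial>M) + (\<integral>x. m n x \<partial>M)"
        using g(1) int_m by simp
      also have "\<dots> < e * B + r / 2"
        using N[OF that] mult_left_mono[OF g(3)[of n] less_imp_le[OF e(1)]] by linarith
      also have "\<dots> < r" using e by simp
      finally have "(\<integral>x. \<bar>h n x\<bar> \<partial>M) < r" .
      moreover have "0 \<le> (\<integral>x. \<bar>h n x\<bar> \<partial>M)" by (rule Bochner_Integration.integral_nonneg) simp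
      ultimately show ?thesis by simp
    qed
    then show "\<exists>N. \<forall>n\<ge>N. norm ((\<integral>x. \<bar>h n x\<bar> \<partial>M) - 0) < r" by blast
  qed
qed

lemma Fatou_bounded:
  fixes f :: "nat \<Rightarrow> 'a \<Rightarrow> real"
  assumes int: "\<And>n. integrable M (f n)" and nn: "\<And>n. AE x in M. 0 \<le> f n x"
    and meas: "g \<in> borel_measurable M"
    and lim: "AE x in M. (\<lambda>n. f n x) \<longlonglongrightarrow> g x"
    and B: "\<And>n. integral\<^sup>L M (f n) \<le> B"
  shows "integrable M g" and "integral\<^sup>L M g \<le> B"
proof -
  have nn': "AE x in M. \<forall>n. 0 \<le> f n x" using nn by (simp add: AE_all_countable)
  have g0: "AE x in M. 0 \<le> g x"
    using lim nn'
  proof eventually_elim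
    case (elim x) then show ?case by (intro LIMSEQ_le_const[of "\<lambda>n. f n x"]) auto
  qed
  have B0: "0 \<le> B" using integral_nonneg_AE[OF nn[of 0]] B[of 0] by linarith
  have "(\<integral>\<^sup>+x. ennreal (g x) \<partial>M) = (\<integral>\<^sup>+x. liminf (\<lambda>n. ennreal (f n x)) \<partial>M)"
  proof (rule nn_integral_cong_AE)
    show "AE x in M. ennreal (g x) = liminf (\<lambda>n. ennreal (f n x))"
      using lim
    proof eventually_elim
      case (elim x)
      then have "(\<lambda>n. ennreal (f n x)) \<longlonglongrightarrow> ennreal (g x)" by (intro tendsto_ennrealI)
      then show ?case by (simp add: lim_imp_Liminf)
    qed
  qed
  also have "\<dots> \<le> liminf (\<lambda>n. \<integral>\<^sup>+x. ennreal (f n x) \<partial>M)"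
    using int by (intro nn_integral_liminf) auto
  also have "\<dots> \<le> liminf (\<lambda>n. ennreal B)"
    using int nn B by (intro Liminf_mono always_eventually) (auto simp: nn_integral_eq_integral intro!: ennreal_leI)
  also have "\<dots> = ennreal B" by (simp add: Liminf_const)
  finally have le: "(\<integral>\<^sup>+x. ennreal (g x) \<partial>M) \<le> ennreal B" .
  show "integrable M g"
  proof (rule integrableI_nonneg[OF meas g0])
    show "(\<integral>\<^sup>+x. ennreal (g x) \<partial>M) < \<infinity>" using le by (auto simp: less_top[symmetric] top_unique)
  qed
  then have "ennreal (integral\<^sup>L M g) \<le> ennreal B"
    using le g0 by (simp add: nn_integral_eq_integral)
  then show "integral\<^sup>L M g \<le> B" using B0 by simp
qed

text \<open>
  Fatou's lemma in the form in which it enters comparisons of levels: infinitely many indices with a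
  smaller integral would contradict \<open>Fatou_bounded\<close> along them.
\<close>

lemma Fatou_eventually:
  fixes f :: "nat \<Rightarrow> 'a \<Rightarrow> real"
  assumes int: "\<And>n. integrable M (f n)" and nn: "\<And>n. AE x in M. 0 \<le> f n x"
    and meas: "g \<in> borel_measurable M"
    and lim: "AE x in M. (\<lambda>n. f n x) \<longlonglongrightarrow> g x"
    and e: "(e::real) > 0"
  shows "\<forall>\<^sub>F n in sequentially. integral\<^sup>L M g \<le> integral\<^sup>L M (f n) + e"
proof (rule ccontr)
  assume "\<not> ?thesis"
  then have "\<exists>\<^sub>F n in sequentially. integral\<^sup>L M (f n) \<le> integral\<^sup>L M g - e"
    by (auto simp: not_eventually elim!: frequently_elim1)
  then have "infinite {n. integral\<^sup>L M (f n) \<le> integral\<^sup>L M g - e}"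
    by (simp add: cofinite_eq_sequentially[symmetric] frequently_cofinite)
  then obtain r :: "nat \<Rightarrow> nat" where r: "strict_mono r" "\<And>n. integral\<^sup>L M (f (r n)) \<le> integral\<^sup>L M g - e"
    using infinite_enumerate by blast
  have "integral\<^sup>L M g \<le> integral\<^sup>L M g - e"
  proof (rule Fatou_bounded(2)[where f="\<lambda>n. f (r n)" and M=M])
    show "AE x in M. (\<lambda>n. f (r n) x) \<longlonglongrightarrow> g x"
      using lim by eventually_elim (use LIMSEQ_subseq_LIMSEQ[OF _ r(1)] in \<open>auto simp: o_def\<close>)
  qed (use int nn meas r in auto)
  then show False using e by simp
qed


section \<open>Square integrable functions\<close>

definition sq_integrable :: "'a measure \<Rightarrow> ('a \<Rightarrow> real) \<Rightarrow> bool" where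
  "sq_integrable M g \<longleftrightarrow> g \<in> borel_measurable M \<and> integrable M (\<lambda>x. (g x)\<^sup>2)"

lemma sq_integrable_mult:
  assumes "sq_integrable M g" "sq_integrable M h"
  shows "integrable M (\<lambda>x. g x * h x)"
proof (rule Bochner_Integration.integrable_bound)
  show "integrable M (\<lambda>x. (g x)\<^sup>2 + (h x)\<^sup>2)" using assms by (auto simp: sq_integrable_def)
  show "(\<lambda>x. g x * h x) \<in> borel_measurable M" using assms by (auto simp: sq_integrable_def)
  have "\<bar>a * b\<bar> \<le> a\<^sup>2 + b\<^sup>2" for a b :: real
  proof -
    have "\<bar>a\<bar> * \<bar>b\<bar> * 2 \<le> \<bar>a\<bar>\<^sup>2 + \<bar>b\<bar>\<^sup>2" using sum_squares_bound[of "\<bar>a\<bar>" "\<bar>b\<bar>"] by (simp add: mult_ac)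
    moreover have "0 \<le> \<bar>a\<bar> * \<bar>b\<bar>" by simp
    ultimately show ?thesis unfolding abs_mult power2_abs by linarith
  qed
  then show "AE x in M. norm (g x * h x) \<le> norm ((g x)\<^sup>2 + (h x)\<^sup>2)"
    by (intro AE_I2) simp
qed

lemma sq_integrable_add:
  assumes "sq_integrable M g" "sq_integrable M h"
  shows "sq_integrable M (\<lambda>x. g x + h x)"
  using assms sq_integrable_mult[OF assms]
  by (auto simp: sq_integrable_def power2_sum mult.assoc)

lemma sq_integrable_cmult:
  "sq_integrable M g \<Longrightarrow> sq_integrable M (\<lambda>x. c * g x)"
  by (auto simp: sq_integrable_def power_mult_distrib)

lemma sq_integrable_diff:
  assumes "sq_integrable M g" "sq_integrable M h"
  shows "sq_integrable M (\<lambda>x. g x - h x)"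
  using sq_integrable_add[OF assms(1) sq_integrable_cmult[OF assms(2), of "-1"]] by simp

text \<open>
  Young's inequality bounds \<open>\<bar>g n - g0\<bar> \<bar>\<phi>\<bar>\<close> by \<open>\<epsilon> (g n - g0)\<^sup>2\<close> plus a multiple of the integrable function \<open>\<phi>\<^sup>2\<close>.
  This is the domination required by \<open>almost_dominated_convergence\<close>.
\<close>

lemma AE_convergent_imp_weakly_convergent:
  fixes g :: "nat \<Rightarrow> 'a \<Rightarrow> real"
  assumes g: "\<And>n. sq_integrable M (g n)" and B: "\<And>n. (\<integral>x. (g n x)\<^sup>2 \<partial>M) \<le> B"
    and g0: "g0 \<in> borel_measurable M" and lim: "AE x in M. (\<lambda>n. g n x) \<longlonglongrightarrow> g0 x"
  shows "sq_integrable M g0" and "(\<integral>x. (g0 x)\<^sup>2 \<partial>M) \<le> B"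
    and "sq_integrable M \<phi> \<Longrightarrow> (\<lambda>n. \<integral>x. g n x * \<phi> x \<partial>M) \<longlonglongrightarrow> (\<integral>x. g0 x * \<phi> x \<partial>M)"
proof -
  have lim2: "AE x in M. (\<lambda>n. (g n x)\<^sup>2) \<longlonglongrightarrow> (g0 x)\<^sup>2"
    using lim by eventually_elim (intro tendsto_intros)
  have F: "integrable M (\<lambda>x. (g0 x)\<^sup>2)" "(\<integral>x. (g0 x)\<^sup>2 \<partial>M) \<le> B"
    using Fatou_bounded[of M "\<lambda>n x. (g n x)\<^sup>2" "\<lambda>x. (g0 x)\<^sup>2" B] g g0 lim2 B
    by (auto simp: sq_integrable_def)
  show s0: "sq_integrable M g0" using F g0 by (simp add: sq_integrable_def)
  show "(\<integral>x. (g0 x)\<^sup>2 \<partial>M) \<le> B" by fact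
  assume \<phi>: "sq_integrable M \<phi>"
  have dd: "sq_integrable M (\<lambda>x. g n x - g0 x)" for n by (intro sq_integrable_diff g s0)
  have sq: "integrable M (\<lambda>x. (g n x - g0 x)\<^sup>2)" for n
    using dd[of n] by (simp add: sq_integrable_def)
  have le: "(\<integral>x. (g n x - g0 x)\<^sup>2 \<partial>M) \<le> 4 * B" for n
  proof -
    have "(\<integral>x. (g n x - g0 x)\<^sup>2 \<partial>M) \<le> (\<integral>x. 2 * (g n x)\<^sup>2 + 2 * (g0 x)\<^sup>2 \<partial>M)"
    proof (rule integral_mono)
      show "(a - b)\<^sup>2 \<le> 2 * a\<^sup>2 + 2 * b\<^sup>2" for a b :: real
        using sum_squares_bound[of a "-b"] by (simp add: power2_diff)
    qed (use sq g s0 in \<open>auto simp: sq_integrable_def\<close>)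
    also have "\<dots> = 2 * (\<integral>x. (g n x)\<^sup>2 \<partial>M) + 2 * (\<integral>x. (g0 x)\<^sup>2 \<partial>M)"
      using g s0 by (simp add: sq_integrable_def)
    also have "\<dots> \<le> 4 * B" using B[of n] F(2) by simp
    finally show ?thesis .
  qed
  have lim_abs: "(\<lambda>n. \<integral>x. \<bar>(g n x - g0 x) * \<phi> x\<bar> \<partial>M) \<longlonglongrightarrow> 0"
  proof (rule almost_dominated_convergence(2)[where h="\<lambda>n x. (g n x - g0 x) * \<phi> x"
        and g="\<lambda>n x. (g n x - g0 x)\<^sup>2" and B="4 * B" and M=M])
    show "(\<lambda>x. (g n x - g0 x) * \<phi> x) \<in> borel_measurable M" for n
      using g[of n] g0 \<phi> by (auto simp: sq_integrable_def)
    show "AE x in M. (\<lambda>n. (g n x - g0 x) * \<phi> x) \<longlonglongrightarrow> 0"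
      using lim by eventually_elim (auto intro!: tendsto_mult_left_zero simp: LIM_zero)
    fix e :: real assume e: "e > 0"
    have ab: "\<bar>a * b\<bar> \<le> e * a\<^sup>2 + (1 / e) * b\<^sup>2" for a b :: real
    proof -
      have "0 \<le> (sqrt e * \<bar>a\<bar> - \<bar>b\<bar> / sqrt e)\<^sup>2" by simp
      also have "\<dots> = e * a\<^sup>2 + (1 / e) * b\<^sup>2 - 2 * (\<bar>a\<bar> * \<bar>b\<bar>)"
        using e by (simp add: power2_diff power_mult_distrib power_divide)
      finally show ?thesis
        using mult_nonneg_nonneg[OF abs_ge_zero[of a] abs_ge_zero[of b]] unfolding abs_mult by linarith
    qed
    show "\<exists>\<Phi>. integrable M \<Phi> \<and> (\<forall>n. AE x in M. \<bar>(g n x - g0 x) * \<phi> x\<bar> \<le> e * (g n x - g0 x)\<^sup>2 + \<Phi> x)"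
      using \<phi> ab by (intro exI[of _ "\<lambda>x. (1/e) * (\<phi> x)\<^sup>2"]) (auto simp: sq_integrable_def)
  qed (use sq le in auto)
  have "(\<integral>x. (g n x - g0 x) * \<phi> x \<partial>M) = (\<integral>x. g n x * \<phi> x \<partial>M) - (\<integral>x. g0 x * \<phi> x \<partial>M)" for n
    using sq_integrable_mult[OF g \<phi>] sq_integrable_mult[OF s0 \<phi>] by (simp add: left_diff_distrib)
  then have "\<bar>(\<integral>x. g n x * \<phi> x \<partial>M) - (\<integral>x. g0 x * \<phi> x \<partial>M)\<bar> \<le> (\<integral>x. \<bar>(g n x - g0 x) * \<phi> x\<bar> \<partial>M)" for n
    using integral_abs_bound[of M "\<lambda>x. (g n x - g0 x) * \<phi> x"] by simp
  then have "(\<lambda>n. (\<integral>x. g n x * \<phi> x \<partial>M) - (\<integral>x. g0 x * \<phi> x \<partial>M)) \<longlonglongrightarrow> 0"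
    by (intro Lim_null_comparison[OF _ lim_abs] always_eventually allI) simp
  then show "(\<lambda>n. \<integral>x. g n x * \<phi> x \<partial>M) \<longlonglongrightarrow> (\<integral>x. g0 x * \<phi> x \<partial>M)"
    by (simp add: LIM_zero_iff)
qed

section \<open>The fractional Sobolev space\<close>

text \<open>
  The signed square root of the Gagliardo kernel. It is linear in \<open>u\<close>, so that the fractional Sobolev space
  is a space of pairs of square integrable functions, and the seminorm comes from an inner product.
\<close>

definition diff_quot :: "real \<Rightarrow> (real ^ 'n \<Rightarrow> real) \<Rightarrow> (real ^ 'n) \<times> (real ^ 'n) \<Rightarrow> real" where
  "diff_quot \<alpha> u = (\<lambda>(x, y). (u x - u y) / norm (x - y) powr ((real CARD('n) + \<alpha>) / 2))"

lemma gagliardo_kernel_eq_square: "gagliardo_kernel \<alpha> u = (\<lambda>z. (diff_quot \<alpha> u z)\<^sup>2)"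
proof -
  have "(t powr (a / 2))\<^sup>2 = t powr a" for t a :: real
    by (simp add: power2_eq_square powr_add[symmetric])
  then show ?thesis
    by (auto simp: gagliardo_kernel_def diff_quot_def power_divide)
qed

lemma borel_measurable_lebesgue_id:
  "(\<lambda>x::'a::euclidean_space. x) \<in> borel_measurable lebesgue"
  by (intro measurable_completion) simp

lemma borel_measurable_diff_quot:
  assumes [measurable]: "u \<in> borel_measurable lebesgue"
  shows "diff_quot \<alpha> u \<in> borel_measurable (lebesgue \<Otimes>\<^sub>M lebesgue)"
proof -
  have [measurable]: "(\<lambda>z. fst z) \<in> borel_measurable (lebesgue \<Otimes>\<^sub>M (lebesgue :: (real^'n) measure))"
    using measurable_compose[OF measurable_fst borel_measurable_lebesgue_id] .
  have [measurable]: "(\<lambda>z. snd z) \<in> borel_measurable ((lebesgue :: (real^'n) measure) \<Otimes>\<^sub>M lebesgue)"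
    using measurable_compose[OF measurable_snd borel_measurable_lebesgue_id] .
  have [measurable]: "(\<lambda>z. u (fst z)) \<in> borel_measurable (lebesgue \<Otimes>\<^sub>M (lebesgue :: (real^'n) measure))"
    using measurable_compose[OF measurable_fst assms] .
  have [measurable]: "(\<lambda>z. u (snd z)) \<in> borel_measurable ((lebesgue :: (real^'n) measure) \<Otimes>\<^sub>M lebesgue)"
    using measurable_compose[OF measurable_snd assms] .
  show ?thesis unfolding diff_quot_def case_prod_beta by measurable
qed

lemma frac_sobolev_iff:
  "u \<in> frac_sobolev \<alpha> \<longleftrightarrow>
     sq_integrable lebesgue u \<and> sq_integrable (lebesgue \<Otimes>\<^sub>M lebesgue) (diff_quot \<alpha> u)"
  by (auto simp: frac_sobolev_def sq_integrable_def gagliardo_kernel_eq_square borel_measurable_diff_quot)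

lemma gagliardo_eq: "gagliardo \<alpha> u = (\<integral>z. (diff_quot \<alpha> u z)\<^sup>2 \<partial>(lebesgue \<Otimes>\<^sub>M lebesgue))"
  by (simp add: gagliardo_def gagliardo_kernel_eq_square)

lemma gagliardo_nonneg: "0 \<le> gagliardo \<alpha> u"
  unfolding gagliardo_eq by (rule Bochner_Integration.integral_nonneg) simp

lemma diff_quot_add: "diff_quot \<alpha> (\<lambda>x. u x + v x) = (\<lambda>z. diff_quot \<alpha> u z + diff_quot \<alpha> v z)"
  by (auto simp: diff_quot_def add_divide_distrib[symmetric])

lemma diff_quot_diff: "diff_quot \<alpha> (\<lambda>x. u x - v x) = (\<lambda>z. diff_quot \<alpha> u z - diff_quot \<alpha> v z)"
  by (auto simp: diff_quot_def diff_divide_distrib[symmetric])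

lemma diff_quot_cmult: "diff_quot \<alpha> (\<lambda>x. t * u x) = (\<lambda>z. t * diff_quot \<alpha> u z)"
  by (auto simp: diff_quot_def right_diff_distrib)

lemma frac_sobolev_add:
  "u \<in> frac_sobolev \<alpha> \<Longrightarrow> v \<in> frac_sobolev \<alpha> \<Longrightarrow> (\<lambda>x. u x + v x) \<in> frac_sobolev \<alpha>"
  by (simp add: frac_sobolev_iff diff_quot_add sq_integrable_add)

lemma frac_sobolev_diff:
  "u \<in> frac_sobolev \<alpha> \<Longrightarrow> v \<in> frac_sobolev \<alpha> \<Longrightarrow> (\<lambda>x. u x - v x) \<in> frac_sobolev \<alpha>"
  by (simp add: frac_sobolev_iff diff_quot_diff sq_integrable_diff)

lemma frac_sobolev_cmult: "u \<in> frac_sobolev \<alpha> \<Longrightarrow> (\<lambda>x. t * u x) \<in> frac_sobolev \<alpha>"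
  by (simp add: frac_sobolev_iff diff_quot_cmult sq_integrable_cmult)

lemma frac_sobolev_sq_integrable: "u \<in> frac_sobolev \<alpha> \<Longrightarrow> sq_integrable lebesgue u"
  by (simp add: frac_sobolev_iff)

lemma frac_sobolev_integrable_square: "u \<in> frac_sobolev \<alpha> \<Longrightarrow> integrable lebesgue (\<lambda>x. (u x)\<^sup>2)"
  by (simp add: frac_sobolev_iff sq_integrable_def)

lemma frac_sobolev_measurable: "u \<in> frac_sobolev \<alpha> \<Longrightarrow> u \<in> borel_measurable lebesgue"
  by (simp add: frac_sobolev_def)

lemma integral_square_nonneg: "0 \<le> (\<integral>x. (u x :: real)\<^sup>2 \<partial>M)"
  by (rule Bochner_Integration.integral_nonneg) simp

lemma frac_sobolev_norm_square:
  "(frac_sobolev_norm \<alpha> u)\<^sup>2 = (\<integral>x. (u x)\<^sup>2 \<partial>lebesgue) + gagliardo \<alpha> u"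
  by (simp add: frac_sobolev_norm_def gagliardo_nonneg integral_square_nonneg)

lemma frac_sobolev_norm_nonneg: "0 \<le> frac_sobolev_norm \<alpha> u"
  by (simp add: frac_sobolev_norm_def gagliardo_nonneg integral_square_nonneg)

lemma frac_sobolev_norm_cmult: "frac_sobolev_norm \<alpha> (\<lambda>x. t * u x) = \<bar>t\<bar> * frac_sobolev_norm \<alpha> u"
proof -
  have "(frac_sobolev_norm \<alpha> (\<lambda>x. t * u x))\<^sup>2 = (\<bar>t\<bar> * frac_sobolev_norm \<alpha> u)\<^sup>2"
    by (simp add: frac_sobolev_norm_square power_mult_distrib gagliardo_eq diff_quot_cmult distrib_left)
  then show ?thesis
    by (rule power2_eq_imp_eq) (simp_all add: frac_sobolev_norm_nonneg)
qed

lemma integral_square_le_norm: "(\<integral>x. (u x)\<^sup>2 \<partial>lebesgue) \<le> (frac_sobolev_norm \<alpha> u)\<^sup>2"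
  by (simp add: frac_sobolev_norm_square gagliardo_nonneg)

lemma gagliardo_le_norm: "gagliardo \<alpha> u \<le> (frac_sobolev_norm \<alpha> u)\<^sup>2"
  by (simp add: frac_sobolev_norm_square integral_square_nonneg)

lemma diff_quot_translation: "diff_quot \<alpha> (\<lambda>x. u (x + z)) = (\<lambda>(x, y). diff_quot \<alpha> u (x + z, y + z))"
  by (auto simp: diff_quot_def)

lemma frac_sobolev_translation:
  fixes u :: "real ^ 'n \<Rightarrow> real"
  assumes u: "u \<in> frac_sobolev \<alpha>"
  shows "(\<lambda>x. u (x + z)) \<in> frac_sobolev \<alpha>"
    and "gagliardo \<alpha> (\<lambda>x. u (x + z)) = gagliardo \<alpha> u"
    and "frac_sobolev_norm \<alpha> (\<lambda>x. u (x + z)) = frac_sobolev_norm \<alpha> u"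
proof -
  let ?T = "\<lambda>(x::real^'n, y::real^'n). (x + z, y + z)"
  let ?P = "lebesgue \<Otimes>\<^sub>M lebesgue :: ((real^'n) \<times> (real^'n)) measure"
  have T: "?T \<in> ?P \<rightarrow>\<^sub>M ?P"
    by (simp add: case_prod_beta measurable_pair_iff o_def measurable_compose[OF measurable_fst measurable_lebesgue_translation]
          measurable_compose[OF measurable_snd measurable_lebesgue_translation])
  have um: "u \<in> borel_measurable lebesgue" using u by (rule frac_sobolev_measurable)
  have um': "(\<lambda>x. u (x + z)) \<in> borel_measurable lebesgue"
    using measurable_compose[OF measurable_lebesgue_translation um] .
  have sq: "(\<lambda>x. (u x)\<^sup>2) \<in> borel_measurable lebesgue" using um by simp
  have d2: "(\<lambda>w. (diff_quot \<alpha> u w)\<^sup>2) \<in> borel_measurable ?P"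
    using borel_measurable_diff_quot[OF um] by simp
  have eq: "(diff_quot \<alpha> (\<lambda>x. u (x + z)) w)\<^sup>2 = (diff_quot \<alpha> u (?T w))\<^sup>2" for w
    by (auto simp: diff_quot_translation split: prod.split)
  have "integrable ?P (\<lambda>w. (diff_quot \<alpha> u (?T w))\<^sup>2) \<longleftrightarrow> integrable ?P (\<lambda>w. (diff_quot \<alpha> u w)\<^sup>2)"
    using integrable_distr_eq[OF T d2] by (simp add: distr_lebesgue_pair_translation)
  then show mem: "(\<lambda>x. u (x + z)) \<in> frac_sobolev \<alpha>"
    using u um' integral_lebesgue_translation(2)[OF sq, of z] borel_measurable_diff_quot[OF um']
    by (simp add: frac_sobolev_iff sq_integrable_def eq)
  show g: "gagliardo \<alpha> (\<lambda>x. u (x + z)) = gagliardo \<alpha> u"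
    using integral_distr[OF T d2] by (simp add: distr_lebesgue_pair_translation gagliardo_eq eq)
  show "frac_sobolev_norm \<alpha> (\<lambda>x. u (x + z)) = frac_sobolev_norm \<alpha> u"
    using integral_lebesgue_translation(1)[OF sq, of z] by (simp add: frac_sobolev_norm_def g)
qed

lemma gagliardo_kernel_integral_fst:
  assumes "u \<in> frac_sobolev \<alpha>"
  shows "AE x in lebesgue. integrable lebesgue (\<lambda>y. (diff_quot \<alpha> u (x, y))\<^sup>2)"
    and "integrable lebesgue (\<lambda>x. \<integral>y. (diff_quot \<alpha> u (x, y))\<^sup>2 \<partial>lebesgue)"
    and "(\<integral>x. (\<integral>y. (diff_quot \<alpha> u (x, y))\<^sup>2 \<partial>lebesgue) \<partial>lebesgue) = gagliardo \<alpha> u"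
proof -
  have i: "integrable (lebesgue \<Otimes>\<^sub>M lebesgue) (\<lambda>z. (diff_quot \<alpha> u z)\<^sup>2)"
    using assms by (simp add: frac_sobolev_iff sq_integrable_def)
  show "AE x in lebesgue. integrable lebesgue (\<lambda>y. (diff_quot \<alpha> u (x, y))\<^sup>2)"
    using leb2.AE_integrable_fst'[OF i] .
  show "integrable lebesgue (\<lambda>x. \<integral>y. (diff_quot \<alpha> u (x, y))\<^sup>2 \<partial>lebesgue)"
    using leb2.integrable_fst'[OF i] .
  show "(\<integral>x. (\<integral>y. (diff_quot \<alpha> u (x, y))\<^sup>2 \<partial>lebesgue) \<partial>lebesgue) = gagliardo \<alpha> u"
    using leb2.integral_fst'[OF i] by (simp add: gagliardo_eq)
qed


section \<open>Dyadic averages\<close>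

text \<open>
  The dyadic cube of side \<open>2\<^sup>-\<^sup>k\<close> that contains \<open>x\<close>, as the class of an equivalence relation. Integrals over all
  of space can then be treated pointwise in \<open>x\<close>, without sums over cubes.
\<close>

definition cell :: "nat \<Rightarrow> real ^ 'n \<Rightarrow> (real ^ 'n) set" where
  "cell k x = {y. \<forall>i. \<lfloor>2 ^ k * y $ i\<rfloor> = \<lfloor>2 ^ k * x $ i\<rfloor>}"

lemma cell_eq: "y \<in> cell k x \<Longrightarrow> cell k y = cell k x"
  by (auto simp: cell_def)

lemma cell_Suc_subset: "cell (Suc k) x \<subseteq> cell k x"
proof -
  have "\<lfloor>s\<rfloor> = \<lfloor>t\<rfloor>" if "\<lfloor>2 * s\<rfloor> = \<lfloor>2 * t\<rfloor>" for s t :: real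
  proof -
    have "2 * \<lfloor>r\<rfloor> \<le> \<lfloor>2 * r\<rfloor>" "\<lfloor>2 * r\<rfloor> \<le> 2 * \<lfloor>r\<rfloor> + 1" for r :: real by linarith+
    from this[of s] this[of t] that show ?thesis by presburger
  qed
  moreover have "\<lfloor>2 * (2 ^ k * y $ i)\<rfloor> = \<lfloor>2 * (2 ^ k * x $ i)\<rfloor>" if "y \<in> cell (Suc k) x" for y i
    using that by (simp add: cell_def mult.assoc)
  ultimately show ?thesis unfolding cell_def[of k] by blast
qed

lemma cell_antimono: "m \<le> k \<Longrightarrow> cell k x \<subseteq> cell m x"
  by (rule lift_Suc_antimono_le[where f="\<lambda>k. cell k x"]) (use cell_Suc_subset in auto)

lemma cell_diameter:
  fixes x y :: "real ^ 'n"
  assumes "y \<in> cell k x"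
  shows "norm (x - y) \<le> real CARD('n) / 2 ^ k"
proof -
  have "norm (x - y) \<le> (\<Sum>i\<in>UNIV. \<bar>(x - y) $ i\<bar>)" by (rule norm_le_l1_cart)
  also have "\<dots> \<le> (\<Sum>i\<in>(UNIV::'n set). 1 / 2 ^ k)"
  proof (rule sum_mono)
    fix i
    have "\<lfloor>2 ^ k * y $ i\<rfloor> = \<lfloor>2 ^ k * x $ i\<rfloor>" using assms by (simp add: cell_def)
    then have "\<bar>2 ^ k * x $ i - 2 ^ k * y $ i\<bar> \<le> 1" by linarith
    then have "2 ^ k * \<bar>x $ i - y $ i\<bar> \<le> 1" by (simp add: right_diff_distrib[symmetric] abs_mult)
    then show "\<bar>(x - y) $ i\<bar> \<le> 1 / 2 ^ k" by (simp add: field_simps)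
  qed
  finally show ?thesis by simp
qed

lemma cell_borel: "cell k (x :: real ^ 'b) \<in> sets borel"
proof -
  have [measurable]: "(\<lambda>y::real^'b. y $ i) \<in> borel_measurable borel" for i
    by (intro borel_measurable_continuous_onI continuous_intros)
  have "cell k x = {y\<in>space borel. \<forall>i. \<lfloor>2 ^ k * y $ i\<rfloor> = \<lfloor>2 ^ k * x $ i\<rfloor>}" by (simp add: cell_def)
  also have "\<dots> \<in> sets borel" by measurable
  finally show ?thesis .
qed

lemma cell_sets [measurable]: "cell k x \<in> sets lebesgue"
  using cell_borel[of k x] by auto

text \<open>
  The half-open cube lies between an open and a closed box of the same volume.
\<close>

lemma emeasure_cell: "emeasure lebesgue (cell k (x :: real ^ 'n)) = ennreal (1 / 2 ^ (k * CARD('n)))"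
proof -
  define a :: "real ^ 'n" where "a = (\<chi> i. real_of_int \<lfloor>2 ^ k * x $ i\<rfloor> / 2 ^ k)"
  define b :: "real ^ 'n" where "b = (\<chi> i. (real_of_int \<lfloor>2 ^ k * x $ i\<rfloor> + 1) / 2 ^ k)"
  have sub1: "box a b \<subseteq> cell k x"
  proof
    fix y assume y: "y \<in> box a b"
    have "\<lfloor>2 ^ k * y $ i\<rfloor> = \<lfloor>2 ^ k * x $ i\<rfloor>" for i
    proof -
      have "a $ i < y $ i" "y $ i < b $ i" using y by (auto simp: mem_box_cart)
      then show ?thesis by (intro floor_unique) (auto simp: a_def b_def field_simps)
    qed
    then show "y \<in> cell k x" by (simp add: cell_def)
  qed
  have sub2: "cell k x \<subseteq> cbox a b"
  proof
    fix y assume y: "y \<in> cell k x"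
    have "a $ i \<le> y $ i \<and> y $ i \<le> b $ i" for i
    proof -
      have "\<lfloor>2 ^ k * y $ i\<rfloor> = \<lfloor>2 ^ k * x $ i\<rfloor>" using y by (simp add: cell_def)
      then have "real_of_int \<lfloor>2 ^ k * x $ i\<rfloor> \<le> 2 ^ k * y $ i" "2 ^ k * y $ i \<le> real_of_int \<lfloor>2 ^ k * x $ i\<rfloor> + 1"
        by linarith+
      then show ?thesis by (simp add: a_def b_def field_simps)
    qed
    then show "y \<in> cbox a b" by (simp add: mem_box_cart)
  qed
  have len: "(b - a) \<bullet> e = 1 / 2 ^ k" if "e \<in> Basis" for e
    using that by (auto simp: Basis_vec_def inner_axis a_def b_def field_simps)
  then have le: "a \<bullet> e \<le> b \<bullet> e" if "e \<in> Basis" for e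
    using that by (metis inner_diff_left diff_ge_0_iff_ge zero_le_divide_1_iff zero_le_power zero_le_numeral)
  have prod: "(\<Prod>e\<in>(Basis::(real^'n) set). (b - a) \<bullet> e) = 1 / 2 ^ (k * CARD('n))"
    by (simp add: len power_one_over power_mult)
  have "emeasure lebesgue (box a b) = ennreal (1 / 2 ^ (k * CARD('n)))"
    using emeasure_lborel_box[OF le] prod by simp
  moreover have "emeasure lebesgue (cbox a b) = ennreal (1 / 2 ^ (k * CARD('n)))"
    using emeasure_lborel_cbox[OF le] prod by simp
  ultimately show ?thesis
    using emeasure_mono[OF sub1 cell_sets] emeasure_mono[OF sub2, of lebesgue]
    by (intro antisym) auto
qed

lemma sq_integrable_indicator_cell: "sq_integrable lebesgue (indicat_real (cell k x))"
proof -
  have "integrable lebesgue (indicat_real (cell k x))"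
    by (intro integrable_real_indicator cell_sets) (simp add: emeasure_cell)
  moreover have "(\<lambda>y. (indicat_real (cell k x) y)\<^sup>2) = indicat_real (cell k x)"
    by (auto simp: indicator_def)
  ultimately show ?thesis by (simp add: sq_integrable_def)
qed

text \<open>The scaling factor is the reciprocal of the measure of the cell.\<close>

definition avg :: "nat \<Rightarrow> (real ^ 'n \<Rightarrow> real) \<Rightarrow> real ^ 'n \<Rightarrow> real" where
  "avg k u x = 2 ^ (k * CARD('n)) * (\<integral>y. indicator (cell k x) y * u y \<partial>lebesgue)"

lemma avg_cong_cell: "y \<in> cell k x \<Longrightarrow> avg k u y = avg k u x"
  by (simp add: avg_def cell_eq)

lemma integrable_cell:
  assumes "sq_integrable lebesgue u"
  shows "integrable lebesgue (\<lambda>y. indicator (cell k x) y * u y)"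
    and "integrable lebesgue (\<lambda>y. indicator (cell k x) y * (u y)\<^sup>2)"
    and "integrable lebesgue (\<lambda>y. indicator (cell k x) y * (c - u y)\<^sup>2)"
proof -
  show 1: "integrable lebesgue (\<lambda>y. indicator (cell k x) y * u y)"
    using sq_integrable_mult[OF sq_integrable_indicator_cell assms] .
  show 2: "integrable lebesgue (\<lambda>y. indicator (cell k x) y * (u y)\<^sup>2)"
    using assms integrable_mult_indicator[OF cell_sets, where f="\<lambda>y. (u y)\<^sup>2"]
    by (simp add: sq_integrable_def)
  have 3: "integrable lebesgue (indicat_real (cell k x))"
    by (intro integrable_real_indicator cell_sets) (simp add: emeasure_cell)
  have "(\<lambda>y. indicator (cell k x) y * (c - u y)\<^sup>2) =
      (\<lambda>y. c\<^sup>2 * indicator (cell k x) y - 2 * c * (indicator (cell k x) y * u y) + indicator (cell k x) y * (u y)\<^sup>2)"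
    by (rule ext) (simp add: power2_diff algebra_simps)
  then show "integrable lebesgue (\<lambda>y. indicator (cell k x) y * (c - u y)\<^sup>2)"
    using 1 2 3 by simp
qed

text \<open>
  Jensen's inequality: as functions of \<open>c\<close>, the two sides differ by a constant, and at \<open>c = avg k u x\<close> the
  left one vanishes.
\<close>

lemma avg_Jensen:
  fixes u :: "real ^ 'n \<Rightarrow> real"
  assumes u: "sq_integrable lebesgue u"
  shows "(c - avg k u x)\<^sup>2 \<le> 2 ^ (k * CARD('n)) * (\<integral>y. indicator (cell k x) y * (c - u y)\<^sup>2 \<partial>lebesgue)"
proof -
  let ?m = "2 ^ (k * CARD('n)) :: real"
  let ?I = "\<lambda>y. indicat_real (cell k x) y"
  define s where "s = ?m * (\<integral>y. ?I y * (u y)\<^sup>2 \<partial>lebesgue)"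
  have 3: "integrable lebesgue ?I"
    by (intro integrable_real_indicator cell_sets) (simp add: emeasure_cell)
  have one: "?m * (\<integral>y. ?I y \<partial>lebesgue) = 1"
    by (simp add: measure_def emeasure_cell)
  have expand: "?m * (\<integral>y. ?I y * (a - u y)\<^sup>2 \<partial>lebesgue) = a\<^sup>2 - 2 * a * avg k u x + s" for a
  proof -
    have "(\<integral>y. ?I y * (a - u y)\<^sup>2 \<partial>lebesgue)
        = (\<integral>y. a\<^sup>2 * ?I y - 2 * a * (?I y * u y) + ?I y * (u y)\<^sup>2 \<partial>lebesgue)"
      by (rule Bochner_Integration.integral_cong) (simp_all add: power2_diff algebra_simps)
    also have "\<dots> = a\<^sup>2 * (\<integral>y. ?I y \<partial>lebesgue) - 2 * a * (\<integral>y. ?I y * u y \<partial>lebesgue) + (\<integral>y. ?I y * (u y)\<^sup>2 \<partial>lebesgue)"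
      using integrable_cell[OF u] 3 by simp
    finally have "?m * (\<integral>y. ?I y * (a - u y)\<^sup>2 \<partial>lebesgue) = ?m * (a\<^sup>2 * (\<integral>y. ?I y \<partial>lebesgue)
        - 2 * a * (\<integral>y. ?I y * u y \<partial>lebesgue) + (\<integral>y. ?I y * (u y)\<^sup>2 \<partial>lebesgue))"
      by (rule arg_cong)
    also have "\<dots> = a\<^sup>2 * (?m * (\<integral>y. ?I y \<partial>lebesgue)) - 2 * a * avg k u x + s"
      by (simp only: s_def avg_def) (simp only: distrib_left right_diff_distrib mult.left_commute mult.assoc)
    finally have "?m * (\<integral>y. ?I y * (a - u y)\<^sup>2 \<partial>lebesgue)
       = a\<^sup>2 * (?m * (\<integral>y. ?I y \<partial>lebesgue)) - 2 * a * avg k u x + s" .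
    then show ?thesis unfolding one by simp
  qed
  have "0 \<le> ?m * (\<integral>y. ?I y * (avg k u x - u y)\<^sup>2 \<partial>lebesgue)"
    by (intro mult_nonneg_nonneg Bochner_Integration.integral_nonneg) auto
  then have "(avg k u x)\<^sup>2 \<le> s"
    unfolding expand by (simp add: power2_eq_square)
  then show ?thesis unfolding expand by (simp add: power2_diff)
qed

lemma avg_square_le:
  fixes u :: "real ^ 'n \<Rightarrow> real"
  assumes "sq_integrable lebesgue u"
  shows "(avg k u x)\<^sup>2 \<le> 2 ^ (k * CARD('n)) * (\<integral>y. indicator (cell k x) y * (u y)\<^sup>2 \<partial>lebesgue)"
  using avg_Jensen[OF assms, of 0 k x] by simp

lemma cell_integral_square_mono:
  assumes u: "sq_integrable lebesgue u" and "m \<le> k"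
  shows "(\<integral>y. indicator (cell k x) y * (u y)\<^sup>2 \<partial>lebesgue) \<le> (\<integral>y. indicator (cell m x) y * (u y)\<^sup>2 \<partial>lebesgue)"
    and "(\<integral>y. indicator (cell k x) y * (u y)\<^sup>2 \<partial>lebesgue) \<le> (\<integral>y. (u y)\<^sup>2 \<partial>lebesgue)"
proof -
  show "(\<integral>y. indicator (cell k x) y * (u y)\<^sup>2 \<partial>lebesgue) \<le> (\<integral>y. indicator (cell m x) y * (u y)\<^sup>2 \<partial>lebesgue)"
    using cell_antimono[OF \<open>m \<le> k\<close>, of x]
    by (intro integral_mono integrable_cell u) (auto simp: indicator_def)
  show "(\<integral>y. indicator (cell k x) y * (u y)\<^sup>2 \<partial>lebesgue) \<le> (\<integral>y. (u y)\<^sup>2 \<partial>lebesgue)"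
    using u by (intro integral_mono integrable_cell u) (auto simp: indicator_def sq_integrable_def)
qed

lemma borel_measurable_avg:
  fixes u :: "real ^ 'n \<Rightarrow> real"
  assumes [measurable]: "u \<in> borel_measurable lebesgue"
  shows "avg k u \<in> borel_measurable lebesgue"
proof -
  let ?P = "lebesgue \<Otimes>\<^sub>M lebesgue :: ((real^'n) \<times> (real^'n)) measure"
  have c: "(\<lambda>x::real^'n. x $ i) \<in> borel_measurable lebesgue" for i :: 'n
  proof (rule measurable_completion)
    have "(\<lambda>x::real^'n. x $ i) \<in> borel_measurable borel"
      by (intro borel_measurable_continuous_onI continuous_intros)
    then show "(\<lambda>x::real^'n. x $ i) \<in> borel_measurable lborel" by simp
  qed
  have [measurable]: "(\<lambda>z. fst z $ i :: real) \<in> borel_measurable ?P" for i :: 'n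
    by (rule measurable_compose[OF measurable_fst c])
  have [measurable]: "(\<lambda>z. snd z $ i :: real) \<in> borel_measurable ?P" for i :: 'n
    by (rule measurable_compose[OF measurable_snd c])
  have [measurable]: "(\<lambda>z. u (snd z)) \<in> borel_measurable ?P"
    using measurable_compose[OF measurable_snd assms] .
  have "{z\<in>space ?P. \<forall>i. \<lfloor>2 ^ k * snd z $ i\<rfloor> = \<lfloor>2 ^ k * fst z $ i\<rfloor>}
      \<in> sets ?P" (is "?S \<in> _")
    by measurable
  then have [measurable]: "indicat_real ?S \<in> borel_measurable ?P"
    by (rule borel_measurable_indicator)
  have "(\<lambda>z. indicat_real ?S z * u (snd z)) \<in> borel_measurable ?P" by measurable
  moreover have "(\<lambda>z. indicat_real ?S z * u (snd z)) = (\<lambda>(x, y). indicator (cell k x) y * u y)"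
    by (auto simp: indicator_def cell_def space_pair_measure)
  ultimately have "(\<lambda>(x, y). indicator (cell k x) y * u y) \<in> borel_measurable ?P"
    by simp
  from leb.borel_measurable_lebesgue_integral[OF this]
  show ?thesis unfolding avg_def[abs_def] by simp
qed

text \<open>
  The deviation from the average on a cell of side \<open>2\<^sup>-\<^sup>k\<close> only sees the Gagliardo kernel at distances
  of order \<open>2\<^sup>-\<^sup>k\<close>, where it is large.
\<close>

lemma avg_deviation:
  fixes u :: "real ^ 'n \<Rightarrow> real"
  assumes u: "u \<in> frac_sobolev \<alpha>" and \<alpha>: "\<alpha> > 0"
  defines "A \<equiv> real CARD('n) powr (real CARD('n) + \<alpha>)"
  shows "sq_integrable lebesgue (\<lambda>x. u x - avg k u x)"
    and "(\<integral>x. (u x - avg k u x)\<^sup>2 \<partial>lebesgue) \<le> A * 2 powr (- \<alpha> * real k) * gagliardo \<alpha> u"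
proof -
  let ?N = "real CARD('n)"
  let ?m = "2 ^ (k * CARD('n)) :: real"
  let ?J = "\<lambda>x. \<integral>y. (diff_quot \<alpha> u (x, y))\<^sup>2 \<partial>lebesgue"
  have sq: "sq_integrable lebesgue u" using u by (rule frac_sobolev_sq_integrable)
  have um: "u \<in> borel_measurable lebesgue" using u by (rule frac_sobolev_measurable)
  have N: "?N > 0" by simp
  \<comment> \<open>The volume of the cell and the kernel at its diameter combine to the factor \<open>2 powr (- \<alpha> k)\<close>.\<close>
  have const: "?m * (?N / 2 ^ k) powr (?N + \<alpha>) = A * 2 powr (- \<alpha> * real k)"
  proof -
    have "(?N / 2 ^ k) powr (?N + \<alpha>) = ?N powr (?N + \<alpha>) / (2 powr real k) powr (?N + \<alpha>)"
      by (simp add: powr_divide powr_realpow)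
    moreover have "?m = 2 powr (real k * ?N)"
      by (simp add: powr_realpow[symmetric])
    moreover have "2 powr (real k * ?N) / (2 powr real k) powr (?N + \<alpha>) = 2 powr (- \<alpha> * real k)"
      by (simp add: powr_powr powr_diff[symmetric] algebra_simps)
    ultimately show ?thesis by (simp add: A_def field_simps)
  qed
  have pt: "AE x in lebesgue. (u x - avg k u x)\<^sup>2 \<le> A * 2 powr (- \<alpha> * real k) * ?J x"
    using gagliardo_kernel_integral_fst(1)[OF u]
  proof eventually_elim
    case (elim x)
    have "(u x - avg k u x)\<^sup>2 \<le> ?m * (\<integral>y. indicator (cell k x) y * (u x - u y)\<^sup>2 \<partial>lebesgue)"
      by (rule avg_Jensen[OF sq])
    also have "\<dots> \<le> ?m * (\<integral>y. (?N / 2 ^ k) powr (?N + \<alpha>) * (diff_quot \<alpha> u (x, y))\<^sup>2 \<partial>lebesgue)"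
    proof (intro mult_left_mono integral_mono)
      show "integrable lebesgue (\<lambda>y. indicator (cell k x) y * (u x - u y)\<^sup>2)"
        by (rule integrable_cell[OF sq])
      show "integrable lebesgue (\<lambda>y. (?N / 2 ^ k) powr (?N + \<alpha>) * (diff_quot \<alpha> u (x, y))\<^sup>2)"
        using elim by simp
      fix y
      show "indicator (cell k x) y * (u x - u y)\<^sup>2 \<le> (?N / 2 ^ k) powr (?N + \<alpha>) * (diff_quot \<alpha> u (x, y))\<^sup>2"
      proof (cases "y \<in> cell k x \<and> x \<noteq> y")
        case True
        then have le: "norm (x - y) powr (?N + \<alpha>) \<le> (?N / 2 ^ k) powr (?N + \<alpha>)"
          using cell_diameter[of y k x] \<alpha> by (intro powr_mono2) auto
        have pos: "norm (x - y) powr (?N + \<alpha>) > 0" using True by simp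
        have "(diff_quot \<alpha> u (x, y))\<^sup>2 = (u x - u y)\<^sup>2 / norm (x - y) powr (?N + \<alpha>)"
          using gagliardo_kernel_eq_square[of \<alpha> u] by (simp add: gagliardo_kernel_def fun_eq_iff)
        then have "(u x - u y)\<^sup>2 = norm (x - y) powr (?N + \<alpha>) * (diff_quot \<alpha> u (x, y))\<^sup>2"
          using pos by simp
        also have "\<dots> \<le> (?N / 2 ^ k) powr (?N + \<alpha>) * (diff_quot \<alpha> u (x, y))\<^sup>2"
          by (intro mult_right_mono le) simp
        finally show ?thesis using True by simp
      qed auto
    qed auto
    also have "\<dots> = A * 2 powr (- \<alpha> * real k) * ?J x" unfolding const[symmetric] by simp
    finally show ?case .
  qed
  have meas: "(\<lambda>x. u x - avg k u x) \<in> borel_measurable lebesgue"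
    using um borel_measurable_avg[OF um] by simp
  have iJ: "integrable lebesgue (\<lambda>x. A * 2 powr (- \<alpha> * real k) * ?J x)"
    using gagliardo_kernel_integral_fst(2)[OF u] by simp
  have int: "integrable lebesgue (\<lambda>x. (u x - avg k u x)\<^sup>2)"
    by (rule Bochner_Integration.integrable_bound[OF iJ]) (use meas pt in auto)
  then show "sq_integrable lebesgue (\<lambda>x. u x - avg k u x)" using meas by (simp add: sq_integrable_def)
  have "(\<integral>x. (u x - avg k u x)\<^sup>2 \<partial>lebesgue) \<le> (\<integral>x. A * 2 powr (- \<alpha> * real k) * ?J x \<partial>lebesgue)"
    by (rule integral_mono_AE[OF int iJ pt])
  also have "\<dots> = A * 2 powr (- \<alpha> * real k) * gagliardo \<alpha> u"
    using gagliardo_kernel_integral_fst(3)[OF u] by simp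
  finally show "(\<integral>x. (u x - avg k u x)\<^sup>2 \<partial>lebesgue) \<le> A * 2 powr (- \<alpha> * real k) * gagliardo \<alpha> u" .
qed

section \<open>Subcritical Sobolev inequality\<close>

lemma powr_add_le:
  fixes a b p :: real
  assumes "p > 0"
  shows "\<bar>a + b\<bar> powr p \<le> 2 powr p * (\<bar>a\<bar> powr p + \<bar>b\<bar> powr p)"
proof -
  have "\<bar>a + b\<bar> powr p \<le> (2 * max \<bar>a\<bar> \<bar>b\<bar>) powr p"
    using assms by (intro powr_mono2) auto
  also have "\<dots> = 2 powr p * (max \<bar>a\<bar> \<bar>b\<bar>) powr p" by (simp add: powr_mult)
  also have "\<dots> \<le> 2 powr p * (\<bar>a\<bar> powr p + \<bar>b\<bar> powr p)"
    by (intro mult_left_mono) (auto simp: max_def)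
  finally show ?thesis .
qed

lemma powr_two: "0 \<le> (x::real) \<Longrightarrow> x powr 2 = x\<^sup>2"
  by (rule powr_numeral)

lemma two_powr_mult_nat: "2 powr (a * real k) = (2 powr a :: real) ^ k"
  by (simp add: powr_powr[symmetric] powr_realpow)

lemma abs_powr_eq: "p > 2 \<Longrightarrow> \<bar>t :: real\<bar> powr p = t\<^sup>2 * (t\<^sup>2) powr ((p - 2) / 2)"
proof -
  assume p: "p > 2"
  have "\<bar>t\<bar> powr 2 = t\<^sup>2" using powr_two[of "\<bar>t\<bar>"] by simp
  then have "\<bar>t\<bar> powr p = (t\<^sup>2) powr (p / 2)"
    using powr_powr[of "\<bar>t\<bar>" 2 "p / 2"] by simp
  also have "\<dots> = t\<^sup>2 * (t\<^sup>2) powr (p / 2 - 1)" by (subst powr_mult_base) auto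
  also have "p / 2 - 1 = (p - 2) / 2" by (simp add: field_simps)
  finally show ?thesis .
qed

lemma Lp_bound_from_sup:
  fixes g :: "'a \<Rightarrow> real"
  assumes g: "sq_integrable M g" and S: "\<And>x. (g x)\<^sup>2 \<le> S" and p: "p > 2"
  shows "integrable M (\<lambda>x. \<bar>g x\<bar> powr p)"
    and "(\<integral>x. \<bar>g x\<bar> powr p \<partial>M) \<le> S powr ((p - 2) / 2) * (\<integral>x. (g x)\<^sup>2 \<partial>M)"
proof -
  have le: "\<bar>g x\<bar> powr p \<le> S powr ((p - 2) / 2) * (g x)\<^sup>2" for x
  proof -
    have "((g x)\<^sup>2) powr ((p - 2) / 2) \<le> S powr ((p - 2) / 2)"
      using S p by (intro powr_mono2) auto
    then have "(g x)\<^sup>2 * ((g x)\<^sup>2) powr ((p - 2) / 2) \<le> (g x)\<^sup>2 * S powr ((p - 2) / 2)"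
      by (rule mult_left_mono) simp
    then show ?thesis using abs_powr_eq[OF p, of "g x"] by (simp add: mult.commute)
  qed
  have i: "integrable M (\<lambda>x. S powr ((p - 2) / 2) * (g x)\<^sup>2)"
    using g by (simp add: sq_integrable_def)
  show int: "integrable M (\<lambda>x. \<bar>g x\<bar> powr p)"
    by (rule Bochner_Integration.integrable_bound[OF i]) (use g le in \<open>auto simp: sq_integrable_def\<close>)
  have "(\<integral>x. \<bar>g x\<bar> powr p \<partial>M) \<le> (\<integral>x. S powr ((p - 2) / 2) * (g x)\<^sup>2 \<partial>M)"
    by (rule integral_mono[OF int i le])
  then show "(\<integral>x. \<bar>g x\<bar> powr p \<partial>M) \<le> S powr ((p - 2) / 2) * (\<integral>x. (g x)\<^sup>2 \<partial>M)" by simp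
qed

text \<open>
  A substitute for Minkowski's inequality: every term is at most its weight times one common number, the
  \<open>p\<close>-th root of the last sum. Slowly decaying geometric weights cost nothing against faster geometric decay.
\<close>

lemma sum_powr_le_weighted:
  fixes a w :: "nat \<Rightarrow> real"
  assumes fin: "finite F" and w: "\<And>k. w k > 0" and p: "p > 0"
  shows "\<bar>\<Sum>k\<in>F. a k\<bar> powr p \<le> (\<Sum>k\<in>F. w k) powr p * (\<Sum>k\<in>F. (\<bar>a k\<bar> / w k) powr p)"
proof -
  define R where "R = (\<Sum>k\<in>F. (\<bar>a k\<bar> / w k) powr p)"
  have R0: "R \<ge> 0" unfolding R_def by (intro sum_nonneg) auto
  have "\<bar>a k\<bar> \<le> w k * R powr (1 / p)" if "k \<in> F" for k
  proof -
    have "(\<bar>a k\<bar> / w k) powr p \<le> R" unfolding R_def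
      by (rule member_le_sum[OF that]) (use fin in auto)
    then have "((\<bar>a k\<bar> / w k) powr p) powr (1 / p) \<le> R powr (1 / p)"
      using p by (intro powr_mono2) auto
    then have "\<bar>a k\<bar> / w k \<le> R powr (1 / p)" using p w[of k] by (simp add: powr_powr)
    then show ?thesis using w[of k] by (simp add: field_simps)
  qed
  then have "\<bar>\<Sum>k\<in>F. a k\<bar> \<le> (\<Sum>k\<in>F. w k * R powr (1 / p))"
    by (intro order_trans[OF sum_abs] sum_mono)
  also have "\<dots> = (\<Sum>k\<in>F. w k) * R powr (1 / p)" by (simp add: sum_distrib_right)
  finally have "\<bar>\<Sum>k\<in>F. a k\<bar> powr p \<le> ((\<Sum>k\<in>F. w k) * R powr (1 / p)) powr p"
    using p by (intro powr_mono2) auto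
  also have "\<dots> = (\<Sum>k\<in>F. w k) powr p * R"
    using p R0 w by (simp add: powr_mult powr_powr sum_nonneg less_imp_le)
  finally show ?thesis unfolding R_def .
qed

lemma avg_square_integral:
  fixes u :: "real ^ 'n \<Rightarrow> real"
  assumes u: "u \<in> frac_sobolev \<alpha>" and \<alpha>: "\<alpha> > 0"
  defines "A \<equiv> real CARD('n) powr (real CARD('n) + \<alpha>)"
  shows "sq_integrable lebesgue (avg k u)"
    and "(\<integral>x. (avg k u x)\<^sup>2 \<partial>lebesgue) \<le> (2 + 2 * A) * (frac_sobolev_norm \<alpha> u)\<^sup>2"
proof -
  have sq: "sq_integrable lebesgue u" using u by (rule frac_sobolev_sq_integrable)
  have dev: "sq_integrable lebesgue (\<lambda>x. u x - avg k u x)" by (rule avg_deviation[OF u \<alpha>])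
  show s: "sq_integrable lebesgue (avg k u)"
    using sq_integrable_diff[OF sq dev] by simp
  have "(\<integral>x. (avg k u x)\<^sup>2 \<partial>lebesgue) \<le> (\<integral>x. 2 * (u x)\<^sup>2 + 2 * (u x - avg k u x)\<^sup>2 \<partial>lebesgue)"
  proof (rule integral_mono)
    have "b\<^sup>2 \<le> 2 * a\<^sup>2 + 2 * (a - b)\<^sup>2" for a b :: real
      using zero_le_power2[of "2 * a - b"] by (simp add: power2_diff power_mult_distrib)
    then show "(avg k u x)\<^sup>2 \<le> 2 * (u x)\<^sup>2 + 2 * (u x - avg k u x)\<^sup>2" for x .
  qed (use sq dev s in \<open>auto simp: sq_integrable_def\<close>)
  also have "\<dots> = 2 * (\<integral>x. (u x)\<^sup>2 \<partial>lebesgue) + 2 * (\<integral>x. (u x - avg k u x)\<^sup>2 \<partial>lebesgue)"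
    using sq dev by (simp add: sq_integrable_def)
  also have "\<dots> \<le> 2 * (frac_sobolev_norm \<alpha> u)\<^sup>2 + 2 * (A * (frac_sobolev_norm \<alpha> u)\<^sup>2)"
  proof (intro add_mono mult_left_mono integral_square_le_norm)
    have "(\<integral>x. (u x - avg k u x)\<^sup>2 \<partial>lebesgue) \<le> A * 2 powr (- \<alpha> * real k) * gagliardo \<alpha> u"
      unfolding A_def by (rule avg_deviation[OF u \<alpha>])
    also have "\<dots> \<le> A * 1 * (frac_sobolev_norm \<alpha> u)\<^sup>2"
    proof (intro mult_mono gagliardo_le_norm)
      have "2 powr (- \<alpha> * real k) \<le> 2 powr 0" using \<alpha> by (intro powr_mono) auto
      then show "2 powr (- \<alpha> * real k) \<le> 1" by simp
    qed (auto simp: A_def gagliardo_nonneg)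
    finally show "(\<integral>x. (u x - avg k u x)\<^sup>2 \<partial>lebesgue) \<le> A * (frac_sobolev_norm \<alpha> u)\<^sup>2" by simp
  qed auto
  also have "\<dots> = (2 + 2 * A) * (frac_sobolev_norm \<alpha> u)\<^sup>2" by (simp add: algebra_simps)
  finally show "(\<integral>x. (avg k u x)\<^sup>2 \<partial>lebesgue) \<le> (2 + 2 * A) * (frac_sobolev_norm \<alpha> u)\<^sup>2" .
qed

text \<open>
  A function that is constant on cells of measure \<open>2\<^sup>-\<^sup>N\<^sup>k\<close> is bounded by \<open>2\<^sup>N\<^sup>k\<^sup>/\<^sup>2\<close> times its \<open>L\<^sup>2\<close> norm.
  Against the gain \<open>2\<^sup>-\<^sup>\<alpha>\<^sup>k\<close> of the square deviation, the resulting \<open>L\<^sup>p\<close> bound decays geometrically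
  exactly when \<open>p\<close> is subcritical.
\<close>

lemma avg_increment_Lp:
  fixes u :: "real ^ 'n \<Rightarrow> real"
  assumes u: "u \<in> frac_sobolev \<alpha>" and \<alpha>: "\<alpha> > 0" and p: "p > 2"
  defines "A \<equiv> real CARD('n) powr (real CARD('n) + \<alpha>)"
  defines "\<beta> \<equiv> \<alpha> - (real CARD('n) - \<alpha>) * ((p - 2) / 2)"
  shows "integrable lebesgue (\<lambda>x. \<bar>avg (Suc k) u x - avg k u x\<bar> powr p)"
    and "(\<integral>x. \<bar>avg (Suc k) u x - avg k u x\<bar> powr p \<partial>lebesgue)
          \<le> 4 * A * (2 ^ CARD('n) * A) powr ((p - 2) / 2) * 2 powr (- \<beta> * real k) * frac_sobolev_norm \<alpha> u powr p"
proof -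
  let ?N = "real CARD('n)"
  let ?D = "\<lambda>x. avg (Suc k) u x - avg k u x"
  let ?G = "gagliardo \<alpha> u"
  let ?n = "frac_sobolev_norm \<alpha> u"
  define S where "S = 2 ^ (Suc k * CARD('n)) * (A * 2 powr (- \<alpha> * real k) * ?G)"
  have A: "A > 0" by (simp add: A_def)
  have sq: "sq_integrable lebesgue u" using u by (rule frac_sobolev_sq_integrable)
  have dev: "sq_integrable lebesgue (\<lambda>x. u x - avg j u x)" for j by (rule avg_deviation[OF u \<alpha>])
  have dev_le: "(\<integral>x. (u x - avg j u x)\<^sup>2 \<partial>lebesgue) \<le> A * 2 powr (- \<alpha> * real j) * ?G" for j
    unfolding A_def by (rule avg_deviation[OF u \<alpha>])
  have D: "sq_integrable lebesgue ?D"
    using sq_integrable_diff[OF dev[of k] dev[of "Suc k"]] by simp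
  have sup: "(?D x)\<^sup>2 \<le> S" for x
  proof -
    have "(?D x)\<^sup>2 = (avg k u x - avg (Suc k) u x)\<^sup>2" by (simp add: power2_commute)
    also have "\<dots> \<le> 2 ^ (Suc k * CARD('n)) * (\<integral>y. indicator (cell (Suc k) x) y * (avg k u x - u y)\<^sup>2 \<partial>lebesgue)"
      by (rule avg_Jensen[OF sq])
    also have "\<dots> \<le> 2 ^ (Suc k * CARD('n)) * (\<integral>y. (u y - avg k u y)\<^sup>2 \<partial>lebesgue)"
    proof (intro mult_left_mono integral_mono)
      show "integrable lebesgue (\<lambda>y. indicator (cell (Suc k) x) y * (avg k u x - u y)\<^sup>2)"
        by (rule integrable_cell[OF sq])
      show "integrable lebesgue (\<lambda>y. (u y - avg k u y)\<^sup>2)" using dev[of k] by (simp add: sq_integrable_def)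
      fix y show "indicator (cell (Suc k) x) y * (avg k u x - u y)\<^sup>2 \<le> (u y - avg k u y)\<^sup>2"
      proof (cases "y \<in> cell (Suc k) x")
        case True
        then have "avg k u y = avg k u x" using cell_Suc_subset avg_cong_cell by blast
        then show ?thesis using True by (simp add: power2_commute)
      qed simp
    qed auto
    also have "\<dots> \<le> S" unfolding S_def by (intro mult_left_mono dev_le) auto
    finally show ?thesis .
  qed
  show "integrable lebesgue (\<lambda>x. \<bar>?D x\<bar> powr p)" by (rule Lp_bound_from_sup(1)[OF D sup p])
  have pw: "2 powr (- \<alpha> * real (Suc k)) \<le> 2 powr (- \<alpha> * real k)" using \<alpha> by (intro powr_mono) (auto simp: algebra_simps)
  have "(\<integral>x. (?D x)\<^sup>2 \<partial>lebesgue) \<le> (\<integral>x. 2 * (u x - avg k u x)\<^sup>2 + 2 * (u x - avg (Suc k) u x)\<^sup>2 \<partial>lebesgue)"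
  proof (rule integral_mono)
    have "(b - a)\<^sup>2 \<le> 2 * (c - a)\<^sup>2 + 2 * (c - b)\<^sup>2" for a b c :: real
      using zero_le_power2[of "(c - a) + (c - b)"] by (simp add: power2_eq_square algebra_simps)
    then show "(?D x)\<^sup>2 \<le> 2 * (u x - avg k u x)\<^sup>2 + 2 * (u x - avg (Suc k) u x)\<^sup>2" for x .
  qed (use D dev[of k] dev[of "Suc k"] in \<open>auto simp: sq_integrable_def\<close>)
  also have "\<dots> = 2 * (\<integral>x. (u x - avg k u x)\<^sup>2 \<partial>lebesgue) + 2 * (\<integral>x. (u x - avg (Suc k) u x)\<^sup>2 \<partial>lebesgue)"
    using dev[of k] dev[of "Suc k"] by (simp add: sq_integrable_def)
  also have "\<dots> \<le> 2 * (A * 2 powr (- \<alpha> * real k) * ?G) + 2 * (A * 2 powr (- \<alpha> * real (Suc k)) * ?G)"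
    using dev_le[of k] dev_le[of "Suc k"] by linarith
  also have "\<dots> \<le> 2 * (A * 2 powr (- \<alpha> * real k) * ?G) + 2 * (A * 2 powr (- \<alpha> * real k) * ?G)"
    using pw A gagliardo_nonneg[of \<alpha> u] by (intro add_mono mult_left_mono mult_right_mono order_refl) auto
  finally have D2: "(\<integral>x. (?D x)\<^sup>2 \<partial>lebesgue) \<le> 4 * A * 2 powr (- \<alpha> * real k) * ?G" by (simp add: mult_ac)
  have Seq: "S = (2 ^ CARD('n) * A) * 2 powr ((?N - \<alpha>) * real k) * ?G"
  proof -
    have "(2::real) ^ (Suc k * CARD('n)) = 2 ^ CARD('n) * 2 powr (?N * real k)"
      by (simp add: power_add powr_realpow[symmetric] mult.commute)
    then have "S = (2 ^ CARD('n) * 2 powr (?N * real k)) * (A * 2 powr (- \<alpha> * real k) * ?G)"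
      by (simp only: S_def)
    also have "\<dots> = (2 ^ CARD('n) * A) * (2 powr (?N * real k) * 2 powr (- \<alpha> * real k)) * ?G"
      by (simp only: mult_ac)
    also have "2 powr (?N * real k) * 2 powr (- \<alpha> * real k) = 2 powr ((?N - \<alpha>) * real k)"
      by (simp add: powr_add[symmetric] algebra_simps)
    finally show ?thesis .
  qed
  have "(\<integral>x. \<bar>?D x\<bar> powr p \<partial>lebesgue) \<le> S powr ((p - 2) / 2) * (\<integral>x. (?D x)\<^sup>2 \<partial>lebesgue)"
    by (rule Lp_bound_from_sup(2)[OF D sup p])
  also have "\<dots> \<le> S powr ((p - 2) / 2) * (4 * A * 2 powr (- \<alpha> * real k) * ?G)"
    by (intro mult_left_mono D2) auto
  also have "S powr ((p - 2) / 2) = (2 ^ CARD('n) * A) powr ((p - 2) / 2) * 2 powr ((?N - \<alpha>) * ((p - 2) / 2) * real k) * ?G powr ((p - 2) / 2)"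
    unfolding Seq using A gagliardo_nonneg[of \<alpha> u] by (simp add: powr_mult powr_powr mult_ac)
  also have "(2 ^ CARD('n) * A) powr ((p - 2) / 2) * 2 powr ((?N - \<alpha>) * ((p - 2) / 2) * real k) * ?G powr ((p - 2) / 2)
        * (4 * A * 2 powr (- \<alpha> * real k) * ?G)
      = 4 * A * (2 ^ CARD('n) * A) powr ((p - 2) / 2) * (2 powr ((?N - \<alpha>) * ((p - 2) / 2) * real k) * 2 powr (- \<alpha> * real k))
        * (?G * ?G powr ((p - 2) / 2))" by (simp only: mult_ac)
  also have "2 powr ((?N - \<alpha>) * ((p - 2) / 2) * real k) * 2 powr (- \<alpha> * real k) = 2 powr (- \<beta> * real k)"
    unfolding powr_add[symmetric] \<beta>_def by (simp add: algebra_simps)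
  also have "?G * ?G powr ((p - 2) / 2) = ?G powr (p / 2)"
    using gagliardo_nonneg[of \<alpha> u] by (simp add: powr_mult_base) (simp add: field_simps)
  also have "4 * A * (2 ^ CARD('n) * A) powr ((p - 2) / 2) * 2 powr (- \<beta> * real k) * ?G powr (p / 2)
     \<le> 4 * A * (2 ^ CARD('n) * A) powr ((p - 2) / 2) * 2 powr (- \<beta> * real k) * ?n powr p"
  proof (intro mult_left_mono)
    have "?G powr (p / 2) \<le> (?n\<^sup>2) powr (p / 2)"
      using p gagliardo_nonneg gagliardo_le_norm by (intro powr_mono2) auto
    also have "\<dots> = ?n powr p"
      using powr_powr[of ?n 2 "p/2"] powr_two[OF frac_sobolev_norm_nonneg, of \<alpha> u]
      by simp
    finally show "?G powr (p / 2) \<le> ?n powr p" .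
  qed (use A in auto)
  finally show "(\<integral>x. \<bar>?D x\<bar> powr p \<partial>lebesgue)
          \<le> 4 * A * (2 ^ CARD('n) * A) powr ((p - 2) / 2) * 2 powr (- \<beta> * real k) * ?n powr p" .
qed

lemma geometric_tail_le:
  fixes r :: real
  assumes "0 < r" "r < 1"
  shows "(\<Sum>k\<in>{m..<j}. r ^ k) \<le> r ^ m / (1 - r)"
proof (cases "m \<le> j")
  case True
  have "(1 - r) * (\<Sum>k\<in>{m..<j}. r ^ k) = r ^ m - r ^ j"
    using True
  proof (induction j rule: dec_induct)
    case (step j)
    have "(\<Sum>k\<in>{m..<Suc j}. r ^ k) = (\<Sum>k\<in>{m..<j}. r ^ k) + r ^ j" using step.hyps by simp
    then have "(1 - r) * (\<Sum>k\<in>{m..<Suc j}. r ^ k) = (r ^ m - r ^ j) + (1 - r) * r ^ j"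
      using step.IH by (simp only: distrib_left)
    then show ?case by (simp add: algebra_simps)
  qed simp
  then have "(\<Sum>k\<in>{m..<j}. r ^ k) = (r ^ m - r ^ j) / (1 - r)" using assms by (simp add: field_simps)
  also have "\<dots> \<le> r ^ m / (1 - r)" using assms by (intro divide_right_mono) auto
  finally show ?thesis .
qed (use assms in auto)

lemma avg_converges_AE_subseq:
  fixes u :: "real ^ 'n \<Rightarrow> real"
  assumes u: "u \<in> frac_sobolev \<alpha>" and \<alpha>: "\<alpha> > 0"
  obtains r :: "nat \<Rightarrow> nat" where "strict_mono r" "AE x in lebesgue. (\<lambda>j. avg (r j) u x) \<longlonglongrightarrow> u x"
proof -
  let ?A = "real CARD('n) powr (real CARD('n) + \<alpha>)"
  have "(\<lambda>k. 2 powr (- \<alpha> * real k)) = (\<lambda>k. (2 powr (- \<alpha>)) ^ k)"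
    by (simp only: two_powr_mult_nat)
  moreover have "(\<lambda>k. (2 powr (- \<alpha>)) ^ k) \<longlonglongrightarrow> 0"
    using \<alpha> powr_less_mono[of "-\<alpha>" 0 2] by (intro LIMSEQ_power_zero) auto
  ultimately have l: "(\<lambda>k. 2 powr (- \<alpha> * real k)) \<longlonglongrightarrow> 0" by simp
  have lim0: "(\<lambda>k. ?A * 2 powr (- \<alpha> * real k) * gagliardo \<alpha> u) \<longlonglongrightarrow> 0"
    using tendsto_mult[OF tendsto_mult[OF tendsto_const[of ?A] l] tendsto_const[of "gagliardo \<alpha> u"]] by simp
  have "(\<lambda>k. \<integral>x. norm ((u x - avg k u x)\<^sup>2) \<partial>lebesgue) \<longlonglongrightarrow> 0"
    by (rule Lim_null_comparison[OF _ lim0])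
       (use avg_deviation(2)[OF u \<alpha>] integral_square_nonneg in auto)
  then obtain r where r: "strict_mono r" "AE x in lebesgue. (\<lambda>j. (u x - avg (r j) u x)\<^sup>2) \<longlonglongrightarrow> 0"
    using tendsto_L1_AE_subseq[of lebesgue "\<lambda>k x. (u x - avg k u x)\<^sup>2"] avg_deviation(1)[OF u \<alpha>]
    by (auto simp: sq_integrable_def)
  have "AE x in lebesgue. (\<lambda>j. avg (r j) u x) \<longlonglongrightarrow> u x"
    using r(2)
  proof eventually_elim
    case (elim x)
    then have "(\<lambda>j. sqrt ((u x - avg (r j) u x)\<^sup>2)) \<longlonglongrightarrow> sqrt 0" by (intro tendsto_intros)
    then have "(\<lambda>j. u x - avg (r j) u x) \<longlonglongrightarrow> 0" by (simp add: tendsto_rabs_zero_iff)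
    then have "(\<lambda>j. u x - (u x - avg (r j) u x)) \<longlonglongrightarrow> u x - 0" by (intro tendsto_intros)
    then show ?case by simp
  qed
  with r(1) that show ?thesis by blast
qed

lemma tendsto_abs_powr:
  fixes f :: "'a \<Rightarrow> real"
  assumes "(f \<longlongrightarrow> l) F" "p > 0"
  shows "((\<lambda>n. \<bar>f n\<bar> powr p) \<longlongrightarrow> \<bar>l\<bar> powr p) F"
  using assms by (intro tendsto_powr2 tendsto_rabs tendsto_const) auto

text \<open>
  The deviation is the telescoping sum of the increments at all finer scales. With weights that decay at half
  the exponential rate of the \<open>L\<^sup>p\<close> norms of the increments, finite sums are bounded by a geometric series, and
  Fatou's lemma yields the full sum.
\<close>

lemma avg_deviation_Lp:
  assumes \<alpha>: "0 < \<alpha>" "\<alpha> < real CARD('n)" and p: "2 < p" "p * (real CARD('n) - \<alpha>) < 2 * real CARD('n)"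
  shows "\<exists>C \<rho> :: real. C \<ge> 0 \<and> 0 < \<rho> \<and> \<rho> < 1 \<and> (\<forall>u m. (u :: real ^ 'n \<Rightarrow> real) \<in> frac_sobolev \<alpha> \<longrightarrow>
       integrable lebesgue (\<lambda>x. \<bar>u x - avg m u x\<bar> powr p) \<and>
       (\<integral>x. \<bar>u x - avg m u x\<bar> powr p \<partial>lebesgue) \<le> C * \<rho> ^ m * frac_sobolev_norm \<alpha> u powr p)"
proof -
  let ?A = "real CARD('n) powr (real CARD('n) + \<alpha>)"
  define \<beta> where "\<beta> = \<alpha> - (real CARD('n) - \<alpha>) * ((p - 2) / 2)"
  have \<beta>: "\<beta> > 0" using p by (simp add: \<beta>_def algebra_simps)
  \<comment> \<open>\<open>\<theta>\<close> gives the weights. Since \<open>\<theta> powr (- p) = 2 powr (\<beta> / 2)\<close>, they spend half of the decay \<open>2 powr (- \<beta>)\<close>, and \<open>\<rho>\<close> is what is left.\<close>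
  define \<theta> where "\<theta> = 2 powr (- (\<beta> / (2 * p)))"
  define \<rho> where "\<rho> = 2 powr (- (\<beta> / 2))"
  have \<theta>: "0 < \<theta>" "\<theta> < 1" using \<beta> p powr_less_mono[of "- (\<beta> / (2 * p))" 0 2] by (auto simp: \<theta>_def)
  have \<rho>: "0 < \<rho>" "\<rho> < 1" using \<beta> powr_less_mono[of "- (\<beta> / 2)" 0 2] by (auto simp: \<rho>_def)
  define C1 where "C1 = 4 * ?A * (2 ^ CARD('n) * ?A) powr ((p - 2) / 2)"
  define C where "C = (1 / (1 - \<theta>)) powr p * C1 / (1 - \<rho>)"
  have C1: "C1 \<ge> 0" by (simp add: C1_def)
  have C: "C \<ge> 0" using C1 \<rho> by (simp add: C_def)
  have main: "integrable lebesgue (\<lambda>x. \<bar>u x - avg m u x\<bar> powr p) \<and>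
      (\<integral>x. \<bar>u x - avg m u x\<bar> powr p \<partial>lebesgue) \<le> C * \<rho> ^ m * frac_sobolev_norm \<alpha> u powr p"
    if u: "u \<in> frac_sobolev \<alpha>" for u :: "real ^ 'n \<Rightarrow> real" and m
  proof -
    let ?n = "frac_sobolev_norm \<alpha> u"
    define D where "D = (\<lambda>k x. avg (Suc k) u x - avg k u x)"
    have um: "u \<in> borel_measurable lebesgue" using u by (rule frac_sobolev_measurable)
    have D1: "integrable lebesgue (\<lambda>x. \<bar>D k x\<bar> powr p)" for k
      unfolding D_def by (rule avg_increment_Lp(1)[OF u \<alpha>(1) p(1)])
    have D2: "(\<integral>x. \<bar>D k x\<bar> powr p \<partial>lebesgue) \<le> C1 * 2 powr (- \<beta> * real k) * ?n powr p" for k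
      unfolding D_def C1_def \<beta>_def by (rule avg_increment_Lp(2)[OF u \<alpha>(1) p(1)])
    have wk: "(\<bar>d\<bar> / \<theta> ^ k) powr p = 2 powr (\<beta> / 2 * real k) * \<bar>d\<bar> powr p" for d and k :: nat
    proof -
      have "\<theta> ^ k = 2 powr (- (\<beta> / (2 * p)) * real k)"
        unfolding \<theta>_def by (rule two_powr_mult_nat[symmetric])
      then have "(\<theta> ^ k) powr p = 2 powr (- (\<beta> / 2 * real k))"
        using p by (simp add: powr_powr)
      then show ?thesis using \<theta>
        by (simp add: powr_divide powr_minus field_simps)
    qed
    have fin: "integrable lebesgue (\<lambda>x. \<bar>avg j u x - avg m u x\<bar> powr p) \<and>
       (\<integral>x. \<bar>avg j u x - avg m u x\<bar> powr p \<partial>lebesgue) \<le> C * \<rho> ^ m * ?n powr p" if "m \<le> j" for j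
    proof -
      let ?W = "(1 / (1 - \<theta>)) powr p"
      let ?g = "\<lambda>x. ?W * (\<Sum>k\<in>{m..<j}. 2 powr (\<beta> / 2 * real k) * \<bar>D k x\<bar> powr p)"
      have le: "\<bar>avg j u x - avg m u x\<bar> powr p \<le> ?g x" for x
      proof -
        have "avg j u x - avg m u x = (\<Sum>k\<in>{m..<j}. D k x)"
          unfolding D_def using sum_Suc_diff'[OF that, of "\<lambda>k. avg k u x"] by simp
        then have "\<bar>avg j u x - avg m u x\<bar> powr p
            \<le> (\<Sum>k\<in>{m..<j}. \<theta> ^ k) powr p * (\<Sum>k\<in>{m..<j}. (\<bar>D k x\<bar> / \<theta> ^ k) powr p)"
          using sum_powr_le_weighted[of "{m..<j}" "\<lambda>k. \<theta> ^ k" p "\<lambda>k. D k x"] \<theta> p by simp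
        also have "\<dots> \<le> ?W * (\<Sum>k\<in>{m..<j}. (\<bar>D k x\<bar> / \<theta> ^ k) powr p)"
        proof (intro mult_right_mono powr_mono2)
          have "(\<Sum>k\<in>{m..<j}. \<theta> ^ k) \<le> \<theta> ^ m / (1 - \<theta>)" by (rule geometric_tail_le[OF \<theta>])
          also have "\<dots> \<le> 1 / (1 - \<theta>)" using \<theta> by (intro divide_right_mono power_le_one) auto
          finally show "(\<Sum>k\<in>{m..<j}. \<theta> ^ k) \<le> 1 / (1 - \<theta>)" .
        qed (use \<theta> p in \<open>auto intro!: sum_nonneg\<close>)
        finally show ?thesis unfolding wk .
      qed
      have ig: "integrable lebesgue ?g" using D1 by auto
      have int: "integrable lebesgue (\<lambda>x. \<bar>avg j u x - avg m u x\<bar> powr p)"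
        by (rule Bochner_Integration.integrable_bound[OF ig])
           (use le borel_measurable_avg[OF um] in \<open>auto intro!: order_trans[OF le]\<close>)
      have "(\<integral>x. \<bar>avg j u x - avg m u x\<bar> powr p \<partial>lebesgue) \<le> (\<integral>x. ?g x \<partial>lebesgue)"
        by (rule integral_mono[OF int ig le])
      also have "\<dots> = ?W * (\<Sum>k\<in>{m..<j}. 2 powr (\<beta> / 2 * real k) * (\<integral>x. \<bar>D k x\<bar> powr p \<partial>lebesgue))"
        using D1 by (simp add: Bochner_Integration.integral_sum)
      also have "\<dots> \<le> ?W * (\<Sum>k\<in>{m..<j}. 2 powr (\<beta> / 2 * real k) * (C1 * 2 powr (- \<beta> * real k) * ?n powr p))"
        by (intro mult_left_mono sum_mono D2) auto
      also have "\<dots> = ?W * (\<Sum>k\<in>{m..<j}. C1 * ?n powr p * \<rho> ^ k)"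
      proof -
        have "2 powr (\<beta> / 2 * real k) * 2 powr (- \<beta> * real k) = \<rho> ^ k" for k :: nat
        proof -
          have "2 powr (\<beta> / 2 * real k) * 2 powr (- \<beta> * real k) = 2 powr (- (\<beta> / 2) * real k)"
            unfolding powr_add[symmetric] by (simp add: algebra_simps)
          also have "\<dots> = \<rho> ^ k" unfolding \<rho>_def by (rule two_powr_mult_nat)
          finally show ?thesis .
        qed
        then have "C1 * ?n powr p * (2 powr (\<beta> / 2 * real k) * 2 powr (- \<beta> * real k)) = C1 * ?n powr p * \<rho> ^ k" for k :: nat
          by (simp only:)
        then show ?thesis
          by (intro arg_cong[where f="\<lambda>s. ?W * s"] sum.cong refl) (simp only: mult_ac)
      qed
      also have "\<dots> = ?W * (C1 * ?n powr p * (\<Sum>k\<in>{m..<j}. \<rho> ^ k))" by (simp add: sum_distrib_left)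
      also have "\<dots> \<le> ?W * (C1 * ?n powr p * (\<rho> ^ m / (1 - \<rho>)))"
        using C1 by (intro mult_left_mono geometric_tail_le \<rho>) auto
      also have "\<dots> = C * \<rho> ^ m * ?n powr p" by (simp add: C_def)
      finally show ?thesis using int by simp
    qed
    obtain r where r: "strict_mono r" "AE x in lebesgue. (\<lambda>j. avg (r j) u x) \<longlonglongrightarrow> u x"
      using avg_converges_AE_subseq[OF u \<alpha>(1)] .
    have ge: "m \<le> r (j + m)" for j using seq_suble[OF r(1), of "j + m"] by simp
    have lim: "AE x in lebesgue. (\<lambda>j. \<bar>avg (r (j + m)) u x - avg m u x\<bar> powr p) \<longlonglongrightarrow> \<bar>u x - avg m u x\<bar> powr p"
      using r(2)
    proof eventually_elim
      case (elim x)
      show ?case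
        using LIMSEQ_ignore_initial_segment[OF elim, of m] p
        by (intro tendsto_abs_powr tendsto_diff tendsto_const) auto
    qed
    have "(\<lambda>x. \<bar>u x - avg m u x\<bar> powr p) \<in> borel_measurable lebesgue"
      using um borel_measurable_avg[OF um] by simp
    note F = Fatou_bounded[OF _ _ this lim, where B="C * \<rho> ^ m * ?n powr p"]
    show ?thesis by (intro conjI F) (use fin[OF ge] in auto)
  qed
  show ?thesis using C \<rho> main by blast
qed

text \<open>
  The averages over unit cubes are bounded by the \<open>L\<^sup>2\<close> norm, and the deviation from them is controlled by
  \<open>avg_deviation_Lp\<close>.
\<close>

lemma Sobolev_inequality:
  assumes \<alpha>: "0 < \<alpha>" "\<alpha> < real CARD('n)" and p: "2 < p" "p * (real CARD('n) - \<alpha>) < 2 * real CARD('n)"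
  shows "\<exists>C :: real. C > 0 \<and> (\<forall>u. (u :: real ^ 'n \<Rightarrow> real) \<in> frac_sobolev \<alpha> \<longrightarrow>
       integrable lebesgue (\<lambda>x. \<bar>u x\<bar> powr p) \<and>
       (\<integral>x. \<bar>u x\<bar> powr p \<partial>lebesgue) \<le> C * frac_sobolev_norm \<alpha> u powr p)"
proof -
  obtain C \<rho> :: real where C_\<rho>: "C \<ge> 0 \<and> 0 < \<rho> \<and> \<rho> < 1 \<and> (\<forall>u m. (u :: real ^ 'n \<Rightarrow> real) \<in> frac_sobolev \<alpha> \<longrightarrow>
       integrable lebesgue (\<lambda>x. \<bar>u x - avg m u x\<bar> powr p) \<and>
       (\<integral>x. \<bar>u x - avg m u x\<bar> powr p \<partial>lebesgue) \<le> C * \<rho> ^ m * frac_sobolev_norm \<alpha> u powr p)"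
    using avg_deviation_Lp[OF \<alpha> p] by (elim exE)
  have C: "C \<ge> 0" "0 < \<rho>" "\<rho> < 1" using C_\<rho> by simp_all
  have dev1: "integrable lebesgue (\<lambda>x. \<bar>u x - avg m u x\<bar> powr p)"
    and dev2: "(\<integral>x. \<bar>u x - avg m u x\<bar> powr p \<partial>lebesgue) \<le> C * \<rho> ^ m * frac_sobolev_norm \<alpha> u powr p"
    if "u \<in> frac_sobolev \<alpha>" for u :: "real ^ 'n \<Rightarrow> real" and m
    using C_\<rho> that by simp_all
  let ?A = "real CARD('n) powr (real CARD('n) + \<alpha>)"
  define C' where "C' = 2 powr p * (C + (2 + 2 * ?A))"
  have A: "?A > 0" by simp
  have C': "C' > 0" using C(1) A by (auto simp: C'_def intro!: mult_pos_pos add_nonneg_pos)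
  have main: "integrable lebesgue (\<lambda>x. \<bar>u x\<bar> powr p) \<and>
      (\<integral>x. \<bar>u x\<bar> powr p \<partial>lebesgue) \<le> C' * frac_sobolev_norm \<alpha> u powr p"
    if u: "u \<in> frac_sobolev \<alpha>" for u :: "real ^ 'n \<Rightarrow> real"
  proof -
    let ?n = "frac_sobolev_norm \<alpha> u"
    have um: "u \<in> borel_measurable lebesgue" using u by (rule frac_sobolev_measurable)
    have sup: "(avg 0 u x)\<^sup>2 \<le> ?n\<^sup>2" for x
      using avg_square_le[OF frac_sobolev_sq_integrable[OF u], of 0 x]
        cell_integral_square_mono(2)[OF frac_sobolev_sq_integrable[OF u] order_refl, of 0 x] integral_square_le_norm[of u \<alpha>]
      by simp
    note av = avg_square_integral[OF u \<alpha>(1), of 0]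
    have ia: "integrable lebesgue (\<lambda>x. \<bar>avg 0 u x\<bar> powr p)" by (rule Lp_bound_from_sup(1)[OF av(1) sup p(1)])
    have "(\<integral>x. \<bar>avg 0 u x\<bar> powr p \<partial>lebesgue) \<le> (?n\<^sup>2) powr ((p - 2) / 2) * (\<integral>x. (avg 0 u x)\<^sup>2 \<partial>lebesgue)"
      by (rule Lp_bound_from_sup(2)[OF av(1) sup p(1)])
    also have "\<dots> \<le> (?n\<^sup>2) powr ((p - 2) / 2) * ((2 + 2 * ?A) * ?n\<^sup>2)"
      by (intro mult_left_mono av(2)) auto
    also have "\<dots> = (2 + 2 * ?A) * ?n powr p"
      using abs_powr_eq[OF p(1), of ?n] frac_sobolev_norm_nonneg[of \<alpha> u] by (simp add: mult_ac)
    finally have a: "(\<integral>x. \<bar>avg 0 u x\<bar> powr p \<partial>lebesgue) \<le> (2 + 2 * ?A) * ?n powr p" .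
    let ?g = "\<lambda>x. 2 powr p * (\<bar>u x - avg 0 u x\<bar> powr p + \<bar>avg 0 u x\<bar> powr p)"
    have le: "\<bar>u x\<bar> powr p \<le> ?g x" for x
      using powr_add_le[of p "u x - avg 0 u x" "avg 0 u x"] p by simp
    have ig: "integrable lebesgue ?g" using dev1[OF u, of 0] ia by simp
    have int: "integrable lebesgue (\<lambda>x. \<bar>u x\<bar> powr p)"
      by (rule Bochner_Integration.integrable_bound[OF ig]) (use um le in \<open>auto intro!: AE_I2 order_trans[OF le]\<close>)
    have "(\<integral>x. \<bar>u x\<bar> powr p \<partial>lebesgue) \<le> (\<integral>x. ?g x \<partial>lebesgue)" by (rule integral_mono[OF int ig le])
    also have "\<dots> = 2 powr p * ((\<integral>x. \<bar>u x - avg 0 u x\<bar> powr p \<partial>lebesgue) + (\<integral>x. \<bar>avg 0 u x\<bar> powr p \<partial>lebesgue))"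
      using dev1[OF u, of 0] ia by simp
    also have "\<dots> \<le> 2 powr p * (C * ?n powr p + (2 + 2 * ?A) * ?n powr p)"
      using dev2[OF u, of 0] a by (intro mult_left_mono add_mono) auto
    also have "\<dots> = C' * ?n powr p" by (simp add: C'_def algebra_simps)
    finally show ?thesis using int by simp
  qed
  show ?thesis using C' main by blast
qed

section \<open>Nonvanishing and compactness\<close>

definition unit_cell :: "(real ^ 'n) set" where "unit_cell = cell 0 0"

lemma unit_cell_sets [measurable]: "unit_cell \<in> sets lebesgue"
  by (simp add: unit_cell_def cell_sets)

lemma integrable_unit_cell: "integrable lebesgue (indicat_real (unit_cell :: (real ^ 'n) set))"
  unfolding unit_cell_def by (intro integrable_real_indicator cell_sets) (simp add: emeasure_cell)

lemma integral_unit_cell_translate: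
  fixes u :: "real ^ 'n \<Rightarrow> real" and x :: "real ^ 'n"
  assumes u: "u \<in> borel_measurable lebesgue"
  defines "z \<equiv> (\<chi> i. real_of_int \<lfloor>x $ i\<rfloor>)"
  shows "z \<in> int_lattice"
    and "(\<integral>y. indicator unit_cell y * (u (y + z))\<^sup>2 \<partial>lebesgue) = (\<integral>y. indicator (cell 0 x) y * (u y)\<^sup>2 \<partial>lebesgue)"
proof -
  show "z \<in> int_lattice" by (simp add: z_def int_lattice_def)
  have "y \<in> unit_cell \<longleftrightarrow> y + z \<in> cell 0 x" for y
    by (simp add: unit_cell_def cell_def z_def)
  then have eq: "indicator unit_cell y * (u (y + z))\<^sup>2 = indicator (cell 0 x) (y + z) * (u (y + z))\<^sup>2" for y
    by (simp add: indicator_def)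
  show "(\<integral>y. indicator unit_cell y * (u (y + z))\<^sup>2 \<partial>lebesgue) = (\<integral>y. indicator (cell 0 x) y * (u y)\<^sup>2 \<partial>lebesgue)"
    unfolding eq
    by (rule integral_lebesgue_translation(1)[where g="\<lambda>y. indicator (cell 0 x) y * (u y)\<^sup>2"])
       (intro borel_measurable_times borel_measurable_indicator borel_measurable_power cell_sets u)
qed

text \<open>
  This is Lions' vanishing lemma in quantitative form. At a fixed fine scale the averages carry a definite
  part of the \<open>L\<^sup>p\<close> norm, and a uniformly small function with bounded \<open>L\<^sup>2\<close> norm has small \<open>L\<^sup>p\<close> norm.
\<close>

lemma nonvanishing:
  assumes \<alpha>: "0 < \<alpha>" "\<alpha> < real CARD('n)" and p: "2 < p" "p * (real CARD('n) - \<alpha>) < 2 * real CARD('n)"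
    and \<delta>: "\<delta> > 0"
  shows "\<exists>d > 0. \<forall>u. (u :: real ^ 'n \<Rightarrow> real) \<in> frac_sobolev \<alpha> \<longrightarrow> frac_sobolev_norm \<alpha> u \<le> B \<longrightarrow>
       \<delta> \<le> (\<integral>x. \<bar>u x\<bar> powr p \<partial>lebesgue) \<longrightarrow>
       (\<exists>z\<in>int_lattice. d \<le> (\<integral>x. indicator unit_cell x * (u (x + z))\<^sup>2 \<partial>lebesgue))"
proof -
  obtain C \<rho> :: real where C_\<rho>: "C \<ge> 0 \<and> 0 < \<rho> \<and> \<rho> < 1 \<and> (\<forall>u m. (u :: real ^ 'n \<Rightarrow> real) \<in> frac_sobolev \<alpha> \<longrightarrow>
       integrable lebesgue (\<lambda>x. \<bar>u x - avg m u x\<bar> powr p) \<and>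
       (\<integral>x. \<bar>u x - avg m u x\<bar> powr p \<partial>lebesgue) \<le> C * \<rho> ^ m * frac_sobolev_norm \<alpha> u powr p)"
    using avg_deviation_Lp[OF \<alpha> p] by (elim exE)
  have C: "C \<ge> 0" "0 < \<rho>" "\<rho> < 1" using C_\<rho> by simp_all
  have dev1: "integrable lebesgue (\<lambda>x. \<bar>u x - avg m u x\<bar> powr p)"
    and dev2: "(\<integral>x. \<bar>u x - avg m u x\<bar> powr p \<partial>lebesgue) \<le> C * \<rho> ^ m * frac_sobolev_norm \<alpha> u powr p"
    if "u \<in> frac_sobolev \<alpha>" for u :: "real ^ 'n \<Rightarrow> real" and m
    using C_\<rho> that by simp_all
  let ?N = "CARD('n)"
  define E where "E = 2 + 2 * real CARD('n) powr (real CARD('n) + \<alpha>)"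
  have E: "E > 0" by (simp add: E_def add_pos_nonneg)
  have "(\<lambda>m. \<rho> ^ m) \<longlonglongrightarrow> 0" using C by (intro LIMSEQ_power_zero) auto
  then have "(\<lambda>m. 2 powr p * (C * \<rho> ^ m * (\<bar>B\<bar> powr p))) \<longlonglongrightarrow> 2 powr p * (C * 0 * (\<bar>B\<bar> powr p))"
    by (intro tendsto_mult tendsto_const)
  then have "\<forall>\<^sub>F m in sequentially. 2 powr p * (C * \<rho> ^ m * (\<bar>B\<bar> powr p)) < \<delta> / 2"
    using \<delta> by (intro order_tendstoD(2)[of _ "2 powr p * (C * 0 * (\<bar>B\<bar> powr p))"]) auto
  then obtain m where m: "2 powr p * (C * \<rho> ^ m * (\<bar>B\<bar> powr p)) < \<delta> / 2"
    by (auto simp: eventually_sequentially)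
  \<comment> \<open>If every unit cell has mass less than \<open>d\<close>, the averages contribute at most \<open>\<delta> / 4\<close> to the bound for \<open>\<delta>\<close>; the scale \<open>m\<close> leaves at most \<open>\<delta> / 2\<close> for the deviation.\<close>
  define K where "K = \<delta> / (4 * 2 powr p * E * (B\<^sup>2 + 1))"
  have BB: "B\<^sup>2 + 1 > 0" by (simp add: add_nonneg_pos)
  have K: "K > 0" using \<delta> E BB by (simp add: K_def)
  define d where "d = K powr (2 / (p - 2)) / 2 ^ (m * ?N)"
  have d: "d > 0" using K by (simp add: d_def)
  have dK: "(2 ^ (m * ?N) * d) powr ((p - 2) / 2) = K"
  proof -
    have "2 / (p - 2) * ((p - 2) / 2) = 1" using p by simp
    moreover have "2 ^ (m * ?N) * d = K powr (2 / (p - 2))" by (simp add: d_def)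
    ultimately show ?thesis using K by (simp add: powr_powr del: times_divide_eq_left times_divide_eq_right)
  qed
  show ?thesis
  proof (intro exI[of _ d] conjI d allI impI)
    fix u :: "real ^ 'n \<Rightarrow> real"
    assume u: "u \<in> frac_sobolev \<alpha>" and uB: "frac_sobolev_norm \<alpha> u \<le> B"
      and low: "\<delta> \<le> (\<integral>x. \<bar>u x\<bar> powr p \<partial>lebesgue)"
    let ?n = "frac_sobolev_norm \<alpha> u"
    have um: "u \<in> borel_measurable lebesgue" using u by (rule frac_sobolev_measurable)
    have sq: "sq_integrable lebesgue u" using u by (rule frac_sobolev_sq_integrable)
    have n0: "?n \<ge> 0" by (rule frac_sobolev_norm_nonneg)
    show "\<exists>z\<in>int_lattice. d \<le> (\<integral>x. indicator unit_cell x * (u (x + z))\<^sup>2 \<partial>lebesgue)"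
    proof (rule ccontr)
      assume "\<not> ?thesis"
      then have small: "(\<integral>y. indicator (cell 0 x) y * (u y)\<^sup>2 \<partial>lebesgue) < d" for x
        using integral_unit_cell_translate[OF um, of x] by (auto simp: not_le)
      have sup: "(avg m u x)\<^sup>2 \<le> 2 ^ (m * ?N) * d" for x
      proof -
        have "(avg m u x)\<^sup>2 \<le> 2 ^ (m * ?N) * (\<integral>y. indicator (cell m x) y * (u y)\<^sup>2 \<partial>lebesgue)"
          by (rule avg_square_le[OF sq])
        also have "\<dots> \<le> 2 ^ (m * ?N) * d"
          using cell_integral_square_mono(1)[OF sq, of 0 m x] small[of x] by (intro mult_left_mono) auto
        finally show ?thesis .
      qed
      note av = avg_square_integral[OF u \<alpha>(1), of m]
      have ia: "integrable lebesgue (\<lambda>x. \<bar>avg m u x\<bar> powr p)" by (rule Lp_bound_from_sup(1)[OF av(1) sup p(1)])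
      have "(\<integral>x. \<bar>avg m u x\<bar> powr p \<partial>lebesgue) \<le> K * (\<integral>x. (avg m u x)\<^sup>2 \<partial>lebesgue)"
        using Lp_bound_from_sup(2)[OF av(1) sup p(1)] by (simp add: dK)
      also have "\<dots> \<le> K * (E * ?n\<^sup>2)"
        using av(2) K by (intro mult_left_mono) (auto simp: E_def)
      also have "\<dots> \<le> K * (E * (B\<^sup>2 + 1))"
        using K E power_mono[OF uB n0, of 2] by (intro mult_left_mono) auto
      finally have a: "(\<integral>x. \<bar>avg m u x\<bar> powr p \<partial>lebesgue) \<le> K * (E * (B\<^sup>2 + 1))" .
      let ?g = "\<lambda>x. 2 powr p * (\<bar>u x - avg m u x\<bar> powr p + \<bar>avg m u x\<bar> powr p)"
      have le: "\<bar>u x\<bar> powr p \<le> ?g x" for x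
        using powr_add_le[of p "u x - avg m u x" "avg m u x"] p by simp
      have ig: "integrable lebesgue ?g" using dev1[OF u, of m] ia by simp
      have int: "integrable lebesgue (\<lambda>x. \<bar>u x\<bar> powr p)"
        by (rule Bochner_Integration.integrable_bound[OF ig]) (use um le in \<open>auto intro!: order_trans[OF le]\<close>)
      have "\<delta> \<le> (\<integral>x. ?g x \<partial>lebesgue)" by (rule order_trans[OF low integral_mono[OF int ig le]])
      also have "\<dots> = 2 powr p * (\<integral>x. \<bar>u x - avg m u x\<bar> powr p \<partial>lebesgue) + 2 powr p * (\<integral>x. \<bar>avg m u x\<bar> powr p \<partial>lebesgue)"
        using dev1[OF u, of m] ia by (simp add: distrib_left)
      also have "\<dots> \<le> 2 powr p * (C * \<rho> ^ m * ?n powr p) + 2 powr p * (K * (E * (B\<^sup>2 + 1)))"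
        using dev2[OF u, of m] a by (intro add_mono mult_left_mono) auto
      also have "\<dots> \<le> 2 powr p * (C * \<rho> ^ m * \<bar>B\<bar> powr p) + 2 powr p * (K * (E * (B\<^sup>2 + 1)))"
        using C n0 uB p by (intro add_right_mono mult_left_mono powr_mono2) auto
      also have "2 powr p * (K * (E * (B\<^sup>2 + 1))) = \<delta> / 4"
      proof -
        have "P * (\<delta> / (4 * P * E * X) * (E * X)) = \<delta> / 4" if "P > 0" "X > 0" for P X :: real
          using E that by simp
        then show ?thesis unfolding K_def using BB by simp
      qed
      finally show False using m \<delta> by linarith
    qed
  qed
qed

lemma AE_convergent_diff_quot:
  fixes v :: "nat \<Rightarrow> real ^ 'n \<Rightarrow> real"
  assumes "AE x in lebesgue. (\<lambda>n. v n x) \<longlonglongrightarrow> v0 x"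
  shows "AE z in lebesgue \<Otimes>\<^sub>M lebesgue. (\<lambda>n. diff_quot \<alpha> (v n) z) \<longlonglongrightarrow> diff_quot \<alpha> v0 z"
  using AE_pair_fstI[OF assms] AE_pair_sndI[OF assms]
proof eventually_elim
  case (elim z)
  then show ?case
    unfolding diff_quot_def case_prod_beta divide_inverse
    by (intro tendsto_mult tendsto_diff tendsto_const) auto
qed

lemma frac_sobolev_AE_limit:
  fixes v :: "nat \<Rightarrow> real ^ 'n \<Rightarrow> real"
  assumes v: "\<And>n. v n \<in> frac_sobolev \<alpha>" and B: "\<And>n. frac_sobolev_norm \<alpha> (v n) \<le> B"
    and v0: "v0 \<in> borel_measurable lebesgue" and lim: "AE x in lebesgue. (\<lambda>n. v n x) \<longlonglongrightarrow> v0 x"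
  shows "v0 \<in> frac_sobolev \<alpha>"
proof -
  have "(\<integral>x. (v n x)\<^sup>2 \<partial>lebesgue) \<le> B\<^sup>2" "gagliardo \<alpha> (v n) \<le> B\<^sup>2" for n
    using integral_square_le_norm[of "v n" \<alpha>] gagliardo_le_norm[of \<alpha> "v n"]
      power_mono[OF B frac_sobolev_norm_nonneg, of n 2] by linarith+
  then show ?thesis
    using AE_convergent_imp_weakly_convergent(1)[where B="B\<^sup>2", OF _ _ v0 lim] v
      AE_convergent_imp_weakly_convergent(1)[where B="B\<^sup>2",
        OF _ _ borel_measurable_diff_quot[OF v0] AE_convergent_diff_quot[OF lim], of \<alpha>]
    by (auto simp: frac_sobolev_iff gagliardo_eq)
qed

lemma avg_depends_on_corner:
  fixes u :: "real ^ 'n \<Rightarrow> real" and x :: "real ^ 'n"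
  shows "avg k u x = avg k u (\<chi> i. real_of_int ((\<chi> i. \<lfloor>2 ^ k * x $ i\<rfloor>) $ i) / 2 ^ k)"
  by (rule avg_cong_cell) (simp add: cell_def)

lemma avg_bounded:
  fixes u :: "real ^ 'n \<Rightarrow> real"
  assumes u: "u \<in> frac_sobolev \<alpha>" and B: "frac_sobolev_norm \<alpha> u \<le> B"
  shows "\<bar>avg k u x\<bar> \<le> sqrt (2 ^ (k * CARD('n))) * B"
proof -
  note sq = frac_sobolev_sq_integrable[OF u]
  have B0: "B \<ge> 0" using B frac_sobolev_norm_nonneg[of \<alpha> u] by linarith
  have "(avg k u x)\<^sup>2 \<le> 2 ^ (k * CARD('n)) * (\<integral>y. indicator (cell k x) y * (u y)\<^sup>2 \<partial>lebesgue)"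
    by (rule avg_square_le[OF sq])
  also have "\<dots> \<le> 2 ^ (k * CARD('n)) * B\<^sup>2"
    using cell_integral_square_mono(2)[OF sq order_refl, of k x] integral_square_le_norm[of u \<alpha>]
      power_mono[OF B frac_sobolev_norm_nonneg, of 2] by (intro mult_left_mono) auto
  finally have "sqrt ((avg k u x)\<^sup>2) \<le> sqrt (2 ^ (k * CARD('n)) * B\<^sup>2)" by (rule real_sqrt_le_mono)
  then show ?thesis using B0 by (simp add: real_sqrt_mult)
qed

text \<open>
  There are only countably many averages, one for each scale and each corner of a cube, and each of them is
  bounded along the sequence. A diagonal subsequence makes all of them converge.
\<close>

lemma subseq_averages_converge:
  fixes u :: "nat \<Rightarrow> real ^ 'n \<Rightarrow> real"
  assumes u: "\<And>n. u n \<in> frac_sobolev \<alpha>" and B: "\<And>n. frac_sobolev_norm \<alpha> (u n) \<le> B"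
  shows "\<exists>r :: nat \<Rightarrow> nat. strict_mono r \<and> (\<forall>k x. convergent (\<lambda>n. avg k (u (r n)) x))"
proof -
  define pt where "pt = (\<lambda>(k, m :: int ^ 'n). (k :: nat, (\<chi> i. real_of_int (m $ i) / 2 ^ k) :: real ^ 'n))"
  define a where "a = (\<lambda>j n. avg (fst (pt (from_nat j))) (u n) (snd (pt (from_nat j))))"
  define P where "P = (\<lambda>j s. convergent (\<lambda>n. a j (s n)))"
  have P_iff: "P j s \<longleftrightarrow> convergent (\<lambda>n. a j (s n))" for j s by (simp add: P_def)
  interpret subseqs P
  proof
    fix j and s :: "nat \<Rightarrow> nat" assume "strict_mono s"
    have "bounded (range (\<lambda>n. a j (s n)))"
      unfolding bounded_iff a_def using avg_bounded[OF u B] by auto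
    then obtain l r where "strict_mono (r :: nat \<Rightarrow> nat)" "((\<lambda>n. a j (s n)) \<circ> r) \<longlonglongrightarrow> l"
      using bounded_imp_convergent_subsequence by blast
    then show "\<exists>r. strict_mono r \<and> P j (s \<circ> r)"
      by (auto simp: P_iff convergent_def o_def)
  qed
  have conv: "convergent (\<lambda>n. a j (diagseq n))" for j
  proof -
    have "P j (diagseq \<circ> (+) (Suc j))"
    proof (rule diagseq_holds)
      fix r s :: "nat \<Rightarrow> nat" and n
      assume "strict_mono r" "P n s"
      then show "P n (s \<circ> r)"
        using convergent_subseq_convergent[of "\<lambda>m. a n (s m)" r] by (simp add: P_iff o_def)
    qed
    then show ?thesis
      using convergent_ignore_initial_segment[of "\<lambda>n. a j (diagseq n)" "Suc j"]
      by (simp add: P_iff o_def add.commute)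
  qed
  have "convergent (\<lambda>n. avg k (u (diagseq n)) x)" for k x
  proof -
    have "a (to_nat (k, (\<chi> i. \<lfloor>2 ^ k * x $ i\<rfloor>))) n = avg k (u n) x" for n
      unfolding a_def from_nat_to_nat pt_def split fst_conv snd_conv by (rule avg_depends_on_corner[symmetric])
    then show ?thesis using conv[of "to_nat (k, (\<chi> i. \<lfloor>2 ^ k * x $ i\<rfloor>))"] by simp
  qed
  with subseq_diagseq show ?thesis by blast
qed

text \<open>
  Rellich's theorem, localised by an integrable weight: the averages at a fixed scale converge by dominated
  convergence and approximate the sequence uniformly in \<open>L\<^sup>2\<close>.
\<close>

lemma AE_convergent_subsequence:
  fixes u :: "nat \<Rightarrow> real ^ 'n \<Rightarrow> real"
  assumes \<alpha>: "0 < \<alpha>" and u: "\<And>n. u n \<in> frac_sobolev \<alpha>" and B: "\<And>n. frac_sobolev_norm \<alpha> (u n) \<le> B"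
  shows "\<exists>(r :: nat \<Rightarrow> nat) u0. strict_mono r \<and> u0 \<in> frac_sobolev \<alpha> \<and>
    (AE x in lebesgue. (\<lambda>n. u (r n) x) \<longlonglongrightarrow> u0 x)"
proof -
  obtain s where s: "strict_mono s" "\<And>k x. convergent (\<lambda>n. avg k (u (s n)) x)"
    using subseq_averages_converge[where u=u and B=B and \<alpha>=\<alpha>, OF u B] by blast
  define v where "v = (\<lambda>n. u (s n))"
  have v: "v n \<in> frac_sobolev \<alpha>" and vB: "frac_sobolev_norm \<alpha> (v n) \<le> B" for n
    using u B by (auto simp: v_def)
  have vm: "v n \<in> borel_measurable lebesgue" for n using v by (rule frac_sobolev_measurable)
  obtain w :: "real ^ 'n \<Rightarrow> real" where w: "w \<in> borel_measurable lebesgue" "\<And>x. w x > 0" "\<And>x. w x \<le> 1"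
      "integrable lebesgue w"
    using leb.obtain_positive_integrable_function by blast
  have w2: "(w x)\<^sup>2 \<le> w x" for x
    using mult_left_mono[OF w(3)[of x] less_imp_le[OF w(2)[of x]]] by (simp add: power2_eq_square)
  have sw: "sq_integrable lebesgue w"
    unfolding sq_integrable_def using w w2
    by (auto intro!: Bochner_Integration.integrable_bound[OF w(4)] order_trans[OF w2 abs_ge_self])
  have wv: "integrable lebesgue (\<lambda>x. w x * g x)" if "sq_integrable lebesgue g" for g
    by (rule sq_integrable_mult[OF sw that])
  let ?A = "real CARD('n) powr (real CARD('n) + \<alpha>)"
  let ?W = "\<integral>x. (w x)\<^sup>2 \<partial>lebesgue"
  have dev: "sq_integrable lebesgue (\<lambda>x. v n x - avg k (v n) x)" for n k
    by (rule avg_deviation[OF v \<alpha>])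
  have devB: "(\<integral>x. (v n x - avg k (v n) x)\<^sup>2 \<partial>lebesgue) \<le> ?A * 2 powr (- \<alpha> * real k) * B\<^sup>2" for n k
  proof -
    have "gagliardo \<alpha> (v n) \<le> B\<^sup>2"
      using gagliardo_le_norm[of \<alpha> "v n"] power_mono[OF vB frac_sobolev_norm_nonneg, of n 2] by linarith
    then have "?A * 2 powr (- \<alpha> * real k) * gagliardo \<alpha> (v n) \<le> ?A * 2 powr (- \<alpha> * real k) * B\<^sup>2"
      by (intro mult_left_mono) auto
    with avg_deviation(2)[OF v[of n] \<alpha>, of k] show ?thesis by linarith
  qed
  have young: "(\<integral>x. \<bar>w x * g x\<bar> \<partial>lebesgue) \<le> t * ?W + (1 / t) * (\<integral>x. (g x)\<^sup>2 \<partial>lebesgue)"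
    if g: "sq_integrable lebesgue g" and t: "t > 0" for g and t :: real
  proof -
    have "(\<integral>x. \<bar>w x * g x\<bar> \<partial>lebesgue) \<le> (\<integral>x. t * (w x)\<^sup>2 + (1 / t) * (g x)\<^sup>2 \<partial>lebesgue)"
    proof (rule integral_mono)
      fix x
      have "0 \<le> (sqrt t * \<bar>w x\<bar> - \<bar>g x\<bar> / sqrt t)\<^sup>2" by simp
      also have "\<dots> = t * (w x)\<^sup>2 + (1 / t) * (g x)\<^sup>2 - 2 * (\<bar>w x\<bar> * \<bar>g x\<bar>)"
        using t by (simp add: power2_diff power_mult_distrib power_divide)
      finally show "\<bar>w x * g x\<bar> \<le> t * (w x)\<^sup>2 + (1 / t) * (g x)\<^sup>2"
        using mult_nonneg_nonneg[OF abs_ge_zero[of "w x"] abs_ge_zero[of "g x"]] unfolding abs_mult by linarith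
    qed (use wv[OF g] g sw in \<open>auto simp: sq_integrable_def\<close>)
    then show ?thesis using g sw by (simp add: sq_integrable_def)
  qed
  have "\<exists>N. \<forall>i\<ge>N. \<forall>j\<ge>N. (\<integral>x. norm (w x * v i x - w x * v j x) \<partial>lebesgue) < e" if e: "e > 0" for e :: real
  proof -
    define t where "t = e / (8 * (?W + 1))"
    have W0: "?W \<ge> 0" by (rule integral_square_nonneg)
    have "e / (8 * (W + 1)) > 0 \<and> e / (8 * (W + 1)) * W < e / 8" if "W \<ge> 0" for W :: real
      using e that by (simp add: field_simps add_nonneg_pos)
    from this[OF W0] have t: "t > 0" "t * ?W < e / 8" by (simp_all only: t_def)
    have "(\<lambda>k. (2 powr (- \<alpha>)) ^ k) \<longlonglongrightarrow> 0"
      using \<alpha> powr_less_mono[of "-\<alpha>" 0 2] by (intro LIMSEQ_power_zero) auto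
    then have "(\<lambda>k. 2 powr (- \<alpha> * real k)) \<longlonglongrightarrow> 0" by (simp only: two_powr_mult_nat)
    then have "(\<lambda>k. (1 / t) * (?A * 2 powr (- \<alpha> * real k) * B\<^sup>2)) \<longlonglongrightarrow> (1 / t) * (?A * 0 * B\<^sup>2)"
      by (intro tendsto_mult tendsto_const)
    then have "\<forall>\<^sub>F k in sequentially. (1 / t) * (?A * 2 powr (- \<alpha> * real k) * B\<^sup>2) < e / 8"
      using e by (intro order_tendstoD(2)[of _ "(1 / t) * (?A * 0 * B\<^sup>2)"]) auto
    then obtain k where k: "(1 / t) * (?A * 2 powr (- \<alpha> * real k) * B\<^sup>2) < e / 8"
      by (auto simp: eventually_sequentially)
    have close: "(\<integral>x. \<bar>w x * (v n x - avg k (v n) x)\<bar> \<partial>lebesgue) < e / 4" for n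
    proof -
      have "(1 / t) * (\<integral>x. (v n x - avg k (v n) x)\<^sup>2 \<partial>lebesgue) \<le> (1 / t) * (?A * 2 powr (- \<alpha> * real k) * B\<^sup>2)"
        using t(1) devB by (intro mult_left_mono) auto
      then show ?thesis using young[OF dev[of n k] t(1)] t(2) k by linarith
    qed
    define l where "l = (\<lambda>x. lim (\<lambda>n. avg k (v n) x))"
    have l: "(\<lambda>n. avg k (v n) x) \<longlonglongrightarrow> l x" for x
      unfolding l_def v_def using s(2) by (simp add: convergent_LIMSEQ_iff)
    have avm: "avg k (v n) \<in> borel_measurable lebesgue" for n by (rule borel_measurable_avg[OF vm])
    have lm: "l \<in> borel_measurable lebesgue"
      by (rule borel_measurable_LIMSEQ_real[of lebesgue "\<lambda>n. avg k (v n)"]) (use l avm in auto)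
    let ?M = "sqrt (2 ^ (k * CARD('n))) * B"
    have ab: "\<bar>avg k (v n) x\<bar> \<le> ?M" for n x by (rule avg_bounded[OF v vB])
    have lb: "\<bar>l x\<bar> \<le> ?M" for x
      using LIMSEQ_le_const2[OF tendsto_rabs[OF l[of x]], of ?M] ab by auto
    have wM: "\<bar>w x * (avg k (v n) x - l x)\<bar> \<le> w x * (2 * ?M)" for n x
    proof -
      have "\<bar>avg k (v n) x - l x\<bar> \<le> 2 * ?M" using ab[of n x] lb[of x] by linarith
      then show ?thesis using w(2)[of x] by (simp add: abs_mult mult_left_mono)
    qed
    have il: "integrable lebesgue (\<lambda>x. w x * (avg k (v n) x - l x))" for n
      by (rule Bochner_Integration.integrable_bound[of lebesgue "\<lambda>x. w x * (2 * ?M)"])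
         (use w wM avm lm in \<open>auto intro!: order_trans[OF wM]\<close>)
    have "(\<lambda>n. \<integral>x. \<bar>w x * (avg k (v n) x - l x)\<bar> \<partial>lebesgue) \<longlonglongrightarrow> (\<integral>x. 0 \<partial>(lebesgue :: (real ^ 'n) measure))"
    proof (rule integral_dominated_convergence[where w="\<lambda>x. w x * (2 * ?M)"])
      show "AE x in lebesgue. (\<lambda>n. \<bar>w x * (avg k (v n) x - l x)\<bar>) \<longlonglongrightarrow> 0"
      proof (rule AE_I2)
        fix x
        have "(\<lambda>n. w x * (avg k (v n) x - l x)) \<longlonglongrightarrow> w x * (l x - l x)" by (intro tendsto_intros l)
        then show "(\<lambda>n. \<bar>w x * (avg k (v n) x - l x)\<bar>) \<longlonglongrightarrow> 0" by (simp add: tendsto_rabs_zero_iff)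
      qed
      show "AE x in lebesgue. norm \<bar>w x * (avg k (v n) x - l x)\<bar> \<le> w x * (2 * ?M)" for n
        using wM by simp
    qed (use w avm lm in auto)
    then have "\<forall>\<^sub>F n in sequentially. (\<integral>x. \<bar>w x * (avg k (v n) x - l x)\<bar> \<partial>lebesgue) < e / 4"
      using e by (intro order_tendstoD(2)) auto
    then obtain N where N: "\<And>n. n \<ge> N \<Longrightarrow> (\<integral>x. \<bar>w x * (avg k (v n) x - l x)\<bar> \<partial>lebesgue) < e / 4"
      by (auto simp: eventually_sequentially)
    have half: "(\<integral>x. \<bar>w x * (v n x - avg k (v n) x)\<bar> + \<bar>w x * (avg k (v n) x - l x)\<bar> \<partial>lebesgue) < e / 2" if "n \<ge> N" for n
      using close[of n] N[OF that] wv[OF dev[of n k]] il[of n] by simp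
    have "(\<integral>x. norm (w x * v i x - w x * v j x) \<partial>lebesgue) < e" if "i \<ge> N" "j \<ge> N" for i j
    proof -
      let ?h = "\<lambda>n x. \<bar>w x * (v n x - avg k (v n) x)\<bar> + \<bar>w x * (avg k (v n) x - l x)\<bar>"
      have ih: "integrable lebesgue (?h n)" for n using wv[OF dev[of n k]] il[of n] by simp
      have "(\<integral>x. norm (w x * v i x - w x * v j x) \<partial>lebesgue) \<le> (\<integral>x. ?h i x + ?h j x \<partial>lebesgue)"
      proof (rule integral_mono)
        show "integrable lebesgue (\<lambda>x. norm (w x * v i x - w x * v j x))"
          using wv[OF frac_sobolev_sq_integrable[OF v[of i]]] wv[OF frac_sobolev_sq_integrable[OF v[of j]]] by auto
        show "integrable lebesgue (\<lambda>x. ?h i x + ?h j x)" by (intro Bochner_Integration.integrable_add ih)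
        fix x
        have "w x * v i x - w x * v j x = w x * (v i x - avg k (v i) x) + w x * (avg k (v i) x - l x)
           - w x * (v j x - avg k (v j) x) - w x * (avg k (v j) x - l x)" by (simp add: algebra_simps)
        then show "norm (w x * v i x - w x * v j x) \<le> ?h i x + ?h j x" by (simp only: real_norm_def)
      qed
      also have "\<dots> = (\<integral>x. ?h i x \<partial>lebesgue) + (\<integral>x. ?h j x \<partial>lebesgue)"
        by (intro Bochner_Integration.integral_add ih)
      also have "\<dots> < e" using half[OF that(1)] half[OF that(2)] by linarith
      finally show ?thesis .
    qed
    then show ?thesis by blast
  qed
  then obtain r where r: "strict_mono r" "AE x in lebesgue. Cauchy (\<lambda>i. w x * v (r i) x)"
    using cauchy_L1_AE_cauchy_subseq[of lebesgue "\<lambda>n x. w x * v n x"] wv[OF frac_sobolev_sq_integrable[OF v]] by blast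
  define u0 where "u0 = (\<lambda>x. lim (\<lambda>n. v (r n) x))"
  have lim: "AE x in lebesgue. (\<lambda>n. v (r n) x) \<longlonglongrightarrow> u0 x"
    using r(2)
  proof eventually_elim
    case (elim x)
    then obtain L where "(\<lambda>i. w x * v (r i) x) \<longlonglongrightarrow> L" by (auto simp: Cauchy_convergent_iff convergent_def)
    then have "(\<lambda>i. (w x * v (r i) x) / w x) \<longlonglongrightarrow> L / w x" by (intro tendsto_intros) (use w(2)[of x] in auto)
    then have "convergent (\<lambda>i. v (r i) x)" using w(2)[of x] by (auto simp: convergent_def)
    then show ?case by (simp add: u0_def convergent_LIMSEQ_iff)
  qed
  have u0: "u0 \<in> borel_measurable lebesgue"
    unfolding u0_def by (intro borel_measurable_lim_metric vm)
  show ?thesis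
  proof (intro exI conjI)
    show "strict_mono (s \<circ> r)" using s(1) r(1) by (rule strict_mono_o)
    show "u0 \<in> frac_sobolev \<alpha>" by (rule frac_sobolev_AE_limit[OF v vB u0 lim])
    show "AE x in lebesgue. (\<lambda>n. u ((s \<circ> r) n) x) \<longlonglongrightarrow> u0 x" using lim by (simp add: v_def)
  qed
qed

text \<open>
  The \<open>L\<^sup>p\<close> bound with \<open>p > 2\<close> makes the squares uniformly integrable on the unit cell. If the limit were zero,
  the \<open>L\<^sup>2\<close> mass in the unit cell would tend to zero.
\<close>

lemma AE_limit_nonzero:
  fixes u :: "nat \<Rightarrow> real ^ 'n \<Rightarrow> real"
  assumes p: "p > 2" and um: "\<And>n. u n \<in> borel_measurable lebesgue"
    and Lp: "\<And>n. integrable lebesgue (\<lambda>x. \<bar>u n x\<bar> powr p)" "\<And>n. (\<integral>x. \<bar>u n x\<bar> powr p \<partial>lebesgue) \<le> C"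
    and lim: "AE x in lebesgue. (\<lambda>n. u n x) \<longlonglongrightarrow> u0 x"
    and d: "d > 0" "\<And>n. d \<le> (\<integral>x. indicator unit_cell x * (u n x)\<^sup>2 \<partial>lebesgue)"
  shows "\<not> (AE x in lebesgue. u0 x = 0)"
proof
  assume z: "AE x in lebesgue. u0 x = 0"
  have ptw: "t\<^sup>2 \<le> e * \<bar>t\<bar> powr p + (1 / e) powr (2 / (p - 2))" if e: "e > 0" for t e :: real
  proof (cases "1 / e \<le> (t\<^sup>2) powr ((p - 2) / 2)")
    case True
    then have "1 \<le> e * (t\<^sup>2) powr ((p - 2) / 2)" using e by (simp add: field_simps)
    then have "t\<^sup>2 * 1 \<le> t\<^sup>2 * (e * (t\<^sup>2) powr ((p - 2) / 2))" by (intro mult_left_mono) auto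
    also have "\<dots> = e * \<bar>t\<bar> powr p" using abs_powr_eq[OF p, of t] by simp
    finally show ?thesis by (smt (verit) powr_ge_zero)
  next
    case False
    then have "((t\<^sup>2) powr ((p - 2) / 2)) powr (2 / (p - 2)) \<le> (1 / e) powr (2 / (p - 2))"
      using p by (intro powr_mono2) auto
    moreover have "(p - 2) / 2 * (2 / (p - 2)) = 1" using p by simp
    ultimately have "t\<^sup>2 \<le> (1 / e) powr (2 / (p - 2))"
      by (simp add: powr_powr del: times_divide_eq_left times_divide_eq_right)
    then show ?thesis using e by (smt (verit) powr_ge_zero mult_nonneg_nonneg)
  qed
  have "(\<lambda>n. \<integral>x. \<bar>indicator unit_cell x * (u n x)\<^sup>2\<bar> \<partial>lebesgue) \<longlonglongrightarrow> 0"
  proof (rule almost_dominated_convergence(2)[where h="\<lambda>n x. indicator unit_cell x * (u n x)\<^sup>2"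
      and g="\<lambda>n x. \<bar>u n x\<bar> powr p" and B=C and M=lebesgue])
    show "(\<lambda>x. indicator unit_cell x * (u n x)\<^sup>2) \<in> borel_measurable lebesgue" for n
      using um[of n] by measurable
    show "AE x in lebesgue. (\<lambda>n. indicator unit_cell x * (u n x)\<^sup>2) \<longlonglongrightarrow> 0"
      using lim z
    proof eventually_elim
      case (elim x)
      then have "(\<lambda>n. indicator unit_cell x * (u n x)\<^sup>2) \<longlonglongrightarrow> indicator unit_cell x * 0\<^sup>2"
        by (intro tendsto_intros) auto
      then show ?case by simp
    qed
    fix e :: real assume e: "e > 0"
    let ?k = "(1 / e) powr (2 / (p - 2))"
    have "\<bar>indicator unit_cell x * (u n x)\<^sup>2\<bar> \<le> e * \<bar>u n x\<bar> powr p + ?k * indicator unit_cell x" for n x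
      using ptw[OF e, of "u n x"] e by (cases "x \<in> unit_cell") auto
    then show "\<exists>\<Phi>. integrable lebesgue \<Phi> \<and> (\<forall>n. AE x in lebesgue. \<bar>indicator unit_cell x * (u n x)\<^sup>2\<bar> \<le> e * \<bar>u n x\<bar> powr p + \<Phi> x)"
      using integrable_unit_cell by (intro exI[of _ "\<lambda>x. ?k * indicator unit_cell x"]) auto
  qed (use Lp in auto)
  then have "(\<lambda>n. \<integral>x. indicator unit_cell x * (u n x)\<^sup>2 \<partial>lebesgue) \<longlonglongrightarrow> 0" by simp
  then have "d \<le> 0" by (rule LIMSEQ_le_const) (use d in auto)
  then show False using d by simp
qed

section \<open>Nonlinearities of subcritical growth\<close>

lemma mean_value_increment:
  fixes \<Phi> \<phi> :: "real \<Rightarrow> real"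
  assumes "\<And>t. (\<Phi> has_real_derivative \<phi> t) (at t)"
  obtains \<theta> where "0 \<le> \<theta>" "\<theta> \<le> 1" "\<Phi> (a + h) - \<Phi> a = h * \<phi> (a + \<theta> * h)"
proof -
  have "((\<lambda>s. \<Phi> (a + s * h)) has_real_derivative h * \<phi> (a + s * h)) (at s)" for s
    by (rule DERIV_chain2[where g="\<lambda>s. a + s * h", OF assms, THEN DERIV_cong])
       (auto intro!: derivative_eq_intros)
  then obtain z where "0 < z" "z < 1" "\<Phi> (a + 1 * h) - \<Phi> (a + 0 * h) = (1 - 0) * (h * \<phi> (a + z * h))"
    using MVT2[of 0 1 "\<lambda>s. \<Phi> (a + s * h)" "\<lambda>s. h * \<phi> (a + s * h)"] by auto
  then show ?thesis using that[of z] by simp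
qed

text \<open>
  A primitive \<open>\<Phi>\<close> and its derivative \<open>\<phi>\<close>, with the growth of the second derivative that makes the
  superposition operator differentiable on a space embedded in \<open>L\<^sup>2 \<inter> L\<^sup>p\<close>.
\<close>

definition growth_pair :: "real \<Rightarrow> real \<Rightarrow> (real \<Rightarrow> real) \<Rightarrow> (real \<Rightarrow> real) \<Rightarrow> bool" where
  "growth_pair p C \<Phi> \<phi> \<longleftrightarrow> \<Phi> 0 = 0 \<and> \<phi> 0 = 0 \<and> (\<forall>t. (\<Phi> has_real_derivative \<phi> t) (at t)) \<and>
     (\<exists>\<phi>'. \<forall>t. (\<phi> has_real_derivative \<phi>' t) (at t) \<and> \<bar>\<phi>' t\<bar> \<le> C * (1 + \<bar>t\<bar> powr (p - 2)))"

lemma growth_pair_increment: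
  assumes g: "growth_pair p C \<Phi> \<phi>" and p: "p > 2" and C: "C \<ge> 0"
  shows "\<bar>\<phi> (a + h) - \<phi> a\<bar> \<le> C * (\<bar>h\<bar> * (1 + 2 powr (p - 2) * (\<bar>a\<bar> powr (p - 2) + \<bar>h\<bar> powr (p - 2))))"
proof -
  obtain \<phi>' where \<phi>': "\<And>t. (\<phi> has_real_derivative \<phi>' t) (at t)" "\<And>t. \<bar>\<phi>' t\<bar> \<le> C * (1 + \<bar>t\<bar> powr (p - 2))"
    using g unfolding growth_pair_def by blast
  obtain \<theta> where \<theta>: "0 \<le> \<theta>" "\<theta> \<le> 1" "\<phi> (a + h) - \<phi> a = h * \<phi>' (a + \<theta> * h)"
    using mean_value_increment[OF \<phi>'(1)] .
  have "\<bar>\<theta> * h\<bar> \<le> \<bar>h\<bar>" using \<theta> by (simp add: abs_mult mult_left_le_one_le)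
  then have th: "\<bar>\<theta> * h\<bar> powr (p - 2) \<le> \<bar>h\<bar> powr (p - 2)" using p by (intro powr_mono2) auto
  have "\<bar>a + \<theta> * h\<bar> powr (p - 2) \<le> 2 powr (p - 2) * (\<bar>a\<bar> powr (p - 2) + \<bar>\<theta> * h\<bar> powr (p - 2))"
    using p by (intro powr_add_le) auto
  also have "\<dots> \<le> 2 powr (p - 2) * (\<bar>a\<bar> powr (p - 2) + \<bar>h\<bar> powr (p - 2))"
    using th by (intro mult_left_mono) auto
  finally have "\<bar>\<phi>' (a + \<theta> * h)\<bar> \<le> C * (1 + 2 powr (p - 2) * (\<bar>a\<bar> powr (p - 2) + \<bar>h\<bar> powr (p - 2)))"
    using C by (intro order_trans[OF \<phi>'(2)] mult_left_mono) auto
  then have "\<bar>h\<bar> * \<bar>\<phi>' (a + \<theta> * h)\<bar> \<le> \<bar>h\<bar> * (C * (1 + 2 powr (p - 2) * (\<bar>a\<bar> powr (p - 2) + \<bar>h\<bar> powr (p - 2))))"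
    by (rule mult_left_mono) simp
  then show ?thesis unfolding \<theta>(3) by (simp add: abs_mult mult_ac)
qed

lemma abs_mult_powr: "\<bar>t :: real\<bar> * \<bar>t\<bar> powr (s - 1) = \<bar>t\<bar> powr s"
  by (simp add: powr_mult_base)

lemma growth_pair_bound:
  assumes g: "growth_pair p C \<Phi> \<phi>" and p: "p > 2" and C: "C \<ge> 0"
  shows "\<bar>\<phi> t\<bar> \<le> C * 2 powr (p - 2) * (\<bar>t\<bar> + \<bar>t\<bar> powr (p - 1))"
    and "\<bar>\<Phi> t\<bar> \<le> C * 2 powr (p - 2) * (t\<^sup>2 + \<bar>t\<bar> powr p)"
proof -
  have D: "2 powr (p - 2) \<ge> (1::real)" using p by (simp add: ge_one_powr_ge_zero)
  show b: "\<bar>\<phi> t\<bar> \<le> C * 2 powr (p - 2) * (\<bar>t\<bar> + \<bar>t\<bar> powr (p - 1))" for t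
  proof -
    have "\<bar>\<phi> t\<bar> \<le> C * (\<bar>t\<bar> * (1 + 2 powr (p - 2) * \<bar>t\<bar> powr (p - 2)))"
      using growth_pair_increment[OF g p C, of 0 t] g p by (simp add: growth_pair_def)
    also have "\<dots> \<le> C * (\<bar>t\<bar> * (2 powr (p - 2) * (1 + \<bar>t\<bar> powr (p - 2))))"
      using C D by (intro mult_left_mono) (auto simp: distrib_left)
    also have "\<dots> = C * 2 powr (p - 2) * (\<bar>t\<bar> + \<bar>t\<bar> * \<bar>t\<bar> powr (p - 1 - 1))"
      by (simp only: distrib_left mult_ac mult_1_right diff_diff_eq one_add_one)
    finally show ?thesis unfolding abs_mult_powr .
  qed
  obtain \<theta> where \<theta>: "0 \<le> \<theta>" "\<theta> \<le> 1" "\<Phi> (0 + t) - \<Phi> 0 = t * \<phi> (0 + \<theta> * t)"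
    using mean_value_increment[of \<Phi> \<phi> 0 t] g unfolding growth_pair_def by blast
  have th: "\<bar>\<theta> * t\<bar> \<le> \<bar>t\<bar>" using \<theta> by (simp add: abs_mult mult_left_le_one_le)
  have "\<bar>\<phi> (\<theta> * t)\<bar> \<le> C * 2 powr (p - 2) * (\<bar>\<theta> * t\<bar> + \<bar>\<theta> * t\<bar> powr (p - 1))" by (rule b)
  also have "\<dots> \<le> C * 2 powr (p - 2) * (\<bar>t\<bar> + \<bar>t\<bar> powr (p - 1))"
    using th C p by (intro mult_left_mono add_mono powr_mono2) auto
  finally have "\<bar>t\<bar> * \<bar>\<phi> (\<theta> * t)\<bar> \<le> \<bar>t\<bar> * (C * 2 powr (p - 2) * (\<bar>t\<bar> + \<bar>t\<bar> powr (p - 1)))"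
    by (rule mult_left_mono) simp
  also have "\<dots> = C * 2 powr (p - 2) * (\<bar>t\<bar> * \<bar>t\<bar> + \<bar>t\<bar> * \<bar>t\<bar> powr (p - 1))" by (simp add: algebra_simps)
  also have "\<dots> = C * 2 powr (p - 2) * (t\<^sup>2 + \<bar>t\<bar> powr p)" unfolding abs_mult_powr by (simp add: power2_eq_square)
  finally show "\<bar>\<Phi> t\<bar> \<le> C * 2 powr (p - 2) * (t\<^sup>2 + \<bar>t\<bar> powr p)"
    using \<theta>(3) g by (simp add: growth_pair_def abs_mult)
qed

text \<open>
  Young's inequality without sharp constants, by comparing \<open>\<bar>b\<bar>\<close> with \<open>e \<bar>a\<bar>\<close>.
\<close>

lemma powr_product_le:
  fixes a b s e :: real
  assumes s: "s > 1" and e: "e > 0"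
  shows "\<bar>a\<bar> powr (s - 1) * \<bar>b\<bar> \<le> e * \<bar>a\<bar> powr s + e powr (1 - s) * \<bar>b\<bar> powr s"
proof (cases "\<bar>b\<bar> \<le> e * \<bar>a\<bar>")
  case True
  have "\<bar>a\<bar> powr (s - 1) * \<bar>b\<bar> \<le> \<bar>a\<bar> powr (s - 1) * (e * \<bar>a\<bar>)" by (rule mult_left_mono[OF True]) simp
  also have "\<dots> = e * (\<bar>a\<bar> * \<bar>a\<bar> powr (s - 1))" by (simp only: mult_ac)
  finally show ?thesis unfolding abs_mult_powr by (simp add: add_increasing2)
next
  case False
  then have "\<bar>a\<bar> \<le> \<bar>b\<bar> / e" using e by (simp add: field_simps)
  then have "\<bar>a\<bar> powr (s - 1) \<le> (\<bar>b\<bar> / e) powr (s - 1)" using s by (intro powr_mono2) auto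
  then have "\<bar>a\<bar> powr (s - 1) * \<bar>b\<bar> \<le> (\<bar>b\<bar> / e) powr (s - 1) * \<bar>b\<bar>" by (rule mult_right_mono) simp
  also have "\<dots> = e powr (1 - s) * (\<bar>b\<bar> * \<bar>b\<bar> powr (s - 1))"
  proof -
    have "(\<bar>b\<bar> / e) powr (s - 1) = \<bar>b\<bar> powr (s - 1) * (1 / e powr (s - 1))"
      using e by (simp add: powr_divide)
    also have "1 / e powr (s - 1) = e powr (1 - s)"
      using powr_minus_divide[of e "s - 1"] by simp
    finally show ?thesis by (simp only: mult_ac)
  qed
  finally show ?thesis unfolding abs_mult_powr using e by (simp add: add_increasing)
qed

lemma powr_product_le_square:
  fixes a k p :: real
  assumes p: "p > 2"
  shows "\<bar>a\<bar> powr (p - 2) * k\<^sup>2 \<le> \<bar>a\<bar> powr p + \<bar>k\<bar> powr p"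
proof -
  have eq: "\<bar>t\<bar> powr (p - 2) * t\<^sup>2 = \<bar>t\<bar> powr p" for t :: real
    using powr_add[of "\<bar>t\<bar>" "p - 2" 2] powr_two[of "\<bar>t\<bar>"] by simp
  show ?thesis
  proof (cases "\<bar>k\<bar> \<le> \<bar>a\<bar>")
    case True
    then have "\<bar>a\<bar> powr (p - 2) * k\<^sup>2 \<le> \<bar>a\<bar> powr (p - 2) * a\<^sup>2"
      using power_mono[OF True, of 2] by (intro mult_left_mono) auto
    then show ?thesis unfolding eq by (simp add: add_increasing2)
  next
    case False
    then have "\<bar>a\<bar> powr (p - 2) * k\<^sup>2 \<le> \<bar>k\<bar> powr (p - 2) * k\<^sup>2"
      using p by (intro mult_right_mono powr_mono2) auto
    then show ?thesis unfolding eq by (simp add: add_increasing)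
  qed
qed

text \<open>
  Since \<open>\<Phi>\<close> is twice differentiable with subcritical second derivative, the remainder is quadratic in the
  size \<open>\<tau>\<close> of the increment, with a factor that is integrable for Sobolev functions \<open>a\<close> and \<open>k\<close>.
\<close>

lemma growth_pair_remainder:
  assumes g: "growth_pair p C \<Phi> \<phi>" and p: "p > 2" and C: "C \<ge> 0" and \<tau>: "0 \<le> \<tau>" "\<tau> \<le> 1"
  shows "\<bar>\<Phi> (a + \<tau> * k) - \<Phi> a - \<phi> a * (\<tau> * k)\<bar>
    \<le> C * 2 powr (p - 2) * \<tau>\<^sup>2 * (k\<^sup>2 + \<bar>a\<bar> powr p + 2 * \<bar>k\<bar> powr p)"
proof -
  let ?D = "2 powr (p - 2) :: real"
  have D: "?D \<ge> 1" using p by (simp add: ge_one_powr_ge_zero)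
  define h where "h = \<tau> * k"
  obtain \<theta> where \<theta>: "0 \<le> \<theta>" "\<theta> \<le> 1" "\<Phi> (a + h) - \<Phi> a = h * \<phi> (a + \<theta> * h)"
    using mean_value_increment[of \<Phi> \<phi> a h] g unfolding growth_pair_def by blast
  have th: "\<bar>\<theta> * h\<bar> \<le> \<bar>h\<bar>" using \<theta> by (simp add: abs_mult mult_left_le_one_le)
  have hk: "\<bar>h\<bar> \<le> \<bar>k\<bar>" using \<tau> by (simp add: h_def abs_mult mult_left_le_one_le)
  have "\<bar>\<phi> (a + \<theta> * h) - \<phi> a\<bar> \<le> C * (\<bar>\<theta> * h\<bar> * (1 + ?D * (\<bar>a\<bar> powr (p - 2) + \<bar>\<theta> * h\<bar> powr (p - 2))))"
    by (rule growth_pair_increment[OF g p C])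
  also have "\<dots> \<le> C * (\<bar>h\<bar> * (?D * (1 + (\<bar>a\<bar> powr (p - 2) + \<bar>k\<bar> powr (p - 2)))))"
  proof (intro mult_left_mono mult_mono)
    have "\<bar>\<theta> * h\<bar> powr (p - 2) \<le> \<bar>k\<bar> powr (p - 2)" using th hk p by (intro powr_mono2) auto
    then have "?D * (\<bar>a\<bar> powr (p - 2) + \<bar>\<theta> * h\<bar> powr (p - 2)) \<le> ?D * (\<bar>a\<bar> powr (p - 2) + \<bar>k\<bar> powr (p - 2))"
      by (intro mult_left_mono) auto
    then show "1 + ?D * (\<bar>a\<bar> powr (p - 2) + \<bar>\<theta> * h\<bar> powr (p - 2)) \<le> ?D * (1 + (\<bar>a\<bar> powr (p - 2) + \<bar>k\<bar> powr (p - 2)))"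
      using D unfolding distrib_left mult_1_right by linarith
  qed (use th C in auto)
  finally have "\<bar>h\<bar> * \<bar>\<phi> (a + \<theta> * h) - \<phi> a\<bar> \<le> \<bar>h\<bar> * (C * (\<bar>h\<bar> * (?D * (1 + (\<bar>a\<bar> powr (p - 2) + \<bar>k\<bar> powr (p - 2))))))"
    by (rule mult_left_mono) simp
  also have "\<dots> = C * ?D * (\<bar>h\<bar> * \<bar>h\<bar>) * (1 + (\<bar>a\<bar> powr (p - 2) + \<bar>k\<bar> powr (p - 2)))"
    by (simp only: mult_ac)
  also have "\<bar>h\<bar> * \<bar>h\<bar> = \<tau>\<^sup>2 * k\<^sup>2" by (simp add: h_def power2_eq_square mult_ac)
  also have "C * ?D * (\<tau>\<^sup>2 * k\<^sup>2) * (1 + (\<bar>a\<bar> powr (p - 2) + \<bar>k\<bar> powr (p - 2)))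
     = C * ?D * \<tau>\<^sup>2 * (k\<^sup>2 + (\<bar>a\<bar> powr (p - 2) * k\<^sup>2 + \<bar>k\<bar> powr (p - 2) * k\<^sup>2))" by (simp only: distrib_left mult_ac mult_1 mult_1_right)
  also have "\<dots> \<le> C * ?D * \<tau>\<^sup>2 * (k\<^sup>2 + \<bar>a\<bar> powr p + 2 * \<bar>k\<bar> powr p)"
  proof (rule mult_left_mono)
    have "\<bar>k\<bar> powr (p - 2) * k\<^sup>2 = \<bar>k\<bar> powr p"
      using powr_add[of "\<bar>k\<bar>" "p - 2" 2] powr_two[of "\<bar>k\<bar>"] by simp
    then show "k\<^sup>2 + (\<bar>a\<bar> powr (p - 2) * k\<^sup>2 + \<bar>k\<bar> powr (p - 2) * k\<^sup>2) \<le> k\<^sup>2 + \<bar>a\<bar> powr p + 2 * \<bar>k\<bar> powr p"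
      using powr_product_le_square[OF p, of a k] by linarith
  qed (use C in auto)
  finally have "\<bar>h * (\<phi> (a + \<theta> * h) - \<phi> a)\<bar> \<le> C * ?D * \<tau>\<^sup>2 * (k\<^sup>2 + \<bar>a\<bar> powr p + 2 * \<bar>k\<bar> powr p)"
    by (simp add: abs_mult)
  moreover have "\<Phi> (a + h) - \<Phi> a - \<phi> a * h = h * (\<phi> (a + \<theta> * h) - \<phi> a)"
    unfolding \<theta>(3) by (simp add: algebra_simps)
  ultimately show ?thesis by (simp add: h_def)
qed

lemma DERIV_abs_powr:
  fixes t q :: real
  assumes q: "q > 1"
  shows "((\<lambda>t. \<bar>t\<bar> powr q) has_real_derivative q * (sgn t * \<bar>t\<bar> powr (q - 1))) (at t)"
proof -
  consider "t > 0" | "t < 0" | "t = 0" by linarith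
  then show ?thesis
  proof cases
    case 1
    have "((\<lambda>t. t powr q) has_real_derivative q * t powr (q - 1)) (at t)"
      using 1 by (rule has_real_derivative_powr)
    then have "((\<lambda>t. \<bar>t\<bar> powr q) has_real_derivative q * t powr (q - 1)) (at t)"
      by (rule has_field_derivative_transform_within_open[where S="{0<..}"]) (use 1 in auto)
    then show ?thesis using 1 by simp
  next
    case 2
    have "((\<lambda>t. (- t) powr q) has_real_derivative (q * (- t) powr (q - 1)) * (- 1)) (at t)"
      by (rule DERIV_chain2[where f="\<lambda>s. s powr q" and g="\<lambda>t. - t"])
         (use 2 in \<open>auto intro!: has_real_derivative_powr derivative_eq_intros\<close>)
    then have "((\<lambda>t. \<bar>t\<bar> powr q) has_real_derivative (q * (- t) powr (q - 1)) * (- 1)) (at t)"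
      by (rule has_field_derivative_transform_within_open[where S="{..<0}"]) (use 2 in auto)
    then show ?thesis using 2 by simp
  next
    case 3
    have "((\<lambda>h::real. \<bar>h\<bar> powr (q - 1)) \<longlongrightarrow> \<bar>0\<bar> powr (q - 1)) (at 0)"
      using q by (intro tendsto_abs_powr tendsto_ident_at) auto
    then have l: "((\<lambda>h::real. \<bar>h\<bar> powr (q - 1)) \<longlongrightarrow> 0) (at 0)" by simp
    have "((\<lambda>h. (\<bar>0 + h\<bar> powr q - \<bar>0\<bar> powr q) / h) \<longlongrightarrow> 0) (at (0::real))"
    proof (rule Lim_null_comparison[OF _ l])
      have "norm ((\<bar>0 + h\<bar> powr q - \<bar>0\<bar> powr q) / h) \<le> \<bar>h\<bar> powr (q - 1)" for h :: real
        using abs_mult_powr[of h q] by (cases "h = 0") (auto simp: field_simps)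
      then show "\<forall>\<^sub>F h in at 0. norm ((\<bar>0 + h\<bar> powr q - \<bar>0\<bar> powr q) / h) \<le> \<bar>h\<bar> powr (q - 1)" by simp
    qed
    then show ?thesis unfolding 3 DERIV_def by simp
  qed
qed

lemma DERIV_signed_powr:
  fixes t s :: real
  assumes s: "s > 1"
  shows "((\<lambda>t. sgn t * \<bar>t\<bar> powr s) has_real_derivative s * \<bar>t\<bar> powr (s - 1)) (at t)"
proof -
  consider "t > 0" | "t < 0" | "t = 0" by linarith
  then show ?thesis
  proof cases
    case 1
    have "((\<lambda>t. \<bar>t\<bar> powr s) has_real_derivative s * (sgn t * \<bar>t\<bar> powr (s - 1))) (at t)"
      using s by (rule DERIV_abs_powr)
    then have "((\<lambda>t. sgn t * \<bar>t\<bar> powr s) has_real_derivative s * (sgn t * \<bar>t\<bar> powr (s - 1))) (at t)"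
      by (rule has_field_derivative_transform_within_open[where S="{0<..}"]) (use 1 in auto)
    then show ?thesis using 1 by simp
  next
    case 2
    have "((\<lambda>t. - (\<bar>t\<bar> powr s)) has_real_derivative - (s * (sgn t * \<bar>t\<bar> powr (s - 1)))) (at t)"
      using s by (intro DERIV_minus DERIV_abs_powr)
    then have "((\<lambda>t. sgn t * \<bar>t\<bar> powr s) has_real_derivative - (s * (sgn t * \<bar>t\<bar> powr (s - 1)))) (at t)"
      by (rule has_field_derivative_transform_within_open[where S="{..<0}"]) (use 2 in auto)
    then show ?thesis using 2 by simp
  next
    case 3
    have "((\<lambda>h::real. \<bar>h\<bar> powr (s - 1)) \<longlongrightarrow> \<bar>0\<bar> powr (s - 1)) (at 0)"
      using s by (intro tendsto_abs_powr tendsto_ident_at) auto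
    then have l: "((\<lambda>h::real. \<bar>h\<bar> powr (s - 1)) \<longlongrightarrow> 0) (at 0)" by simp
    have "((\<lambda>h. (sgn (0 + h) * \<bar>0 + h\<bar> powr s - sgn 0 * \<bar>0\<bar> powr s) / h) \<longlongrightarrow> 0) (at (0::real))"
    proof (rule Lim_null_comparison[OF _ l])
      have "norm ((sgn (0 + h) * \<bar>0 + h\<bar> powr s - sgn 0 * \<bar>0\<bar> powr s) / h) \<le> \<bar>h\<bar> powr (s - 1)" for h :: real
        using abs_mult_powr[of h s] by (cases "h = 0") (auto simp: field_simps abs_mult)
      then show "\<forall>\<^sub>F h in at 0. norm ((sgn (0 + h) * \<bar>0 + h\<bar> powr s - sgn 0 * \<bar>0\<bar> powr s) / h) \<le> \<bar>h\<bar> powr (s - 1)" by simp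
    qed
    then show ?thesis unfolding 3 DERIV_def using s by simp
  qed
qed

text \<open>
  A jointly Lebesgue measurable \<open>f\<close> need not be measurable in \<open>x\<close> for every value of the second argument.
  The primitive only depends on \<open>f x\<close> up to null sets, so that \<open>f\<close> can be replaced by a Borel function.
\<close>

lemma borel_measurable_primitive:
  fixes f :: "real ^ 'n \<Rightarrow> real \<Rightarrow> real"
  assumes f: "case_prod f \<in> borel_measurable (lebesgue :: ((real ^ 'n) \<times> real) measure)"
    and fx: "AE x in lebesgue. f x \<in> borel_measurable borel"
    and u: "u \<in> borel_measurable lebesgue"
  shows "(\<lambda>x. primitive f x (u x)) \<in> borel_measurable lebesgue"
proof -
  obtain f' where f': "f' \<in> borel_measurable (lborel :: ((real ^ 'n) \<times> real) measure)"
      "AE z in lborel. case_prod f z = f' z"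
    using completion_ex_borel_measurable_real[OF f] by blast
  define k where "k = (\<lambda>u s :: real. if 0 < s \<and> s < u then 1 else if u < s \<and> s < 0 then -1 else 0 :: real)"
  have prim: "primitive f x t = (\<integral>s. k t s * f x s \<partial>lborel)" for x t
  proof (cases "0 \<le> t")
    case True
    then have "(\<integral>s. k t s * f x s \<partial>lborel) = (\<integral>s. indicator {0<..<t} s *\<^sub>R f x s \<partial>lborel)"
      by (intro Bochner_Integration.integral_cong) (auto simp: k_def indicator_def)
    then show ?thesis using True
      by (simp add: primitive_def interval_lebesgue_integral_def set_lebesgue_integral_def)
  next
    case False
    then have "(\<integral>s. k t s * f x s \<partial>lborel) = (\<integral>s. - (indicator {t<..<0} s *\<^sub>R f x s) \<partial>lborel)"
      by (intro Bochner_Integration.integral_cong) (auto simp: k_def indicator_def)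
    then show ?thesis using False
      by (simp add: primitive_def interval_lebesgue_integral_def set_lebesgue_integral_def zero_ereal_def)
  qed
  have "AE z in (lborel :: (real^'n) measure) \<Otimes>\<^sub>M (lborel :: real measure). case_prod f z = f' z"
    using f'(2) unfolding lborel_prod .
  then have "AE x in lborel. AE s in lborel. f x s = f' (x, s)"
    by (auto dest: lborel_pair.AE_pair)
  then have ae: "AE x in lebesgue. AE s in lborel. f x s = f' (x, s)" by (rule AE_completion)
  have f'b[measurable]: "f' \<in> borel_measurable (borel \<Otimes>\<^sub>M borel)" using f'(1) by (simp add: borel_prod)
  define H where "H = (\<lambda>w :: (real ^ 'n) \<times> real. \<integral>s. k (snd w) s * f' (fst w, s) \<partial>lborel)"
  have "(\<lambda>(w, s). k (snd w) s * f' (fst w, s)) \<in> borel_measurable ((borel \<Otimes>\<^sub>M borel) \<Otimes>\<^sub>M lborel)"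
    unfolding k_def by measurable
  from lborel.borel_measurable_lebesgue_integral[OF this]
  have H: "H \<in> borel_measurable (borel \<Otimes>\<^sub>M borel)" by (simp add: H_def)
  have pair: "(\<lambda>x. (x, u x)) \<in> lebesgue \<rightarrow>\<^sub>M (borel \<Otimes>\<^sub>M borel)"
    using u borel_measurable_lebesgue_id by (rule measurable_Pair[rotated])
  have Hm: "(\<lambda>x. H (x, u x)) \<in> borel_measurable lebesgue"
    using measurable_compose[OF pair H] .
  have "AE x in lebesgue. H (x, u x) = primitive f x (u x)"
    using ae fx
  proof eventually_elim
    case (elim x)
    have "(\<lambda>s. f' (x, s)) \<in> borel_measurable lborel" by measurable
    moreover have "f x \<in> borel_measurable lborel" using elim by simp
    ultimately show ?case unfolding prim H_def fst_conv snd_conv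
      by (intro integral_cong_AE) (use elim in \<open>auto simp: k_def\<close>)
  qed
  from borel_measurable_AE[OF Hm this] show ?thesis .
qed

section \<open>Integral functionals\<close>

lemma growth_pair_product_bound:
  assumes g: "growth_pair p C \<Phi> \<phi>" and p: "p > 2" and C: "C \<ge> 0" and e: "e > 0"
  shows "\<bar>\<phi> a * b\<bar> \<le> C * 2 powr (p - 2) * (e * (a\<^sup>2 + \<bar>a\<bar> powr p) + (e powr (- 1) * b\<^sup>2 + e powr (1 - p) * \<bar>b\<bar> powr p))"
proof -
  have "\<bar>\<phi> a * b\<bar> = \<bar>\<phi> a\<bar> * \<bar>b\<bar>" by (rule abs_mult)
  also have "\<dots> \<le> (C * 2 powr (p - 2) * (\<bar>a\<bar> + \<bar>a\<bar> powr (p - 1))) * \<bar>b\<bar>"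
    by (intro mult_right_mono growth_pair_bound(1)[OF g p C]) simp
  also have "\<dots> = C * 2 powr (p - 2) * (\<bar>a\<bar> * \<bar>b\<bar> + \<bar>a\<bar> powr (p - 1) * \<bar>b\<bar>)" by (simp add: algebra_simps)
  also have "\<dots> \<le> C * 2 powr (p - 2) * ((e * a\<^sup>2 + e powr (- 1) * b\<^sup>2) + (e * \<bar>a\<bar> powr p + e powr (1 - p) * \<bar>b\<bar> powr p))"
  proof (intro mult_left_mono add_mono)
    show "\<bar>a\<bar> * \<bar>b\<bar> \<le> e * a\<^sup>2 + e powr (- 1) * b\<^sup>2"
      using powr_product_le[of 2 e a b] e by (simp add: powr_two)
    show "\<bar>a\<bar> powr (p - 1) * \<bar>b\<bar> \<le> e * \<bar>a\<bar> powr p + e powr (1 - p) * \<bar>b\<bar> powr p"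
      using p e by (intro powr_product_le) auto
  qed (use C in auto)
  finally show ?thesis by (simp add: algebra_simps)
qed

lemma powr_le_one: "0 \<le> (x::real) \<Longrightarrow> x \<le> 1 \<Longrightarrow> 0 < a \<Longrightarrow> x powr a \<le> 1"
  using powr_mono2[of a x 1] by simp

text \<open>
  A nonlinearity \<open>g\<close> with primitive \<open>G\<close> of subcritical growth, together with Sobolev's inequality for the
  exponent \<open>p\<close> of the growth condition.
\<close>

locale superposition =
  fixes \<alpha> p C S :: real and G g :: "real ^ 'n \<Rightarrow> real \<Rightarrow> real"
  assumes p: "p > 2" and C: "C \<ge> 0" and S: "S > 0"
    and Sobolev_integrable: "\<And>u :: real ^ 'n \<Rightarrow> real. u \<in> frac_sobolev \<alpha> \<Longrightarrow> integrable lebesgue (\<lambda>x. \<bar>u x\<bar> powr p)"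
    and Sobolev: "\<And>u :: real ^ 'n \<Rightarrow> real. u \<in> frac_sobolev \<alpha> \<Longrightarrow>
        (\<integral>x. \<bar>u x\<bar> powr p \<partial>lebesgue) \<le> S * frac_sobolev_norm \<alpha> u powr p"
    and growth: "AE x in lebesgue. growth_pair p C (G x) (g x)"
    and G_measurable: "\<And>u. u \<in> borel_measurable lebesgue \<Longrightarrow> (\<lambda>x. G x (u x)) \<in> borel_measurable lebesgue"
begin

text \<open>
  Only \<open>G\<close> is assumed to preserve measurability; \<open>g\<close> inherits this as a limit of difference quotients.
\<close>

lemma g_measurable:
  assumes u: "u \<in> borel_measurable lebesgue"
  shows "(\<lambda>x. g x (u x)) \<in> borel_measurable lebesgue"
proof -
  define a where "a = (\<lambda>n x. (G x (u x + 1 / real (Suc n)) - G x (u x)) / (1 / real (Suc n)))"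
  have am: "a n \<in> borel_measurable lebesgue" for n
    unfolding a_def by (intro borel_measurable_divide borel_measurable_diff G_measurable borel_measurable_add u borel_measurable_const)
  have lim: "AE x in lebesgue. lim (\<lambda>n. a n x) = g x (u x)"
    using growth
  proof eventually_elim
    case (elim x)
    then have "((\<lambda>h. (G x (u x + h) - G x (u x)) / h) \<longlongrightarrow> g x (u x)) (at 0)"
      by (simp add: growth_pair_def DERIV_def)
    moreover have "(\<lambda>n. 1 / real (Suc n)) \<longlonglongrightarrow> 0" using LIMSEQ_inverse_real_of_nat by (simp add: inverse_eq_divide)
    ultimately have "((\<lambda>h. (G x (u x + h) - G x (u x)) / h) \<circ> (\<lambda>n. 1 / real (Suc n))) \<longlonglongrightarrow> g x (u x)"
      unfolding tendsto_at_iff_sequentially by (auto simp del: of_nat_Suc)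
    then show ?case by (simp add: a_def o_def limI del: of_nat_Suc)
  qed
  have "(\<lambda>x. lim (\<lambda>n. a n x)) \<in> borel_measurable lebesgue"
    by (intro borel_measurable_lim_metric am)
  from borel_measurable_AE[OF this lim] show ?thesis .
qed

lemma integrable_G:
  assumes u: "u \<in> frac_sobolev \<alpha>"
  shows "integrable lebesgue (\<lambda>x. G x (u x))"
proof (rule Bochner_Integration.integrable_bound)
  show "integrable lebesgue (\<lambda>x. C * 2 powr (p - 2) * ((u x)\<^sup>2 + \<bar>u x\<bar> powr p))"
    using frac_sobolev_integrable_square[OF u] Sobolev_integrable[OF u] by simp
  show "AE x in lebesgue. norm (G x (u x)) \<le> norm (C * 2 powr (p - 2) * ((u x)\<^sup>2 + \<bar>u x\<bar> powr p))"
    using growth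
  proof eventually_elim
    case (elim x)
    then show ?case using growth_pair_bound(2)[OF elim p C, of "u x"] C by simp
  qed
qed (rule G_measurable[OF frac_sobolev_measurable[OF u]])

lemma product_bound_integrable:
  fixes u :: "real ^ 'n \<Rightarrow> real"
  assumes "u \<in> frac_sobolev \<alpha>"
  shows "integrable lebesgue (\<lambda>x. c * (d * ((u x)\<^sup>2) + e * \<bar>u x\<bar> powr p))"
  using frac_sobolev_integrable_square[OF assms] Sobolev_integrable[OF assms] by simp

lemma integrable_g_times:
  assumes u: "u \<in> frac_sobolev \<alpha>" and v: "v \<in> frac_sobolev \<alpha>"
  shows "integrable lebesgue (\<lambda>x. g x (u x) * v x)"
    and "\<bar>\<integral>x. g x (u x) * v x \<partial>lebesgue\<bar> \<le> C * 2 powr (p - 2) *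
      ((\<integral>x. (u x)\<^sup>2 \<partial>lebesgue) + (\<integral>x. \<bar>u x\<bar> powr p \<partial>lebesgue) + (\<integral>x. (v x)\<^sup>2 \<partial>lebesgue) + (\<integral>x. \<bar>v x\<bar> powr p \<partial>lebesgue))"
proof -
  let ?b = "\<lambda>x. C * 2 powr (p - 2) * ((u x)\<^sup>2 + \<bar>u x\<bar> powr p + (v x)\<^sup>2 + \<bar>v x\<bar> powr p)"
  have le: "AE x in lebesgue. \<bar>g x (u x) * v x\<bar> \<le> ?b x"
    using growth
  proof eventually_elim
    case (elim x)
    then show ?case using growth_pair_product_bound[OF elim p C, of 1 "u x" "v x"] by (simp add: add.assoc)
  qed
  have ib: "integrable lebesgue ?b"
    using frac_sobolev_integrable_square[OF u] Sobolev_integrable[OF u] frac_sobolev_integrable_square[OF v] Sobolev_integrable[OF v]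
    by simp
  have m: "(\<lambda>x. g x (u x) * v x) \<in> borel_measurable lebesgue"
    using g_measurable[OF frac_sobolev_measurable[OF u]] frac_sobolev_measurable[OF v] by simp
  show int: "integrable lebesgue (\<lambda>x. g x (u x) * v x)"
    by (rule Bochner_Integration.integrable_bound[OF ib m]) (use le in \<open>eventually_elim, simp\<close>)
  have "\<bar>\<integral>x. g x (u x) * v x \<partial>lebesgue\<bar> \<le> (\<integral>x. \<bar>g x (u x) * v x\<bar> \<partial>lebesgue)"
    by (rule integral_abs_bound)
  also have "\<dots> \<le> (\<integral>x. ?b x \<partial>lebesgue)"
    by (rule integral_mono_AE[OF integrable_abs[OF int] ib le])
  also have "\<dots> = C * 2 powr (p - 2) *
      ((\<integral>x. (u x)\<^sup>2 \<partial>lebesgue) + (\<integral>x. \<bar>u x\<bar> powr p \<partial>lebesgue) + (\<integral>x. (v x)\<^sup>2 \<partial>lebesgue) + (\<integral>x. \<bar>v x\<bar> powr p \<partial>lebesgue))"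
    using frac_sobolev_integrable_square[OF u] Sobolev_integrable[OF u] frac_sobolev_integrable_square[OF v] Sobolev_integrable[OF v]
    by simp
  finally show "\<bar>\<integral>x. g x (u x) * v x \<partial>lebesgue\<bar> \<le> C * 2 powr (p - 2) *
      ((\<integral>x. (u x)\<^sup>2 \<partial>lebesgue) + (\<integral>x. \<bar>u x\<bar> powr p \<partial>lebesgue) + (\<integral>x. (v x)\<^sup>2 \<partial>lebesgue) + (\<integral>x. \<bar>v x\<bar> powr p \<partial>lebesgue))" .
qed

lemma unit_ball_bounds:
  fixes v :: "real ^ 'n \<Rightarrow> real"
  assumes v: "v \<in> frac_sobolev \<alpha>" and n: "frac_sobolev_norm \<alpha> v \<le> 1"
  shows "(\<integral>x. (v x)\<^sup>2 \<partial>lebesgue) \<le> 1" and "(\<integral>x. \<bar>v x\<bar> powr p \<partial>lebesgue) \<le> S"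
proof -
  show "(\<integral>x. (v x)\<^sup>2 \<partial>lebesgue) \<le> 1"
    using integral_square_le_norm[of v \<alpha>] power_le_one[OF frac_sobolev_norm_nonneg n, of 2] by linarith
  have "S * frac_sobolev_norm \<alpha> v powr p \<le> S * 1"
    using S p n frac_sobolev_norm_nonneg by (intro mult_left_mono powr_le_one) auto
  then show "(\<integral>x. \<bar>v x\<bar> powr p \<partial>lebesgue) \<le> S" using Sobolev[OF v] by simp
qed

text \<open>
  Normalising the increment reduces the pointwise quadratic estimate to a function in the unit ball, whose \<open>L\<^sup>p\<close>
  norm is bounded by Sobolev's inequality.
\<close>

lemma integral_G_remainder:
  assumes u: "u \<in> frac_sobolev \<alpha>" and h: "h \<in> frac_sobolev \<alpha>"
    and \<tau>: "0 < \<tau>" "\<tau> \<le> 1" "frac_sobolev_norm \<alpha> h \<le> \<tau>"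
  shows "\<bar>(\<integral>x. G x (u x + h x) \<partial>lebesgue) - (\<integral>x. G x (u x) \<partial>lebesgue) - (\<integral>x. g x (u x) * h x \<partial>lebesgue)\<bar>
     \<le> C * 2 powr (p - 2) * (1 + (\<integral>x. \<bar>u x\<bar> powr p \<partial>lebesgue) + 2 * S) * \<tau>\<^sup>2"
proof -
  define k where "k = (\<lambda>x. (1 / \<tau>) * h x)"
  have k: "k \<in> frac_sobolev \<alpha>" unfolding k_def by (rule frac_sobolev_cmult[OF h])
  have hk: "h x = \<tau> * k x" for x using \<tau> by (simp add: k_def)
  have nk: "frac_sobolev_norm \<alpha> k \<le> 1"
    unfolding k_def frac_sobolev_norm_cmult using \<tau> by (simp add: field_simps)
  let ?r = "\<lambda>x. G x (u x + h x) - G x (u x) - g x (u x) * h x"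
  let ?b = "\<lambda>x. C * 2 powr (p - 2) * \<tau>\<^sup>2 * ((k x)\<^sup>2 + \<bar>u x\<bar> powr p + 2 * \<bar>k x\<bar> powr p)"
  have le: "AE x in lebesgue. \<bar>?r x\<bar> \<le> ?b x"
    using growth
  proof eventually_elim
    case (elim x)
    then show ?case using growth_pair_remainder[OF elim p C, of \<tau> "u x" "k x"] \<tau> by (simp add: hk)
  qed
  have i1: "integrable lebesgue (\<lambda>x. G x (u x + h x))" by (rule integrable_G[OF frac_sobolev_add[OF u h]])
  have i2: "integrable lebesgue (\<lambda>x. G x (u x))" by (rule integrable_G[OF u])
  have i3: "integrable lebesgue (\<lambda>x. g x (u x) * h x)" by (rule integrable_g_times[OF u h])
  have ir: "integrable lebesgue ?r" using i1 i2 i3 by simp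
  have ib: "integrable lebesgue ?b"
    using frac_sobolev_integrable_square[OF k] Sobolev_integrable[OF u] Sobolev_integrable[OF k] by simp
  have "(\<integral>x. G x (u x + h x) \<partial>lebesgue) - (\<integral>x. G x (u x) \<partial>lebesgue) - (\<integral>x. g x (u x) * h x \<partial>lebesgue) = (\<integral>x. ?r x \<partial>lebesgue)"
    using i1 i2 i3 by simp
  also have "\<bar>\<dots>\<bar> \<le> (\<integral>x. \<bar>?r x\<bar> \<partial>lebesgue)" by (rule integral_abs_bound)
  also have "\<dots> \<le> (\<integral>x. ?b x \<partial>lebesgue)" by (rule integral_mono_AE[OF integrable_abs[OF ir] ib le])
  also have "\<dots> = C * 2 powr (p - 2) * \<tau>\<^sup>2 *
      ((\<integral>x. (k x)\<^sup>2 \<partial>lebesgue) + (\<integral>x. \<bar>u x\<bar> powr p \<partial>lebesgue) + 2 * (\<integral>x. \<bar>k x\<bar> powr p \<partial>lebesgue))"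
    using frac_sobolev_integrable_square[OF k] Sobolev_integrable[OF u] Sobolev_integrable[OF k] by simp
  also have "\<dots> \<le> C * 2 powr (p - 2) * \<tau>\<^sup>2 * (1 + (\<integral>x. \<bar>u x\<bar> powr p \<partial>lebesgue) + 2 * S)"
    using unit_ball_bounds[OF k nk] C by (intro mult_left_mono) auto
  finally show ?thesis by (simp add: mult_ac)
qed

text \<open>
  The integrands are almost dominated: by Young's inequality \<open>\<bar>g x (w n x) v x\<bar>\<close> is a small multiple of
  \<open>(w n x)\<^sup>2 + \<bar>w n x\<bar>\<^sup>p\<close>, whose integrals are bounded, plus a fixed integrable function of \<open>v\<close>.
\<close>

lemma integral_g_times_tendsto:
  assumes w: "\<And>n. w n \<in> frac_sobolev \<alpha>" and B: "\<And>n. frac_sobolev_norm \<alpha> (w n) \<le> B"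
    and w0: "w0 \<in> frac_sobolev \<alpha>" and lim: "AE x in lebesgue. (\<lambda>n. w n x) \<longlonglongrightarrow> w0 x"
    and v: "v \<in> frac_sobolev \<alpha>"
  shows "(\<lambda>n. \<integral>x. g x (w n x) * v x \<partial>lebesgue) \<longlonglongrightarrow> (\<integral>x. g x (w0 x) * v x \<partial>lebesgue)"
proof -
  let ?D = "C * 2 powr (p - 2)"
  let ?h = "\<lambda>n x. g x (w n x) * v x - g x (w0 x) * v x"
  have B0: "B \<ge> 0" using B[of 0] frac_sobolev_norm_nonneg[of \<alpha> "w 0"] by linarith
  have iw: "integrable lebesgue (\<lambda>x. g x (w n x) * v x)" for n by (rule integrable_g_times[OF w v])
  have i0: "integrable lebesgue (\<lambda>x. g x (w0 x) * v x)" by (rule integrable_g_times[OF w0 v])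
  have "(\<lambda>n. \<integral>x. \<bar>?h n x\<bar> \<partial>lebesgue) \<longlonglongrightarrow> 0"
  proof (rule almost_dominated_convergence(2)[where h="?h" and M=lebesgue
      and g="\<lambda>n x. ?D * ((w n x)\<^sup>2 + \<bar>w n x\<bar> powr p)" and B="?D * (B\<^sup>2 + S * B powr p)"])
    show "?h n \<in> borel_measurable lebesgue" for n using iw[of n] i0 by simp
    show "AE x in lebesgue. (\<lambda>n. ?h n x) \<longlonglongrightarrow> 0"
      using lim growth
    proof eventually_elim
      case (elim x)
      have "isCont (g x) (w0 x)" using elim(2) unfolding growth_pair_def by (meson DERIV_isCont)
      then have "(\<lambda>n. g x (w n x)) \<longlonglongrightarrow> g x (w0 x)" using elim(1) by (rule isCont_tendsto_compose)
      then have "(\<lambda>n. ?h n x) \<longlonglongrightarrow> g x (w0 x) * v x - g x (w0 x) * v x" by (intro tendsto_intros)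
      then show ?case by simp
    qed
    show "integrable lebesgue (\<lambda>x. ?D * ((w n x)\<^sup>2 + \<bar>w n x\<bar> powr p))" for n
      using frac_sobolev_integrable_square[OF w] Sobolev_integrable[OF w] by simp
    show "0 \<le> ?D * ((w n x)\<^sup>2 + \<bar>w n x\<bar> powr p)" for n x using C by simp
    show "(\<integral>x. ?D * ((w n x)\<^sup>2 + \<bar>w n x\<bar> powr p) \<partial>lebesgue) \<le> ?D * (B\<^sup>2 + S * B powr p)" for n
    proof -
      have "(\<integral>x. (w n x)\<^sup>2 \<partial>lebesgue) \<le> B\<^sup>2"
        using integral_square_le_norm[of "w n" \<alpha>] power_mono[OF B frac_sobolev_norm_nonneg, of n 2] by linarith
      moreover have "S * frac_sobolev_norm \<alpha> (w n) powr p \<le> S * B powr p"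
        using S p B frac_sobolev_norm_nonneg by (intro mult_left_mono powr_mono2) auto
      ultimately have "(\<integral>x. (w n x)\<^sup>2 \<partial>lebesgue) + (\<integral>x. \<bar>w n x\<bar> powr p \<partial>lebesgue) \<le> B\<^sup>2 + S * B powr p"
        using Sobolev[OF w[of n]] by linarith
      then have "?D * ((\<integral>x. (w n x)\<^sup>2 \<partial>lebesgue) + (\<integral>x. \<bar>w n x\<bar> powr p \<partial>lebesgue)) \<le> ?D * (B\<^sup>2 + S * B powr p)"
        using C by (intro mult_left_mono) auto
      then show ?thesis
        using frac_sobolev_integrable_square[OF w[of n]] Sobolev_integrable[OF w[of n]] by simp
    qed
    fix e :: real assume e: "e > 0"
    let ?\<Phi> = "\<lambda>x. ?D * (e powr (- 1) * (v x)\<^sup>2 + e powr (1 - p) * \<bar>v x\<bar> powr p) + \<bar>g x (w0 x) * v x\<bar>"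
    have "integrable lebesgue ?\<Phi>"
      using product_bound_integrable[OF v] i0 by (intro Bochner_Integration.integrable_add integrable_abs)
    moreover have "AE x in lebesgue. \<bar>?h n x\<bar> \<le> e * (?D * ((w n x)\<^sup>2 + \<bar>w n x\<bar> powr p)) + ?\<Phi> x" for n
      using growth
    proof eventually_elim
      case (elim x)
      have "?D * (e * ((w n x)\<^sup>2 + \<bar>w n x\<bar> powr p) + (e powr (- 1) * (v x)\<^sup>2 + e powr (1 - p) * \<bar>v x\<bar> powr p))
         = e * (?D * ((w n x)\<^sup>2 + \<bar>w n x\<bar> powr p)) + ?D * (e powr (- 1) * (v x)\<^sup>2 + e powr (1 - p) * \<bar>v x\<bar> powr p)"
        by (simp only: distrib_left mult_ac)
      then show ?case
        using growth_pair_product_bound[OF elim p C e, of "w n x" "v x"] by linarith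
    qed
    ultimately show "\<exists>\<Phi>. integrable lebesgue \<Phi> \<and> (\<forall>n. AE x in lebesgue. \<bar>?h n x\<bar> \<le> e * (?D * ((w n x)\<^sup>2 + \<bar>w n x\<bar> powr p)) + \<Phi> x)"
      by (intro exI[of _ ?\<Phi>]) simp
  qed
  then have l0: "(\<lambda>n. \<integral>x. \<bar>?h n x\<bar> \<partial>lebesgue) \<longlonglongrightarrow> 0" .
  have "norm ((\<integral>x. g x (w n x) * v x \<partial>lebesgue) - (\<integral>x. g x (w0 x) * v x \<partial>lebesgue)) \<le> (\<integral>x. \<bar>?h n x\<bar> \<partial>lebesgue)" for n
  proof -
    have "(\<integral>x. g x (w n x) * v x \<partial>lebesgue) - (\<integral>x. g x (w0 x) * v x \<partial>lebesgue) = (\<integral>x. ?h n x \<partial>lebesgue)"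
      using iw[of n] i0 by simp
    then show ?thesis by (simp only: real_norm_def integral_abs_bound)
  qed
  then have "(\<lambda>n. (\<integral>x. g x (w n x) * v x \<partial>lebesgue) - (\<integral>x. g x (w0 x) * v x \<partial>lebesgue)) \<longlonglongrightarrow> 0"
    by (intro Lim_null_comparison[OF _ l0] always_eventually allI)
  then show ?thesis by (simp add: LIM_zero_iff)
qed

end


section \<open>Frechet derivatives on the fractional Sobolev space\<close>

text \<open>
  The usual normalisation is possible only if the norm is positive. If it vanishes, homogeneity bounds \<open>L v\<close>
  by every positive multiple of \<open>C\<close>.
\<close>

lemma homogeneous_bound:
  fixes L :: "(real ^ 'n \<Rightarrow> real) \<Rightarrow> real"
  assumes hom: "\<And>v t. v \<in> frac_sobolev \<alpha> \<Longrightarrow> L (\<lambda>x. t * v x) = t * L v"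
    and ball: "\<And>k. k \<in> frac_sobolev \<alpha> \<Longrightarrow> frac_sobolev_norm \<alpha> k \<le> 1 \<Longrightarrow> \<bar>L k\<bar> \<le> C"
    and v: "v \<in> frac_sobolev \<alpha>"
  shows "\<bar>L v :: real\<bar> \<le> C * frac_sobolev_norm \<alpha> v"
proof -
  have scaled: "\<bar>L v\<bar> \<le> C * s" if s: "s > 0" "frac_sobolev_norm \<alpha> v \<le> s" for s
  proof -
    have "\<bar>L (\<lambda>x. (1 / s) * v x)\<bar> \<le> C"
      using s by (intro ball frac_sobolev_cmult v) (simp add: frac_sobolev_norm_cmult[of \<alpha> "1/s", simplified] field_simps)
    then have "\<bar>(1 / s) * L v\<bar> \<le> C" unfolding hom[OF v] .
    then show ?thesis using s by (simp add: abs_mult field_simps)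
  qed
  show ?thesis
  proof (cases "frac_sobolev_norm \<alpha> v = 0")
    case False
    then show ?thesis using frac_sobolev_norm_nonneg[of \<alpha> v] by (intro scaled) auto
  next
    case True
    have l: "(\<lambda>j. C * (1 / real (Suc j))) \<longlonglongrightarrow> C * 0"
      using LIMSEQ_inverse_real_of_nat by (intro tendsto_mult tendsto_const) (simp add: inverse_eq_divide)
    have "\<bar>L v\<bar> \<le> C * 0"
    proof (rule LIMSEQ_le_const[OF l], intro exI[of _ 0] allI impI)
      show "\<bar>L v\<bar> \<le> C * (1 / real (Suc j))" for j
        using True by (intro scaled) (auto simp del: of_nat_Suc)
    qed
    then show ?thesis using True by simp
  qed
qed

lemma has_frechet_derivativeI_quadratic:
  fixes L :: "(real ^ 'n \<Rightarrow> real) \<Rightarrow> real"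
  assumes add: "\<And>v w. v \<in> frac_sobolev \<alpha> \<Longrightarrow> w \<in> frac_sobolev \<alpha> \<Longrightarrow> L (\<lambda>x. v x + w x) = L v + L w"
    and hom: "\<And>v t. v \<in> frac_sobolev \<alpha> \<Longrightarrow> L (\<lambda>x. t * v x) = t * L v"
    and ball: "\<And>k. k \<in> frac_sobolev \<alpha> \<Longrightarrow> frac_sobolev_norm \<alpha> k \<le> 1 \<Longrightarrow> \<bar>L k\<bar> \<le> C"
    and rem: "\<And>h \<tau>. h \<in> frac_sobolev \<alpha> \<Longrightarrow> 0 < \<tau> \<Longrightarrow> \<tau> \<le> 1 \<Longrightarrow> frac_sobolev_norm \<alpha> h \<le> \<tau> \<Longrightarrow>
        \<bar>J (\<lambda>x. u x + h x) - J u - L h\<bar> \<le> R * \<tau>\<^sup>2"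
  shows "has_frechet_derivative \<alpha> J u L"
  unfolding has_frechet_derivative_def
proof (intro conjI ballI allI impI)
  show "\<exists>C. \<forall>v\<in>frac_sobolev \<alpha>. \<bar>L v\<bar> \<le> C * frac_sobolev_norm \<alpha> v"
    using homogeneous_bound[of \<alpha> L C, OF hom ball] by blast
  fix e :: real assume e: "e > 0"
  define d where "d = min 1 (e / (\<bar>R\<bar> + 1))"
  have d: "d > 0" "d \<le> 1" "\<bar>R\<bar> * d \<le> e"
  proof -
    have "\<bar>R\<bar> * d \<le> (\<bar>R\<bar> + 1) * (e / (\<bar>R\<bar> + 1))" using e by (intro mult_mono) (auto simp: d_def)
    then show "d > 0" "d \<le> 1" "\<bar>R\<bar> * d \<le> e" using e by (auto simp: d_def)
  qed
  show "\<exists>\<delta>>0. \<forall>h\<in>frac_sobolev \<alpha>. frac_sobolev_norm \<alpha> h < \<delta> \<longrightarrow>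
      \<bar>J (\<lambda>x. u x + h x) - J u - L h\<bar> \<le> e * frac_sobolev_norm \<alpha> h"
  proof (intro exI[of _ d] conjI ballI impI d(1))
    fix h :: "real ^ 'n \<Rightarrow> real" assume h: "h \<in> frac_sobolev \<alpha>" "frac_sobolev_norm \<alpha> h < d"
    let ?n = "frac_sobolev_norm \<alpha> h"
    have n0: "?n \<ge> 0" by (rule frac_sobolev_norm_nonneg)
    show "\<bar>J (\<lambda>x. u x + h x) - J u - L h\<bar> \<le> e * ?n"
    proof (cases "?n = 0")
      case False
      then have "\<bar>J (\<lambda>x. u x + h x) - J u - L h\<bar> \<le> R * ?n\<^sup>2"
        using n0 h d by (intro rem) auto
      also have "\<dots> \<le> \<bar>R\<bar> * (d * ?n)"
        using n0 h(2) by (intro mult_mono) (auto simp: power2_eq_square mult_right_mono)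
      also have "\<dots> = (\<bar>R\<bar> * d) * ?n" by simp
      also have "\<dots> \<le> e * ?n" using d n0 by (intro mult_right_mono) auto
      finally show ?thesis .
    next
      case True
      have "(\<lambda>j. 1 / real (Suc j)) \<longlonglongrightarrow> 0"
        using LIMSEQ_inverse_real_of_nat by (simp add: inverse_eq_divide)
      then have l: "(\<lambda>j. R * (1 / real (Suc j))\<^sup>2) \<longlonglongrightarrow> R * 0\<^sup>2" by (intro tendsto_intros)
      have "\<bar>J (\<lambda>x. u x + h x) - J u - L h\<bar> \<le> R * 0\<^sup>2"
      proof (rule LIMSEQ_le_const[OF l], intro exI[of _ 0] allI impI)
        show "\<bar>J (\<lambda>x. u x + h x) - J u - L h\<bar> \<le> R * (1 / real (Suc j))\<^sup>2" for j
          using True by (intro rem h) (auto simp: field_simps)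
      qed
      then show ?thesis using True by simp
    qed
  qed
qed (use add hom in auto)

lemma has_frechet_derivative_unique:
  assumes L: "has_frechet_derivative \<alpha> J u L" and M: "has_frechet_derivative \<alpha> J u M"
    and v: "v \<in> frac_sobolev \<alpha>"
  shows "L v = M v"
proof (rule ccontr)
  assume ne: "L v \<noteq> M v"
  let ?n = "frac_sobolev_norm \<alpha> v"
  define e where "e = \<bar>L v - M v\<bar> / (4 * (?n + 1))"
  have n0: "?n \<ge> 0" by (rule frac_sobolev_norm_nonneg)
  have e: "e > 0" using ne n0 by (simp add: e_def)
  have "4 * (a / (4 * b) * b) = a" if "b > 0" for a b :: real using that by simp
  from this[of "?n + 1"] have e4: "4 * (e * (?n + 1)) = \<bar>L v - M v\<bar>" unfolding e_def using n0 by simp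
  obtain d1 where d1: "d1 > 0" "\<And>h. h \<in> frac_sobolev \<alpha> \<Longrightarrow> frac_sobolev_norm \<alpha> h < d1 \<Longrightarrow>
      \<bar>J (\<lambda>x. u x + h x) - J u - L h\<bar> \<le> e * frac_sobolev_norm \<alpha> h"
    using L e unfolding has_frechet_derivative_def by blast
  obtain d2 where d2: "d2 > 0" "\<And>h. h \<in> frac_sobolev \<alpha> \<Longrightarrow> frac_sobolev_norm \<alpha> h < d2 \<Longrightarrow>
      \<bar>J (\<lambda>x. u x + h x) - J u - M h\<bar> \<le> e * frac_sobolev_norm \<alpha> h"
    using M e unfolding has_frechet_derivative_def by blast
  define t where "t = min d1 d2 / (2 * (?n + 1))"
  have t: "t > 0" using d1 d2 n0 by (simp add: t_def)
  have "t * ?n < min d1 d2"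
  proof -
    have "t * ?n \<le> t * (?n + 1)" using t by simp
    also have "\<dots> = min d1 d2 / 2" using n0 by (simp add: t_def field_simps)
    also have "\<dots> < min d1 d2" using d1(1) d2(1) by (simp add: min_def)
    finally show ?thesis .
  qed
  then have nt: "frac_sobolev_norm \<alpha> (\<lambda>x. t * v x) < d1" "frac_sobolev_norm \<alpha> (\<lambda>x. t * v x) < d2"
    using t by (simp_all add: frac_sobolev_norm_cmult)
  have tv: "(\<lambda>x. t * v x) \<in> frac_sobolev \<alpha>" by (rule frac_sobolev_cmult[OF v])
  have Lt: "L (\<lambda>x. t * v x) = t * L v" and Mt: "M (\<lambda>x. t * v x) = t * M v"
    using L M v unfolding has_frechet_derivative_def by blast+
  have "\<bar>t * L v - t * M v\<bar> \<le> 2 * (e * (t * ?n))"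
    using d1(2)[OF tv nt(1)] d2(2)[OF tv nt(2)] t unfolding Lt Mt by (simp add: frac_sobolev_norm_cmult)
  then have "t * \<bar>L v - M v\<bar> \<le> t * (2 * (e * ?n))"
    using t by (simp add: right_diff_distrib[symmetric] abs_mult mult_ac)
  then have "\<bar>L v - M v\<bar> \<le> 2 * (e * ?n)" using t by simp
  moreover have "2 * (e * ?n) < 4 * (e * (?n + 1))"
    using mult_nonneg_nonneg[OF less_imp_le[OF e] n0] e unfolding distrib_left mult_1_right by linarith
  ultimately show False using e4 by linarith
qed

lemma has_frechet_derivative_along_ray:
  assumes J: "has_frechet_derivative \<alpha> J (\<lambda>x. t * v x) L" and v: "v \<in> frac_sobolev \<alpha>"
  shows "((\<lambda>s. J (\<lambda>x. s * v x)) has_real_derivative L v) (at t)"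
  unfolding DERIV_def
proof (rule LIM_I)
  fix r :: real assume r: "r > 0"
  let ?n = "frac_sobolev_norm \<alpha> v"
  have n0: "?n \<ge> 0" by (rule frac_sobolev_norm_nonneg)
  define e where "e = r / (2 * (?n + 1))"
  have e: "e > 0" "e * ?n < r" 
  proof -
    show "e > 0" using r n0 by (simp add: e_def)
    then have "e * ?n \<le> e * (?n + 1)" by simp
    also have "\<dots> = r / 2" using n0 by (simp add: e_def field_simps)
    finally show "e * ?n < r" using r by linarith
  qed
  obtain d where d: "d > 0" "\<And>h. h \<in> frac_sobolev \<alpha> \<Longrightarrow> frac_sobolev_norm \<alpha> h < d \<Longrightarrow>
      \<bar>J (\<lambda>x. t * v x + h x) - J (\<lambda>x. t * v x) - L h\<bar> \<le> e * frac_sobolev_norm \<alpha> h"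
    using J e unfolding has_frechet_derivative_def by blast
  have hom: "L (\<lambda>x. s * v x) = s * L v" for s
    using J v unfolding has_frechet_derivative_def by blast
  show "\<exists>s>0. \<forall>h. h \<noteq> 0 \<and> norm (h - 0) < s \<longrightarrow> norm ((J (\<lambda>x. (t + h) * v x) - J (\<lambda>x. t * v x)) / h - L v) < r"
  proof (intro exI[of _ "d / (?n + 1)"] conjI allI impI)
    show "d / (?n + 1) > 0" using d n0 by simp
    fix h :: real assume h: "h \<noteq> 0 \<and> norm (h - 0) < d / (?n + 1)"
    have "\<bar>h\<bar> * ?n \<le> \<bar>h\<bar> * (?n + 1)" by (rule mult_left_mono) auto
    also have "\<dots> < d" using h n0 by (simp add: field_simps)
    finally have "frac_sobolev_norm \<alpha> (\<lambda>x. h * v x) < d" by (simp add: frac_sobolev_norm_cmult)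
    from d(2)[OF frac_sobolev_cmult[OF v] this]
    have "\<bar>J (\<lambda>x. (t + h) * v x) - J (\<lambda>x. t * v x) - h * L v\<bar> \<le> e * (\<bar>h\<bar> * ?n)"
      by (simp add: hom frac_sobolev_norm_cmult distrib_right)
    moreover have "(J (\<lambda>x. (t + h) * v x) - J (\<lambda>x. t * v x)) / h - L v = (J (\<lambda>x. (t + h) * v x) - J (\<lambda>x. t * v x) - h * L v) / h"
      using h by (simp add: field_simps)
    ultimately have "norm ((J (\<lambda>x. (t + h) * v x) - J (\<lambda>x. t * v x)) / h - L v) \<le> e * (\<bar>h\<bar> * ?n) / \<bar>h\<bar>"
      by (simp only: real_norm_def abs_divide divide_right_mono abs_ge_zero)
    also have "\<dots> = e * ?n" using h by simp
    finally show "norm ((J (\<lambda>x. (t + h) * v x) - J (\<lambda>x. t * v x)) / h - L v) < r" using e by simp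
  qed
qed

section \<open>The energy functional\<close>

lemma lebesgue_AE_ex:
  assumes "AE x in (lebesgue :: 'a::euclidean_space measure). P x"
  shows "\<exists>x. P x"
proof (rule ccontr)
  assume "\<nexists>x. P x"
  then have "AE x in (lebesgue :: 'a measure). False" using assms by simp
  then have "ae_filter (lebesgue :: 'a measure) = bot" unfolding trivial_limit_def .
  then show False by (simp add: ae_filter_eq_bot_iff)
qed

lemma Linf_bound:
  assumes "g \<in> Linf"
  obtains k where "0 \<le> k" "Linf_norm g = ereal k" "AE x in lebesgue. \<bar>g x\<bar> \<le> k"
proof -
  have ae: "AE x in lebesgue. ereal \<bar>g x\<bar> \<le> Linf_norm g"
    unfolding Linf_norm_def by (rule esssup_AE)
  then obtain x where "ereal \<bar>g x\<bar> \<le> Linf_norm g" using lebesgue_AE_ex by blast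
  moreover have "Linf_norm g < \<infinity>" using assms by (simp add: Linf_def)
  ultimately obtain k where k: "Linf_norm g = ereal k" "0 \<le> k"
    by (cases "Linf_norm g") auto
  then show ?thesis using that[of k] ae by simp
qed

lemma essinf_pos_bound:
  assumes "essinf_lebesgue g > 0"
  obtains k where "k > 0" "AE x in lebesgue. k \<le> g x"
proof -
  obtain c where c: "0 < c" "c < essinf_lebesgue g" using dense[OF assms] by blast
  have ae: "AE x in lebesgue. c < ereal (g x)"
    using c(2) unfolding essinf_lebesgue_def by (rule less_LiminfD)
  have "c \<noteq> \<infinity>" using c by auto
  then obtain k where k: "c = ereal k" using c(1) by (cases c) auto
  show ?thesis
    by (rule that[of k]) (use c k ae in \<open>auto elim: eventually_mono\<close>)
qed

lemma has_frechet_derivative_cong: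
  assumes "has_frechet_derivative \<alpha> J u L" and "\<And>v. v \<in> frac_sobolev \<alpha> \<Longrightarrow> L v = M v"
  shows "has_frechet_derivative \<alpha> J u M"
  using assms frac_sobolev_add frac_sobolev_cmult unfolding has_frechet_derivative_def
  by (simp add: frac_sobolev_add frac_sobolev_cmult)

locale semilinear_problem =
  fixes \<alpha> q p :: real
    and V Vper :: "real ^ 'n \<Rightarrow> real"
    and f :: "real ^ 'n \<Rightarrow> real \<Rightarrow> real"
  assumes \<alpha>: "0 < \<alpha>" "\<alpha> < 2" "real CARD('n) > \<alpha>"
    and condV: "cond_V \<alpha> V (\<lambda>_. 0) Vper"
    and F1: "cond_F1 \<alpha> q p f" and F2: "cond_F2 f" and F3: "cond_F3 q f" and F4: "cond_F4 q f" and F5: "cond_F5 p f"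
begin

abbreviation "H \<equiv> frac_sobolev \<alpha> :: (real ^ 'n \<Rightarrow> real) set"
abbreviation "nrm \<equiv> frac_sobolev_norm \<alpha> :: (real ^ 'n \<Rightarrow> real) \<Rightarrow> real"
abbreviation "F \<equiv> primitive f"
abbreviation "leb \<equiv> lebesgue :: (real ^ 'n) measure"

lemma qp: "2 < q" "q < p" "2 < p"
  using F1 by (auto simp: cond_F1_def)

lemma subcritical: "p * (real CARD('n) - \<alpha>) < 2 * real CARD('n)"
  using F1 \<alpha> by (simp add: cond_F1_def critical_exponent_def field_simps)

lemma Sobolev_ex: "\<exists>S :: real. S > 0 \<and> (\<forall>u \<in> H. integrable lebesgue (\<lambda>x. \<bar>u x\<bar> powr p) \<and>
       (\<integral>x. \<bar>u x\<bar> powr p \<partial>lebesgue) \<le> S * nrm u powr p)"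
  using Sobolev_inequality[OF \<alpha>(1) \<alpha>(3) qp(3) subcritical] by blast

lemma frac_const_pos: "frac_const TYPE('n) \<alpha> > 0"
proof -
  have "- \<alpha> / 2 \<notin> \<int>\<^sub>\<le>\<^sub>0"
  proof
    assume "- \<alpha> / 2 \<in> \<int>\<^sub>\<le>\<^sub>0"
    then obtain n where "- \<alpha> / 2 = of_int n" by (auto elim!: nonpos_Ints_cases)
    then have "real_of_int n < 0" "real_of_int (- 1) < real_of_int n" using \<alpha> by simp_all
    then have "n < 0" "- 1 < n" by (simp_all only: of_int_less_iff of_int_less_0_iff)
    then show False by linarith
  qed
  then have "Gamma (- \<alpha> / 2) \<noteq> 0" by (simp add: Gamma_eq_zero_iff)
  moreover have "Gamma ((real CARD('n) + \<alpha>) / 2) > 0" using \<alpha> by (intro Gamma_real_pos) auto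
  ultimately show ?thesis by (simp add: frac_const_def)
qed

lemma V_bounds:
  obtains V0 V1 where "0 < V0" "V0 \<le> V1" "AE x in leb. V0 \<le> V x \<and> V x \<le> V1"
proof -
  obtain V1 where V1: "AE x in lebesgue. \<bar>V x\<bar> \<le> V1" using condV Linf_bound[of V] by (auto simp: cond_V_def)
  obtain V0 where V0: "V0 > 0" "AE x in lebesgue. V0 \<le> V x" using condV essinf_pos_bound[of V] by (auto simp: cond_V_def)
  have ae: "AE x in leb. V0 \<le> V x \<and> V x \<le> V1" using V0(2) V1 by eventually_elim auto
  then obtain x where "V0 \<le> V x \<and> V x \<le> V1" using lebesgue_AE_ex by blast
  then show ?thesis using that[of V0 V1] V0(1) ae by auto
qed

lemma V_measurable: "V \<in> borel_measurable leb"
  using condV by (simp add: cond_V_def Linf_def)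

lemma V_periodic:
  assumes "z \<in> int_lattice"
  shows "AE x in leb. V (x + z) = V x"
proof -
  have ae: "AE x in leb. V x = Vper x" "AE x in leb. Vper (x + z) = Vper x"
    using condV assms by (auto simp: cond_V_def ae_periodic_def)
  show ?thesis using ae(1) ae(2) AE_lebesgue_translation[OF ae(1), of z] by eventually_elim simp
qed

lemma f_zero:
  assumes "continuous_on UNIV (f x)"
  shows "f x 0 = 0"
proof -
  obtain d where d: "d > 0" "\<And>x u. 0 < \<bar>u\<bar> \<and> \<bar>u\<bar> < d \<Longrightarrow> \<bar>f x u\<bar> \<le> 1 * \<bar>u\<bar>"
    using F2 zero_less_one unfolding cond_F2_def by blast
  have "(f x \<longlongrightarrow> f x 0) (at 0)"
    using assms by (simp add: continuous_on_eq_continuous_at isCont_def)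
  moreover have "(f x \<longlongrightarrow> 0) (at 0)"
  proof (rule Lim_null_comparison)
    show "((\<lambda>u::real. \<bar>u\<bar>) \<longlongrightarrow> 0) (at 0)" by (rule tendsto_rabs_zero[OF tendsto_ident_at])
    show "\<forall>\<^sub>F u in at 0. norm (f x u) \<le> \<bar>u\<bar>"
      unfolding eventually_at using d by (intro exI[of _ d]) (auto simp: dist_real_def)
  qed
  ultimately show ?thesis by (rule LIM_unique)
qed

lemma primitive_derivative:
  assumes "continuous_on UNIV (f x)"
  shows "(F x has_real_derivative f x t) (at t)"
proof -
  let ?a = "- (\<bar>t\<bar> + 1)" and ?b = "\<bar>t\<bar> + 1"
  have "((\<lambda>u. LBINT y=ereal 0..ereal u. f x y) has_vector_derivative f x t) (at t within {?a..?b})"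
    by (rule interval_integral_FTC2) (use assms in \<open>auto intro: continuous_on_subset\<close>)
  then have "(F x has_vector_derivative f x t) (at t within {?a..?b})"
    by (simp add: primitive_def[abs_def])
  moreover have "at t within {?a..?b} = at t" by (rule at_within_interior) auto
  ultimately have "(F x has_vector_derivative f x t) (at t)" by (simp only:)
  then show ?thesis by (simp add: has_real_derivative_iff_has_vector_derivative)
qed

lemma primitive_zero: "F x 0 = 0"
  by (simp add: primitive_def interval_lebesgue_integral_def set_lebesgue_integral_def)

lemma f_continuous: "AE x in leb. continuous_on UNIV (f x)"
  using F1 by (simp add: cond_F1_def)

lemma f_growth:
  obtains c where "c \<ge> 0" "AE x in leb. growth_pair p c (F x) (f x)"
proof -
  obtain r b c where "0 < c" and ae: "AE x in leb. \<forall>u. b * \<bar>u\<bar> powr r \<le> f x u * u - 2 * F x u \<and>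
      \<bar>deriv (f x) u\<bar> \<le> c * (1 + \<bar>u\<bar> powr (p - 2))"
    using F5 unfolding cond_F5_def by blast
  have c: "0 < c" "AE x in leb. \<forall>u. \<bar>deriv (f x) u\<bar> \<le> c * (1 + \<bar>u\<bar> powr (p - 2))"
    using \<open>0 < c\<close> ae by (auto elim: eventually_mono)
  have C1: "AE x in leb. f x C1_differentiable_on UNIV" using F5 by (simp add: cond_F5_def)
  have "AE x in leb. growth_pair p c (F x) (f x)"
    using c(2) C1 f_continuous
  proof eventually_elim
    case (elim x)
    obtain D where D: "\<And>t. (f x has_vector_derivative D t) (at t)"
      using elim(2) by (auto simp: C1_differentiable_on_def)
    then have D': "(f x has_real_derivative D t) (at t)" for t
      by (simp add: has_real_derivative_iff_has_vector_derivative)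
    then have "deriv (f x) t = D t" for t by (rule DERIV_imp_deriv)
    then show ?case
      unfolding growth_pair_def using elim(1) D' primitive_derivative[OF elim(3)] f_zero[OF elim(3)] primitive_zero
      by auto
  qed
  then show ?thesis using that[of c] c(1) by auto
qed

text \<open>
  The term with \<open>K\<close> is absorbed into the nonlinearity, so that differentiability and measurability have to be
  shown only once for all the functionals involved.
\<close>

definition G :: "(real ^ 'n \<Rightarrow> real) \<Rightarrow> real ^ 'n \<Rightarrow> real \<Rightarrow> real" where
  "G K x t = F x t - 1 / q * K x * \<bar>t\<bar> powr q"

definition g :: "(real ^ 'n \<Rightarrow> real) \<Rightarrow> real ^ 'n \<Rightarrow> real \<Rightarrow> real" where
  "g K x t = f x t - K x * (sgn t * \<bar>t\<bar> powr (q - 1))"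

lemma powr_interpolate:
  fixes t :: real
  assumes "0 < a" "a \<le> b"
  shows "\<bar>t\<bar> powr a \<le> 1 + \<bar>t\<bar> powr b"
proof (cases "\<bar>t\<bar> \<le> 1")
  case True
  then have "\<bar>t\<bar> powr a \<le> 1" using assms by (intro powr_le_one) auto
  then show ?thesis by (smt (verit) powr_ge_zero)
next
  case False
  then have "\<bar>t\<bar> powr a \<le> \<bar>t\<bar> powr b" using assms by (intro powr_mono) auto
  then show ?thesis by simp
qed

lemma growth_G:
  assumes f: "growth_pair p c (F x) (f x)" and k: "\<bar>K x\<bar> \<le> k"
  shows "growth_pair p (c + k * (q - 1)) (G K x) (g K x)"
proof -
  obtain f' where f': "\<And>t. (f x has_real_derivative f' t) (at t)" "\<And>t. \<bar>f' t\<bar> \<le> c * (1 + \<bar>t\<bar> powr (p - 2))"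
    using f unfolding growth_pair_def by blast
  have F': "(F x has_real_derivative f x t) (at t)" for t using f by (simp add: growth_pair_def)
  have k0: "k \<ge> 0" using k by linarith
  have "(G K x has_real_derivative g K x t) (at t)" for t
  proof -
    have "((\<lambda>t. F x t - (1 / q * K x) * \<bar>t\<bar> powr q) has_real_derivative
        f x t - (1 / q * K x) * (q * (sgn t * \<bar>t\<bar> powr (q - 1)))) (at t)"
      using qp by (intro DERIV_diff DERIV_cmult F' DERIV_abs_powr) auto
    then show ?thesis using qp by (simp add: G_def[abs_def] g_def)
  qed
  moreover have "(g K x has_real_derivative (f' t - K x * ((q - 1) * \<bar>t\<bar> powr (q - 1 - 1)))) (at t)" for t
    unfolding g_def[abs_def] using qp by (intro DERIV_diff DERIV_cmult f' DERIV_signed_powr) auto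
  moreover have "\<bar>f' t - K x * ((q - 1) * \<bar>t\<bar> powr (q - 1 - 1))\<bar> \<le> (c + k * (q - 1)) * (1 + \<bar>t\<bar> powr (p - 2))" for t
  proof -
    have "\<bar>K x * ((q - 1) * \<bar>t\<bar> powr (q - 1 - 1))\<bar> = \<bar>K x\<bar> * ((q - 1) * \<bar>t\<bar> powr (q - 2))"
      using qp by (simp add: abs_mult)
    also have "\<dots> \<le> k * ((q - 1) * (1 + \<bar>t\<bar> powr (p - 2)))"
      using k k0 qp by (intro mult_mono powr_interpolate mult_left_mono) auto
    finally have "\<bar>K x * ((q - 1) * \<bar>t\<bar> powr (q - 1 - 1))\<bar> \<le> k * ((q - 1) * (1 + \<bar>t\<bar> powr (p - 2)))" .
    then have "\<bar>f' t - K x * ((q - 1) * \<bar>t\<bar> powr (q - 1 - 1))\<bar> \<le> c * (1 + \<bar>t\<bar> powr (p - 2)) + k * ((q - 1) * (1 + \<bar>t\<bar> powr (p - 2)))"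
      using f'(2)[of t] by linarith
    then show ?thesis by (simp add: algebra_simps)
  qed
  moreover have "G K x 0 = 0" "g K x 0 = 0" using f by (simp_all add: growth_pair_def G_def g_def)
  ultimately show ?thesis
    unfolding growth_pair_def
    by (intro conjI allI exI[of _ "\<lambda>t. f' t - K x * ((q - 1) * \<bar>t\<bar> powr (q - 1 - 1))"])
qed

lemma G_measurable:
  assumes K: "K \<in> borel_measurable leb" and u: "u \<in> borel_measurable leb"
  shows "(\<lambda>x. G K x (u x)) \<in> borel_measurable leb"
proof -
  have "AE x in leb. f x \<in> borel_measurable borel"
    using f_continuous by eventually_elim (rule borel_measurable_continuous_onI)
  then have "(\<lambda>x. F x (u x)) \<in> borel_measurable leb"
    using F1 u by (intro borel_measurable_primitive) (auto simp: cond_F1_def)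
  then show ?thesis unfolding G_def using K u by simp
qed

lemma cond_K_measurable: "cond_K K \<Longrightarrow> K \<in> borel_measurable lebesgue"
  by (simp add: cond_K_def Linf_def)

lemma cond_K_zero: "cond_K (\<lambda>_ :: real ^ 'n. 0)"
proof -
  have "Linf_norm (\<lambda>_ :: real ^ 'n. 0) \<le> 0"
    unfolding Linf_norm_def by (rule esssup_I) (auto simp: zero_ereal_def)
  then show ?thesis by (auto simp: cond_K_def Linf_def ae_periodic_def intro: order_le_less_trans)
qed

lemma superposition_G:
  assumes K: "cond_K K"
  obtains C S where "superposition \<alpha> p C S (G K) (g K)"
proof -
  obtain S where S: "S > 0" "\<forall>u \<in> H. integrable lebesgue (\<lambda>x. \<bar>u x\<bar> powr p) \<and>
       (\<integral>x. \<bar>u x\<bar> powr p \<partial>lebesgue) \<le> S * nrm u powr p" using Sobolev_ex by blast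
  obtain c where c: "c \<ge> 0" "AE x in leb. growth_pair p c (F x) (f x)" using f_growth .
  obtain k where k: "0 \<le> k" "AE x in lebesgue. \<bar>K x\<bar> \<le> k" using K Linf_bound[of K] by (auto simp: cond_K_def)
  have "superposition \<alpha> p (c + k * (q - 1)) S (G K) (g K)"
  proof
    show "AE x in lebesgue. growth_pair p (c + k * (q - 1)) (G K x) (g K x)"
      using c(2) k(2) by eventually_elim (rule growth_G)
    show "(\<lambda>x. G K x (u x)) \<in> borel_measurable lebesgue" if "u \<in> borel_measurable lebesgue" for u
      by (rule G_measurable[OF cond_K_measurable[OF K] that])
  qed (use qp c k S in auto)
  then show ?thesis by (rule that)
qed

text \<open>
  The symmetric form whose halved diagonal is the quadratic part of the energy.
\<close>

definition bil :: "(real ^ 'n \<Rightarrow> real) \<Rightarrow> (real ^ 'n \<Rightarrow> real) \<Rightarrow> real" where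
  "bil u v = frac_const TYPE('n) \<alpha> * (\<integral>z. diff_quot \<alpha> u z * diff_quot \<alpha> v z \<partial>(leb \<Otimes>\<^sub>M leb)) + (\<integral>x. V x * (u x * v x) \<partial>leb)"

lemma integrable_diff_quot_mult:
  "u \<in> H \<Longrightarrow> v \<in> H \<Longrightarrow> integrable (leb \<Otimes>\<^sub>M leb) (\<lambda>z. diff_quot \<alpha> u z * diff_quot \<alpha> v z)"
  by (rule sq_integrable_mult) (simp_all add: frac_sobolev_iff)

lemma integrable_V_mult:
  assumes u: "u \<in> H" and v: "v \<in> H"
  shows "integrable leb (\<lambda>x. V x * (u x * v x))"
proof -
  obtain V0 V1 where V: "0 < V0" "V0 \<le> V1" "AE x in leb. V0 \<le> V x \<and> V x \<le> V1" using V_bounds .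
  have i: "integrable leb (\<lambda>x. u x * v x)" by (rule sq_integrable_mult[OF frac_sobolev_sq_integrable[OF u] frac_sobolev_sq_integrable[OF v]])
  show ?thesis
  proof (rule Bochner_Integration.integrable_bound)
    show "integrable leb (\<lambda>x. V1 * (u x * v x))" using i by simp
    show "(\<lambda>x. V x * (u x * v x)) \<in> borel_measurable leb" using V_measurable i by simp
    show "AE x in leb. norm (V x * (u x * v x)) \<le> norm (V1 * (u x * v x))"
      using V(3) by eventually_elim (use V(1) in \<open>auto simp: abs_mult intro!: mult_right_mono\<close>)
  qed
qed

lemma bil_commute: "bil u v = bil v u"
  by (simp add: bil_def mult.commute)

lemma bil_add: "u \<in> H \<Longrightarrow> v \<in> H \<Longrightarrow> w \<in> H \<Longrightarrow> bil u (\<lambda>x. v x + w x) = bil u v + bil u w"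
  using integrable_diff_quot_mult[of u v] integrable_diff_quot_mult[of u w] integrable_V_mult[of u v] integrable_V_mult[of u w]
  by (simp add: bil_def diff_quot_add distrib_left)

lemma bil_cmult: "bil u (\<lambda>x. t * v x) = t * bil u v"
proof -
  have "(\<lambda>x. V x * (u x * (t * v x))) = (\<lambda>x. t * (V x * (u x * v x)))"
    and "(\<lambda>z. diff_quot \<alpha> u z * (t * diff_quot \<alpha> v z)) = (\<lambda>z. t * (diff_quot \<alpha> u z * diff_quot \<alpha> v z))"
    by (simp_all add: mult.left_commute)
  then show ?thesis by (simp add: bil_def diff_quot_cmult distrib_left)
qed

lemma bil_square_add:
  assumes "u \<in> H" "v \<in> H"
  shows "bil (\<lambda>x. u x + t * v x) (\<lambda>x. u x + t * v x) = bil u u + 2 * t * bil u v + t\<^sup>2 * bil v v"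
proof -
  have tv: "(\<lambda>x. t * v x) \<in> H" by (rule frac_sobolev_cmult[OF assms(2)])
  have utv: "(\<lambda>x. u x + t * v x) \<in> H" by (rule frac_sobolev_add[OF assms(1) tv])
  have "bil (\<lambda>x. u x + t * v x) (\<lambda>x. u x + t * v x)
      = bil u (\<lambda>x. u x + t * v x) + t * bil v (\<lambda>x. u x + t * v x)"
    using bil_add[OF utv assms(1) tv] by (simp add: bil_cmult bil_commute[of _ u] bil_commute[of _ v])
  also have "\<dots> = (bil u u + t * bil u v) + t * (bil v u + t * bil v v)"
    using bil_add[OF assms(1) assms(1) tv] bil_add[OF assms(2) assms(1) tv] by (simp add: bil_cmult)
  finally show ?thesis by (simp add: bil_commute[of v u] power2_eq_square algebra_simps)
qed

lemma bil_square_eq: "bil u u = frac_const TYPE('n) \<alpha> * gagliardo \<alpha> u + (\<integral>x. V x * (u x)\<^sup>2 \<partial>leb)"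
  by (simp add: bil_def gagliardo_eq power2_eq_square)

lemma bil_equivalent:
  "\<exists>m > 0. \<exists>M \<ge> 0. \<forall>u \<in> H. m * (nrm u)\<^sup>2 \<le> bil u u \<and> bil u u \<le> M * (nrm u)\<^sup>2 \<and>
    m * (\<integral>x. (u x)\<^sup>2 \<partial>leb) \<le> bil u u"
proof -
  obtain V0 V1 where V: "0 < V0" "V0 \<le> V1" "AE x in leb. V0 \<le> V x \<and> V x \<le> V1" using V_bounds .
  define m where "m = min (frac_const TYPE('n) \<alpha>) V0"
  define M where "M = frac_const TYPE('n) \<alpha> + V1"
  have m: "m > 0" using V frac_const_pos by (simp add: m_def)
  have M: "M \<ge> 0" using V frac_const_pos by (simp add: M_def)
  have both: "m * (nrm u)\<^sup>2 \<le> bil u u \<and> bil u u \<le> M * (nrm u)\<^sup>2" if u: "u \<in> H" for u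
  proof -
    have i2: "integrable leb (\<lambda>x. (u x)\<^sup>2)" by (rule frac_sobolev_integrable_square[OF u])
    have iV: "integrable leb (\<lambda>x. V x * (u x)\<^sup>2)" using integrable_V_mult[OF u u] by (simp add: power2_eq_square)
    have "(\<integral>x. V0 * (u x)\<^sup>2 \<partial>leb) \<le> (\<integral>x. V x * (u x)\<^sup>2 \<partial>leb)"
    proof (rule integral_mono_AE)
      show "AE x in leb. V0 * (u x)\<^sup>2 \<le> V x * (u x)\<^sup>2"
        using V(3) by eventually_elim (simp add: mult_right_mono)
    qed (use i2 iV in auto)
    then have l: "V0 * (\<integral>x. (u x)\<^sup>2 \<partial>leb) \<le> (\<integral>x. V x * (u x)\<^sup>2 \<partial>leb)" by simp
    have "(\<integral>x. V x * (u x)\<^sup>2 \<partial>leb) \<le> (\<integral>x. V1 * (u x)\<^sup>2 \<partial>leb)"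
    proof (rule integral_mono_AE)
      show "AE x in leb. V x * (u x)\<^sup>2 \<le> V1 * (u x)\<^sup>2"
        using V(3) by eventually_elim (simp add: mult_right_mono)
    qed (use i2 iV in auto)
    then have r: "(\<integral>x. V x * (u x)\<^sup>2 \<partial>leb) \<le> V1 * (\<integral>x. (u x)\<^sup>2 \<partial>leb)" by simp
    have nn: "0 \<le> gagliardo \<alpha> u" "0 \<le> (\<integral>x. (u x)\<^sup>2 \<partial>leb)" by (simp_all add: gagliardo_nonneg integral_square_nonneg)
    have "m * (\<integral>x. (u x)\<^sup>2 \<partial>leb) \<le> V0 * (\<integral>x. (u x)\<^sup>2 \<partial>leb)" "m * gagliardo \<alpha> u \<le> frac_const TYPE('n) \<alpha> * gagliardo \<alpha> u"
      using nn by (auto simp: m_def intro!: mult_right_mono)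
    moreover have "V1 * (\<integral>x. (u x)\<^sup>2 \<partial>leb) \<le> M * (\<integral>x. (u x)\<^sup>2 \<partial>leb)" "frac_const TYPE('n) \<alpha> * gagliardo \<alpha> u \<le> M * gagliardo \<alpha> u"
      using nn V frac_const_pos by (auto simp: M_def intro!: mult_right_mono)
    ultimately show ?thesis
      unfolding bil_square_eq frac_sobolev_norm_square distrib_left using l r by linarith
  qed
  moreover have "m * (\<integral>x. (u x)\<^sup>2 \<partial>leb) \<le> bil u u" if u: "u \<in> H" for u
    using both[OF u] mult_left_mono[OF integral_square_le_norm[of u \<alpha>] less_imp_le[OF m]] by linarith
  ultimately show ?thesis using m M by blast
qed

lemma bil_nonneg: "u \<in> H \<Longrightarrow> 0 \<le> bil u u"
proof -
  assume u: "u \<in> H"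
  obtain m where "0 < m" "\<And>u. u \<in> H \<Longrightarrow> m * (nrm u)\<^sup>2 \<le> bil u u" using bil_equivalent by blast
  then show ?thesis using u by (meson less_imp_le mult_nonneg_nonneg order_trans zero_le_power2)
qed

lemma bil_abs_le:
  assumes "u \<in> H" "v \<in> H"
  shows "2 * \<bar>bil u v\<bar> \<le> bil u u + bil v v"
proof -
  have "0 \<le> bil u u + 2 * t * bil u v + t\<^sup>2 * bil v v" for t
    unfolding bil_square_add[OF assms, symmetric]
    by (intro bil_nonneg frac_sobolev_add frac_sobolev_cmult assms)
  from this[of 1] this[of "-1"] show ?thesis by simp
qed

lemma energy_eq: "energy \<alpha> q V f K u = bil u u / 2 - (\<integral>x. G K x (u x) \<partial>leb)"
  by (simp add: energy_def bil_square_eq G_def field_simps)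

definition dJ :: "(real ^ 'n \<Rightarrow> real) \<Rightarrow> (real ^ 'n \<Rightarrow> real) \<Rightarrow> (real ^ 'n \<Rightarrow> real) \<Rightarrow> real" where
  "dJ K u v = bil u v - (\<integral>x. g K x (u x) * v x \<partial>leb)"

lemma energy_frechet:
  assumes K: "cond_K K" and u: "u \<in> H"
  shows "has_frechet_derivative \<alpha> (energy \<alpha> q V f K) u (dJ K u)"
proof -
  obtain C S where "superposition \<alpha> p C S (G K) (g K)" using superposition_G[OF K] .
  then interpret sup: superposition \<alpha> p C S "G K" "g K" .
  obtain M where mM: "0 \<le> M" "\<And>u. u \<in> H \<Longrightarrow> bil u u \<le> M * (nrm u)\<^sup>2"
    using bil_equivalent by blast
  define B where "B = bil u u + M + C * 2 powr (p - 2) * ((\<integral>x. (u x)\<^sup>2 \<partial>leb) + (\<integral>x. \<bar>u x\<bar> powr p \<partial>leb) + 1 + S)"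
  define R where "R = M + C * 2 powr (p - 2) * (1 + (\<integral>x. \<bar>u x\<bar> powr p \<partial>leb) + 2 * S)"
  show ?thesis
  proof (rule has_frechet_derivativeI_quadratic[where C=B and R=R])
    fix v w assume vw: "v \<in> H" "w \<in> H"
    show "dJ K u (\<lambda>x. v x + w x) = dJ K u v + dJ K u w"
      using sup.integrable_g_times(1)[OF u vw(1)] sup.integrable_g_times(1)[OF u vw(2)]
      by (simp add: dJ_def bil_add[OF u vw] distrib_left)
  next
    fix v and t :: real assume v: "v \<in> H"
    have "(\<lambda>x. g K x (u x) * (t * v x)) = (\<lambda>x. t * (g K x (u x) * v x))" by (simp add: mult.left_commute)
    then show "dJ K u (\<lambda>x. t * v x) = t * dJ K u v"
      by (simp add: dJ_def bil_cmult right_diff_distrib)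
  next
    fix k assume k: "k \<in> H" "nrm k \<le> 1"
    have "M * (nrm k)\<^sup>2 \<le> M * 1"
      using mM power_le_one[OF frac_sobolev_norm_nonneg k(2), of 2] by (intro mult_left_mono) auto
    then have 1: "\<bar>bil u k\<bar> \<le> bil u u + M"
      using bil_abs_le[OF u k(1)] mM(2)[OF k(1)] by linarith
    have 2: "\<bar>\<integral>x. g K x (u x) * k x \<partial>leb\<bar> \<le> C * 2 powr (p - 2) * ((\<integral>x. (u x)\<^sup>2 \<partial>leb) + (\<integral>x. \<bar>u x\<bar> powr p \<partial>leb) + 1 + S)"
      by (rule order_trans[OF sup.integrable_g_times(2)[OF u k(1)]])
         (use sup.unit_ball_bounds[OF k] sup.C in \<open>auto intro!: mult_left_mono\<close>)
    show "\<bar>dJ K u k\<bar> \<le> B" unfolding dJ_def B_def using 1 2 by linarith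
  next
    fix h \<tau> assume h: "h \<in> H" and \<tau>: "0 < \<tau>" "\<tau> \<le> 1" "nrm h \<le> \<tau>"
    have Q: "bil (\<lambda>x. u x + h x) (\<lambda>x. u x + h x) = bil u u + 2 * bil u h + bil h h"
      using bil_square_add[OF u h, of 1] by simp
    have "(nrm h)\<^sup>2 \<le> \<tau>\<^sup>2" using \<tau> frac_sobolev_norm_nonneg by (intro power_mono) auto
    then have "bil h h \<le> M * \<tau>\<^sup>2" using mM(2)[OF h] mult_left_mono[OF _ mM(1)] by (meson order_trans)
    moreover note bil_nonneg[OF h] sup.integral_G_remainder[OF u h \<tau>]
    moreover have "energy \<alpha> q V f K (\<lambda>x. u x + h x) - energy \<alpha> q V f K u - dJ K u h
       = bil h h / 2 - ((\<integral>x. G K x (u x + h x) \<partial>lebesgue) - (\<integral>x. G K x (u x) \<partial>lebesgue) - (\<integral>x. g K x (u x) * h x \<partial>lebesgue))"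
      unfolding energy_eq dJ_def Q by (simp add: field_simps)
    ultimately show "\<bar>energy \<alpha> q V f K (\<lambda>x. u x + h x) - energy \<alpha> q V f K u - dJ K u h\<bar> \<le> R * \<tau>\<^sup>2"
      unfolding R_def distrib_right by linarith
  qed
qed

lemma nehari_iff:
  assumes "cond_K K"
  shows "u \<in> nehari \<alpha> q V f K \<longleftrightarrow> u \<in> H \<and> \<not> (AE x in lebesgue. u x = 0) \<and> dJ K u u = 0"
proof
  assume "u \<in> nehari \<alpha> q V f K"
  then obtain L where u: "u \<in> H" "\<not> (AE x in lebesgue. u x = 0)"
      "has_frechet_derivative \<alpha> (energy \<alpha> q V f K) u L" "L u = 0"
    unfolding nehari_def by blast
  then show "u \<in> H \<and> \<not> (AE x in lebesgue. u x = 0) \<and> dJ K u u = 0"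
    using has_frechet_derivative_unique[OF u(3) energy_frechet[OF assms u(1)] u(1)] by simp
next
  assume "u \<in> H \<and> \<not> (AE x in lebesgue. u x = 0) \<and> dJ K u u = 0"
  then show "u \<in> nehari \<alpha> q V f K"
    unfolding nehari_def using energy_frechet[OF assms] by blast
qed

lemma critical_iff:
  assumes "cond_K K" "u \<in> H"
  shows "has_frechet_derivative \<alpha> (energy \<alpha> q V f K) u (\<lambda>_. 0) \<longleftrightarrow> (\<forall>v\<in>H. dJ K u v = 0)"
  using energy_frechet[OF assms] has_frechet_derivative_unique[of \<alpha> "energy \<alpha> q V f K" u "dJ K u" "\<lambda>_. 0"]
    has_frechet_derivative_cong[of \<alpha> "energy \<alpha> q V f K" u "dJ K u" "\<lambda>_. 0"] by blast

lemma energy_translation: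
  assumes K: "cond_K K" and u: "u \<in> H" and z: "z \<in> int_lattice"
  shows "energy \<alpha> q V f K (\<lambda>x. u (x + z)) = energy \<alpha> q V f K u"
proof -
  have um: "u \<in> borel_measurable leb" using u by (rule frac_sobolev_measurable)
  have "(\<integral>x. V x * (u (x + z))\<^sup>2 \<partial>leb) = (\<integral>x. V (x + z) * (u (x + z))\<^sup>2 \<partial>leb)"
  proof (rule integral_cong_AE)
    show "AE x in leb. V x * (u (x + z))\<^sup>2 = V (x + z) * (u (x + z))\<^sup>2"
      using V_periodic[OF z] by eventually_elim simp
  qed (use V_measurable um measurable_compose[OF measurable_lebesgue_translation um]
        measurable_compose[OF measurable_lebesgue_translation V_measurable] in auto)
  also have "\<dots> = (\<integral>x. V x * (u x)\<^sup>2 \<partial>leb)"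
    using integral_lebesgue_translation(1)[of "\<lambda>x. V x * (u x)\<^sup>2" z] V_measurable um by simp
  finally have 1: "(\<integral>x. V x * (u (x + z))\<^sup>2 \<partial>leb) = (\<integral>x. V x * (u x)\<^sup>2 \<partial>leb)" .
  have Gm: "(\<lambda>x. G K x (u x)) \<in> borel_measurable leb" by (rule G_measurable[OF cond_K_measurable[OF K] um])
  have fz: "f (x + z) = f x" for x using F1 z by (auto simp: cond_F1_def)
  have "(\<integral>x. G K x (u (x + z)) \<partial>leb) = (\<integral>x. G K (x + z) (u (x + z)) \<partial>leb)"
  proof (rule integral_cong_AE)
    have "AE x in leb. K (x + z) = K x" using K z by (auto simp: cond_K_def ae_periodic_def)
    then show "AE x in leb. G K x (u (x + z)) = G K (x + z) (u (x + z))"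
      by eventually_elim (simp add: G_def primitive_def fz)
    show "(\<lambda>x. G K x (u (x + z))) \<in> borel_measurable leb"
      by (rule G_measurable[OF cond_K_measurable[OF K] measurable_compose[OF measurable_lebesgue_translation um]])
    show "(\<lambda>x. G K (x + z) (u (x + z))) \<in> borel_measurable leb"
      using measurable_compose[OF measurable_lebesgue_translation Gm] .
  qed
  also have "\<dots> = (\<integral>x. G K x (u x) \<partial>leb)" by (rule integral_lebesgue_translation(1)[OF Gm])
  finally show ?thesis using 1 by (simp add: energy_eq bil_square_eq frac_sobolev_translation(2)[OF u])
qed

text \<open>
  Only the invariance of the energy and of the norm enters: increments of the translated function are
  translates of increments of \<open>u\<close>.
\<close>

lemma critical_translation:
  assumes K: "cond_K K" and u: "u \<in> H" and z: "z \<in> int_lattice"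
    and crit: "has_frechet_derivative \<alpha> (energy \<alpha> q V f K) u (\<lambda>_. 0)"
  shows "has_frechet_derivative \<alpha> (energy \<alpha> q V f K) (\<lambda>x. u (x + z)) (\<lambda>_. 0)"
proof -
  have mz: "- z \<in> int_lattice" using z by (auto simp: int_lattice_def)
  have shift: "\<bar>energy \<alpha> q V f K (\<lambda>x. u (x + z) + h x) - energy \<alpha> q V f K (\<lambda>x. u (x + z))\<bar>
     = \<bar>energy \<alpha> q V f K (\<lambda>x. u x + h (x + - z)) - energy \<alpha> q V f K u\<bar>" if h: "h \<in> H" for h
  proof -
    have "(\<lambda>x. u (x + z) + h x) \<in> H" by (intro frac_sobolev_add frac_sobolev_translation u h)
    from energy_translation[OF K this mz]
    have "energy \<alpha> q V f K (\<lambda>x. u x + h (x + - z)) = energy \<alpha> q V f K (\<lambda>x. u (x + z) + h x)" by simp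
    then show ?thesis using energy_translation[OF K u z] by simp
  qed
  show ?thesis
    unfolding has_frechet_derivative_def
  proof (intro conjI ballI allI impI)
    show "\<exists>C. \<forall>v\<in>H. \<bar>0\<bar> \<le> C * nrm v" by (intro exI[of _ 0]) simp
    fix e :: real assume "e > 0"
    then obtain d where d: "d > 0" "\<And>h. h \<in> H \<Longrightarrow> nrm h < d \<Longrightarrow>
       \<bar>energy \<alpha> q V f K (\<lambda>x. u x + h x) - energy \<alpha> q V f K u - 0\<bar> \<le> e * nrm h"
      using crit unfolding has_frechet_derivative_def by blast
    show "\<exists>d>0. \<forall>h\<in>H. nrm h < d \<longrightarrow> \<bar>energy \<alpha> q V f K (\<lambda>x. u (x + z) + h x) - energy \<alpha> q V f K (\<lambda>x. u (x + z)) - 0\<bar> \<le> e * nrm h"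
    proof (intro exI[of _ d] conjI ballI impI d(1))
      fix h assume h: "h \<in> H" "nrm h < d"
      have "nrm (\<lambda>x. h (x + - z)) = nrm h" by (rule frac_sobolev_translation(3)[OF h(1)])
      then show "\<bar>energy \<alpha> q V f K (\<lambda>x. u (x + z) + h x) - energy \<alpha> q V f K (\<lambda>x. u (x + z)) - 0\<bar> \<le> e * nrm h"
        using d(2)[of "\<lambda>x. h (x + - z)"] frac_sobolev_translation(1)[OF h(1), of "- z"] h(2) shift[OF h(1)] by simp
    qed
  qed auto
qed

end

section \<open>The Nehari manifold\<close>

lemma minimum_at_one:
  fixes h h' :: "real \<Rightarrow> real"
  assumes d: "\<And>t. (h has_real_derivative h' t) (at t)" and s: "\<And>t. 0 < t \<Longrightarrow> 0 \<le> (t - 1) * h' t" and t: "0 \<le> t"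
  shows "h 1 \<le> h t"
proof -
  consider "t = 1" | "1 < t" | "t < 1" by linarith
  then show ?thesis
  proof cases
    case 2
    then obtain z where z: "1 < z" "h t - h 1 = (t - 1) * h' z" using MVT2[of 1 t h h'] d by auto
    then have "0 \<le> h' z" using s[of z] by (simp add: zero_le_mult_iff)
    then show ?thesis using z 2 by (smt (verit) mult_nonneg_nonneg)
  next
    case 3
    then obtain z where z: "t < z" "z < 1" "h 1 - h t = (1 - t) * h' z" using MVT2[of t 1 h h'] d by auto
    then have "h' z \<le> 0" using s[of z] t by (simp add: zero_le_mult_iff)
    then show ?thesis using z 3 by (smt (verit) mult_nonneg_nonpos)
  qed simp
qed

context semilinear_problem
begin

text \<open>
  The property in (F5) that leads to \<open>F \<ge> 0\<close>, with the continuity that makes \<open>F x\<close> a primitive of \<open>f x\<close>. It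
  holds for almost all \<open>x\<close>.
\<close>

definition good :: "real ^ 'n \<Rightarrow> bool" where
  "good x \<longleftrightarrow> continuous_on UNIV (f x) \<and> (\<forall>t. 2 * F x t \<le> f x t * t)"

lemma AE_good: "AE x in leb. good x"
proof -
  obtain r b c where b: "0 < b" and ae: "AE x in leb. \<forall>u. b * \<bar>u\<bar> powr r \<le> f x u * u - 2 * F x u \<and>
      \<bar>deriv (f x) u\<bar> \<le> c * (1 + \<bar>u\<bar> powr (p - 2))"
    using F5 unfolding cond_F5_def by blast
  have "AE x in leb. \<forall>u. 2 * F x u \<le> f x u * u"
    using ae
  proof eventually_elim
    case (elim x)
    show ?case
    proof
      fix u
      have "0 \<le> b * \<bar>u\<bar> powr r" using b by simp
      then show "2 * F x u \<le> f x u * u" using elim[rule_format, of u] by linarith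
    qed
  qed
  then show ?thesis using f_continuous by eventually_elim (simp add: good_def)
qed

text \<open>The quotient \<open>F x t / t\<^sup>2\<close> increases in \<open>\<bar>t\<bar>\<close> and vanishes at the origin.\<close>

lemma F_nonneg:
  assumes x: "good x"
  shows "0 \<le> F x v"
proof (rule ccontr)
  assume "\<not> 0 \<le> F x v"
  then have neg: "F x v < 0" by simp
  then have v: "v \<noteq> 0" using primitive_zero by auto
  have cont: "continuous_on UNIV (f x)" using x by (simp add: good_def)
  note F' = primitive_derivative[OF cont]
  \<comment> \<open>Monotonicity of the quotient will give \<open>F x v \<ge> - e v\<^sup>2\<close>; this \<open>e\<close> makes the right-hand side \<open>F x v / 2\<close>, which exceeds the negative number \<open>F x v\<close>.\<close>
  define e where "e = - F x v / (2 * v\<^sup>2)"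
  have e: "e > 0" using neg v by (simp add: e_def divide_neg_pos)
  obtain d where d: "d > 0" "\<And>x u. 0 < \<bar>u\<bar> \<and> \<bar>u\<bar> < d \<Longrightarrow> \<bar>f x u\<bar> \<le> e * \<bar>u\<bar>"
    using F2 e unfolding cond_F2_def by blast
  define t where "t = min (1/2) (d / (2 * \<bar>v\<bar>))"
  have t01: "0 < t" "t < 1" using d v by (auto simp: t_def min_def)
  have "t * \<bar>v\<bar> \<le> d / (2 * \<bar>v\<bar>) * \<bar>v\<bar>" unfolding t_def by (intro mult_right_mono) auto
  also have "\<dots> = d / 2" using v by simp
  finally have "t * \<bar>v\<bar> < d" using d(1) by linarith
  note t = t01 this
  obtain \<theta> where \<theta>: "0 \<le> \<theta>" "\<theta> \<le> 1" "F x (0 + t * v) - F x 0 = (t * v) * f x (0 + \<theta> * (t * v))"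
    using mean_value_increment[of "F x" "f x" 0 "t * v"] F' by blast
  have "\<bar>f x (\<theta> * (t * v))\<bar> \<le> e * \<bar>t * v\<bar>"
  proof (cases "\<theta> = 0")
    case True
    then show ?thesis using f_zero[OF cont] e by simp
  next
    case False
    have le: "\<bar>\<theta> * (t * v)\<bar> \<le> \<bar>t * v\<bar>" using \<theta> by (simp add: abs_mult mult_left_le_one_le)
    moreover have "\<bar>t * v\<bar> < d" using t by (simp add: abs_mult)
    ultimately have "\<bar>f x (\<theta> * (t * v))\<bar> \<le> e * \<bar>\<theta> * (t * v)\<bar>"
      using False t v by (intro d(2)) auto
    also have "\<dots> \<le> e * \<bar>t * v\<bar>" using le e by (intro mult_left_mono) auto
    finally show ?thesis .
  qed
  then have "\<bar>t * v\<bar> * \<bar>f x (\<theta> * (t * v))\<bar> \<le> \<bar>t * v\<bar> * (e * \<bar>t * v\<bar>)" by (rule mult_left_mono) simp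
  also have "\<dots> = e * (t\<^sup>2 * v\<^sup>2)" using t by (simp add: abs_mult power2_eq_square mult_ac)
  finally have small: "\<bar>F x (t * v)\<bar> \<le> e * (t\<^sup>2 * v\<^sup>2)"
    using \<theta>(3) by (simp add: primitive_zero abs_mult)
  define k where "k = (\<lambda>s. F x (s * v) / s\<^sup>2)"
  have kd: "(k has_real_derivative (f x (s * v) * v * s\<^sup>2 - F x (s * v) * (2 * s)) / (s\<^sup>2 * s\<^sup>2)) (at s)" if "s > 0" for s
  proof -
    have "((\<lambda>s. F x (s * v)) has_real_derivative f x (s * v) * v) (at s)"
      by (rule DERIV_chain2[OF F']) (auto intro!: derivative_eq_intros)
    moreover have "((\<lambda>s. s\<^sup>2) has_real_derivative 2 * s) (at s)" by (auto intro!: derivative_eq_intros)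
    ultimately show ?thesis unfolding k_def using that by (intro DERIV_divide) auto
  qed
  have "k t \<le> k 1"
  proof (rule DERIV_nonneg_imp_nondecreasing[where f=k and a=t and b=1])
    fix s assume s: "t \<le> s" "s \<le> 1"
    then have s0: "s > 0" using t by simp
    have "2 * F x (s * v) \<le> f x (s * v) * (s * v)" using x by (simp add: good_def)
    then have "0 \<le> s * (f x (s * v) * (s * v) - 2 * F x (s * v))" using s0 by simp
    then have "0 \<le> f x (s * v) * v * s\<^sup>2 - F x (s * v) * (2 * s)"
      by (simp add: power2_eq_square algebra_simps)
    then show "\<exists>y. (k has_real_derivative y) (at s) \<and> 0 \<le> y" using kd[OF s0] by (intro exI conjI) auto
  qed (use t in auto)
  then have "F x (t * v) / t\<^sup>2 \<le> F x v" by (simp add: k_def)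
  moreover have "- (e * v\<^sup>2) \<le> F x (t * v) / t\<^sup>2"
  proof -
    have "- (e * v\<^sup>2) * t\<^sup>2 \<le> F x (t * v)" using small by (simp add: mult_ac)
    then show ?thesis using t by (simp add: pos_le_divide_eq)
  qed
  moreover have "e * v\<^sup>2 = - F x v / 2" using v by (simp add: e_def)
  ultimately show False using neg by linarith
qed

text \<open>
  This is (F4) for the points \<open>v\<close> and \<open>t v\<close>, which lie on the same side of the origin. The factor \<open>t - 1\<close> covers
  both directions of the comparison at once.
\<close>

lemma f_scaling:
  assumes t: "t > 0"
  shows "0 \<le> (t - 1) * (f x (t * v) * v - t powr (q - 1) * (f x v * v))"
proof -
  have m1: "f x a / \<bar>a\<bar> powr (q - 1) \<le> f x b / \<bar>b\<bar> powr (q - 1)" if "0 < a" "a \<le> b" for a b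
    using F4 that unfolding cond_F4_def mono_on_def by auto
  have m2: "f x a / \<bar>a\<bar> powr (q - 1) \<le> f x b / \<bar>b\<bar> powr (q - 1)" if "b < 0" "a \<le> b" for a b
    using F4 that unfolding cond_F4_def mono_on_def by auto
  have tq: "t powr (q - 1) > 0" using t by simp
  have sc: "f x (t * v) / \<bar>t * v\<bar> powr (q - 1) = (f x (t * v) / t powr (q - 1)) / \<bar>v\<bar> powr (q - 1)"
    using t by (simp add: abs_mult powr_mult)
  have cmp: "a / \<bar>v\<bar> powr (q - 1) \<le> b / \<bar>v\<bar> powr (q - 1) \<longleftrightarrow> a \<le> b" if "v \<noteq> 0" for a b
    using that by (simp add: divide_le_cancel)
  consider "v = 0" | "v > 0" "t \<ge> 1" | "v > 0" "t < 1" | "v < 0" "t \<ge> 1" | "v < 0" "t < 1" by linarith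
  then show ?thesis
  proof cases
    case 2
    have "f x v / \<bar>v\<bar> powr (q - 1) \<le> f x (t * v) / \<bar>t * v\<bar> powr (q - 1)" using 2 by (intro m1) auto
    then have "f x v \<le> f x (t * v) / t powr (q - 1)" unfolding sc using cmp 2 by blast
    then have "t powr (q - 1) * f x v \<le> f x (t * v)" using tq by (simp add: field_simps)
    then have "t powr (q - 1) * f x v * v \<le> f x (t * v) * v" using 2 by (intro mult_right_mono) auto
    then show ?thesis using 2 by (simp add: mult.assoc)
  next
    case 3
    have "f x (t * v) / \<bar>t * v\<bar> powr (q - 1) \<le> f x v / \<bar>v\<bar> powr (q - 1)" using 3 t by (intro m1) auto
    then have "f x (t * v) / t powr (q - 1) \<le> f x v" unfolding sc using cmp 3 by blast
    then have "f x (t * v) \<le> t powr (q - 1) * f x v" using tq by (simp add: field_simps)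
    then have "f x (t * v) * v \<le> t powr (q - 1) * f x v * v" using 3 by (intro mult_right_mono) auto
    then show ?thesis using 3 by (intro mult_nonpos_nonpos) (auto simp: mult.assoc)
  next
    case 4
    have "f x (t * v) / \<bar>t * v\<bar> powr (q - 1) \<le> f x v / \<bar>v\<bar> powr (q - 1)" using 4 by (intro m2) auto
    then have "f x (t * v) / t powr (q - 1) \<le> f x v" unfolding sc using cmp 4 by blast
    then have "f x (t * v) \<le> t powr (q - 1) * f x v" using tq by (simp add: field_simps)
    then have "t powr (q - 1) * f x v * v \<le> f x (t * v) * v" using 4 by (intro mult_right_mono_neg) auto
    then show ?thesis using 4 by (simp add: mult.assoc)
  next
    case 5
    have "f x v / \<bar>v\<bar> powr (q - 1) \<le> f x (t * v) / \<bar>t * v\<bar> powr (q - 1)"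
      using 5 t by (intro m2) (auto simp: mult_pos_neg)
    then have "f x v \<le> f x (t * v) / t powr (q - 1)" unfolding sc using cmp 5 by blast
    then have "t powr (q - 1) * f x v \<le> f x (t * v)" using tq by (simp add: field_simps)
    then have "f x (t * v) * v \<le> t powr (q - 1) * f x v * v" using 5 by (intro mult_right_mono_neg) auto
    then show ?thesis using 5 by (intro mult_nonpos_nonpos) (auto simp: mult.assoc)
  qed simp
qed

lemma F_ray_derivative:
  assumes "good x"
  shows "((\<lambda>s. F x (s * v)) has_real_derivative f x (t * v) * v) (at t)"
  by (rule DERIV_chain2[OF primitive_derivative]) (use assms in \<open>auto simp: good_def intro!: derivative_eq_intros\<close>)

text \<open>
  By (F4) the function \<open>F x (t v) - (t\<^sup>q / q) f x v v\<close> of \<open>t \<ge> 0\<close> is smallest at \<open>t = 1\<close>, and it vanishes at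
  \<open>t = 0\<close>.
\<close>

lemma Ambrosetti_Rabinowitz:
  assumes x: "good x"
  shows "q * F x v \<le> f x v * v"
proof -
  define h where "h = (\<lambda>t. F x (t * v) - (1 / q * (f x v * v)) * \<bar>t\<bar> powr q)"
  have "h 1 \<le> h 0"
  proof (rule minimum_at_one)
    show "(h has_real_derivative f x (t * v) * v - (1 / q * (f x v * v)) * (q * (sgn t * \<bar>t\<bar> powr (q - 1)))) (at t)" for t
      unfolding h_def using qp by (intro DERIV_diff DERIV_cmult F_ray_derivative x DERIV_abs_powr) auto
    show "0 \<le> (t - 1) * (f x (t * v) * v - (1 / q * (f x v * v)) * (q * (sgn t * \<bar>t\<bar> powr (q - 1))))" if "0 < t" for t
      using f_scaling[OF that, of x v] that qp by (simp add: mult_ac)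
  qed simp
  then have "F x v - 1 / q * (f x v * v) \<le> 0" using qp by (simp add: h_def primitive_zero)
  then show ?thesis using qp by (simp add: field_simps)
qed

lemma f_times_nonneg:
  assumes x: "good x"
  shows "0 \<le> f x v * v"
  using Ambrosetti_Rabinowitz[OF x, of v] F_nonneg[OF x, of v] qp
  by (smt (verit) mult_nonneg_nonneg)

text \<open>
  Integrated over \<open>x\<close> for a function \<open>v\<close> on the Nehari manifold, this says that the energy on the ray through \<open>v\<close>
  is maximal at \<open>v\<close>. The exponent \<open>q\<close> of (F4) may be lowered to \<open>2\<close> because \<open>f x v v \<ge> 0\<close>.
\<close>

lemma F_ray_inequality:
  assumes x: "good x" and t: "0 \<le> t"
  shows "F x v - f x v * v / 2 \<le> F x (t * v) - t\<^sup>2 * (f x v * v) / 2"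
proof -
  let ?a = "f x v * v"
  define h where "h = (\<lambda>t. F x (t * v) - ?a / 2 * t\<^sup>2)"
  have "h 1 \<le> h t"
  proof (rule minimum_at_one[OF _ _ t])
    show "(h has_real_derivative f x (t * v) * v - ?a / 2 * (2 * t)) (at t)" for t
      unfolding h_def by (intro DERIV_diff DERIV_cmult F_ray_derivative x) (auto intro!: derivative_eq_intros)
    fix t :: real assume t: "0 < t"
    have a: "?a \<ge> 0" by (rule f_times_nonneg[OF x])
    have "0 \<le> (t - 1) * (t powr (q - 1) - t)"
    proof (cases "t \<ge> 1")
      case True
      then have "t powr 1 \<le> t powr (q - 1)" using qp by (intro powr_mono) auto
      then show ?thesis using True t by simp
    next
      case False
      then have "t powr (q - 1) \<le> t powr 1" using qp t by (intro powr_mono') auto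
      then show ?thesis using False t by (simp add: mult_nonpos_nonpos)
    qed
    then have "0 \<le> (t - 1) * (t powr (q - 1) - t) * ?a" using a by (rule mult_nonneg_nonneg)
    moreover have "(t - 1) * (f x (t * v) * v - ?a / 2 * (2 * t))
        = (t - 1) * (f x (t * v) * v - t powr (q - 1) * ?a) + (t - 1) * (t powr (q - 1) - t) * ?a"
      by (simp add: algebra_simps)
    ultimately show "0 \<le> (t - 1) * (f x (t * v) * v - ?a / 2 * (2 * t))"
      using f_scaling[OF t, of x v] by linarith
  qed
  then show ?thesis by (simp add: h_def mult_ac)
qed

lemma f_small_growth:
  assumes e: "e > 0"
  obtains C where "C > 0" "\<And>x t. good x \<Longrightarrow> f x t * t \<le> e * t\<^sup>2 + C * \<bar>t\<bar> powr p"
proof -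
  obtain d where d: "d > 0" "\<And>x u. 0 < \<bar>u\<bar> \<and> \<bar>u\<bar> < d \<Longrightarrow> \<bar>f x u\<bar> \<le> e * \<bar>u\<bar>"
    using F2 e unfolding cond_F2_def by blast
  obtain c where c: "c > 0" "\<And>x u. \<bar>f x u\<bar> \<le> c * (1 + \<bar>u\<bar> powr (p - 1))"
    using F1 unfolding cond_F1_def by blast
  define C where "C = c * (d powr (1 - p) + 1)"
  have C: "C > 0" using c d by (simp add: C_def add_pos_pos)
  have "f x t * t \<le> e * t\<^sup>2 + C * \<bar>t\<bar> powr p" if x: "good x" for x t
  proof -
    consider "t = 0" | "t \<noteq> 0" "\<bar>t\<bar> < d" | "d \<le> \<bar>t\<bar>" by linarith
    then show ?thesis
    proof cases
      case 2
      then have "\<bar>f x t\<bar> * \<bar>t\<bar> \<le> (e * \<bar>t\<bar>) * \<bar>t\<bar>" by (intro mult_right_mono d(2)) auto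
      moreover have "f x t * t \<le> \<bar>f x t\<bar> * \<bar>t\<bar>" by (metis abs_ge_self abs_mult)
      moreover have "(e * \<bar>t\<bar>) * \<bar>t\<bar> = e * t\<^sup>2" by (simp add: power2_eq_square)
      moreover have "0 \<le> C * \<bar>t\<bar> powr p" using C by simp
      ultimately show ?thesis by linarith
    next
      case 3
      have "1 = d powr (1 - p) * d powr (p - 1)" using d(1) by (simp add: powr_add[symmetric])
      also have "\<dots> \<le> d powr (1 - p) * \<bar>t\<bar> powr (p - 1)"
        using d 3 qp by (intro mult_left_mono powr_mono2) auto
      finally have "c * (1 + \<bar>t\<bar> powr (p - 1)) \<le> c * (d powr (1 - p) * \<bar>t\<bar> powr (p - 1) + \<bar>t\<bar> powr (p - 1))"
        using c by (intro mult_left_mono) auto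
      also have "\<dots> = C * \<bar>t\<bar> powr (p - 1)" by (simp add: C_def algebra_simps)
      finally have "\<bar>f x t\<bar> * \<bar>t\<bar> \<le> (C * \<bar>t\<bar> powr (p - 1)) * \<bar>t\<bar>"
        using c(2)[of x t] by (intro mult_right_mono) auto
      moreover have "f x t * t \<le> \<bar>f x t\<bar> * \<bar>t\<bar>" by (metis abs_ge_self abs_mult)
      moreover have "(C * \<bar>t\<bar> powr (p - 1)) * \<bar>t\<bar> = C * \<bar>t\<bar> powr p"
        using abs_mult_powr[of t p] by (simp add: mult_ac)
      moreover have "0 \<le> e * t\<^sup>2" using e by simp
      ultimately show ?thesis by linarith
    qed simp
  qed
  then show ?thesis using that[of C] C by blast
qed

abbreviation K0 :: "real ^ 'n \<Rightarrow> real" where "K0 \<equiv> \<lambda>_. 0"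

abbreviation J :: "(real ^ 'n \<Rightarrow> real) \<Rightarrow> (real ^ 'n \<Rightarrow> real) \<Rightarrow> real" where "J K \<equiv> energy \<alpha> q V f K"

lemma G_K0: "G K0 x t = F x t" and g_K0: "g K0 x t = f x t"
  by (simp_all add: G_def g_def)

lemma g_times: "g K x t * t = f x t * t - K x * \<bar>t\<bar> powr q"
proof -
  have "(sgn t * \<bar>t\<bar> powr (q - 1)) * t = \<bar>t\<bar> powr q"
    using abs_mult_powr[of t q] by (cases "t < 0"; cases "t = 0") (simp_all add: mult.commute)
  then have "K x * (sgn t * \<bar>t\<bar> powr (q - 1)) * t = K x * \<bar>t\<bar> powr q" by (simp only: mult.assoc)
  then show ?thesis unfolding g_def left_diff_distrib by (simp only:)
qed

lemma integrable_F: "u \<in> H \<Longrightarrow> integrable leb (\<lambda>x. F x (u x))"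
proof -
  assume u: "u \<in> H"
  obtain C S where "superposition \<alpha> p C S (G K0) (g K0)" using superposition_G[OF cond_K_zero] .
  from superposition.integrable_G[OF this u] show ?thesis by (simp add: G_K0)
qed

lemma integrable_f_times: "u \<in> H \<Longrightarrow> v \<in> H \<Longrightarrow> integrable leb (\<lambda>x. f x (u x) * v x)"
proof -
  assume u: "u \<in> H" and v: "v \<in> H"
  obtain C S where "superposition \<alpha> p C S (G K0) (g K0)" using superposition_G[OF cond_K_zero] .
  from superposition.integrable_g_times(1)[OF this u v] show ?thesis by (simp add: g_K0)
qed

lemma integrable_Lp: "u \<in> H \<Longrightarrow> integrable leb (\<lambda>x. \<bar>u x\<bar> powr p)"
  using Sobolev_ex by blast

lemma powr_q_le: "\<bar>t :: real\<bar> powr q \<le> t\<^sup>2 + \<bar>t\<bar> powr p"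
proof -
  have "\<bar>t\<bar> powr 2 * \<bar>t\<bar> powr (q - 2) \<le> \<bar>t\<bar> powr 2 * (1 + \<bar>t\<bar> powr (p - 2))"
    using qp by (intro mult_left_mono powr_interpolate) auto
  moreover have "\<bar>t\<bar> powr 2 * \<bar>t\<bar> powr (s - 2) = \<bar>t\<bar> powr s" for s
    by (simp only: powr_add[symmetric]) simp
  ultimately show ?thesis by (simp only: distrib_left mult_1_right) (simp add: powr_two)
qed

lemma integrable_Lq:
  assumes u: "u \<in> H"
  shows "integrable leb (\<lambda>x. \<bar>u x\<bar> powr q)"
    and "(\<integral>x. \<bar>u x\<bar> powr q \<partial>leb) \<le> (\<integral>x. (u x)\<^sup>2 \<partial>leb) + (\<integral>x. \<bar>u x\<bar> powr p \<partial>leb)"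
proof -
  have i: "integrable leb (\<lambda>x. (u x)\<^sup>2 + \<bar>u x\<bar> powr p)"
    using frac_sobolev_integrable_square[OF u] integrable_Lp[OF u] by simp
  show iq: "integrable leb (\<lambda>x. \<bar>u x\<bar> powr q)"
    by (rule Bochner_Integration.integrable_bound[OF i])
       (use frac_sobolev_measurable[OF u] powr_q_le in auto)
  have "(\<integral>x. \<bar>u x\<bar> powr q \<partial>leb) \<le> (\<integral>x. (u x)\<^sup>2 + \<bar>u x\<bar> powr p \<partial>leb)"
    by (rule integral_mono[OF iq i powr_q_le])
  then show "(\<integral>x. \<bar>u x\<bar> powr q \<partial>leb) \<le> (\<integral>x. (u x)\<^sup>2 \<partial>leb) + (\<integral>x. \<bar>u x\<bar> powr p \<partial>leb)"
    using frac_sobolev_integrable_square[OF u] integrable_Lp[OF u] by simp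
qed

lemma K_powr_integral:
  assumes K: "cond_K K" and k: "AE x in leb. \<bar>K x\<bar> \<le> k" and u: "u \<in> H"
  shows "integrable leb (\<lambda>x. K x * \<bar>u x\<bar> powr q)"
    and "0 \<le> (\<integral>x. K x * \<bar>u x\<bar> powr q \<partial>leb)"
    and "(\<integral>x. K x * \<bar>u x\<bar> powr q \<partial>leb) \<le> k * (\<integral>x. \<bar>u x\<bar> powr q \<partial>leb)"
proof -
  have K0: "AE x in leb. 0 \<le> K x" using K by (simp add: cond_K_def)
  have i: "integrable leb (\<lambda>x. k * \<bar>u x\<bar> powr q)" using integrable_Lq(1)[OF u] by simp
  have le: "AE x in leb. \<bar>K x * \<bar>u x\<bar> powr q\<bar> \<le> k * \<bar>u x\<bar> powr q"
    using k by eventually_elim (simp add: abs_mult mult_right_mono)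
  show int: "integrable leb (\<lambda>x. K x * \<bar>u x\<bar> powr q)"
  proof (rule Bochner_Integration.integrable_bound[OF i])
    show "AE x in leb. norm (K x * \<bar>u x\<bar> powr q) \<le> norm (k * \<bar>u x\<bar> powr q)"
      unfolding real_norm_def using le by eventually_elim linarith
  qed (use cond_K_measurable[OF K] frac_sobolev_measurable[OF u] in auto)
  show "0 \<le> (\<integral>x. K x * \<bar>u x\<bar> powr q \<partial>leb)"
    by (rule integral_nonneg_AE) (use K0 in \<open>eventually_elim, simp\<close>)
  have "(\<integral>x. K x * \<bar>u x\<bar> powr q \<partial>leb) \<le> (\<integral>x. k * \<bar>u x\<bar> powr q \<partial>leb)"
    by (rule integral_mono_AE[OF int i]) (use le in \<open>eventually_elim, linarith\<close>)
  then show "(\<integral>x. K x * \<bar>u x\<bar> powr q \<partial>leb) \<le> k * (\<integral>x. \<bar>u x\<bar> powr q \<partial>leb)" by simp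
qed

lemma cond_K_bound:
  assumes "cond_K K"
  obtains k where "AE x in leb. \<bar>K x\<bar> \<le> k"
  using assms Linf_bound[of K] by (auto simp: cond_K_def)

lemma energy_split:
  assumes K: "cond_K K" and u: "u \<in> H"
  shows "J K u = J K0 u + 1 / q * (\<integral>x. K x * \<bar>u x\<bar> powr q \<partial>leb)"
proof -
  obtain k where "AE x in leb. \<bar>K x\<bar> \<le> k" using cond_K_bound[OF K] .
  then have "integrable leb (\<lambda>x. K x * \<bar>u x\<bar> powr q)" using K_powr_integral(1)[OF K _ u] by blast
  then show ?thesis
    using integrable_F[OF u] by (simp add: energy_eq G_def mult.assoc)
qed

lemma derivative_split:
  assumes K: "cond_K K" and u: "u \<in> H"
  shows "dJ K u u = bil u u - (\<integral>x. f x (u x) * u x \<partial>leb) + (\<integral>x. K x * \<bar>u x\<bar> powr q \<partial>leb)"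
proof -
  obtain k where "AE x in leb. \<bar>K x\<bar> \<le> k" using cond_K_bound[OF K] .
  then have "integrable leb (\<lambda>x. K x * \<bar>u x\<bar> powr q)" using K_powr_integral(1)[OF K _ u] by blast
  then show ?thesis
    using integrable_f_times[OF u u] by (simp add: dJ_def g_times)
qed

lemma energy_K0: "J K0 u = bil u u / 2 - (\<integral>x. F x (u x) \<partial>leb)"
  by (simp add: energy_eq G_K0)

text \<open>
  Subtracting \<open>1 / q\<close> times the Nehari constraint removes the term with \<open>K\<close> and leaves two
  nonnegative terms, both of which are lower semicontinuous under almost everywhere convergence.
\<close>

lemma energy_on_nehari:
  assumes K: "cond_K K" and u: "u \<in> H" and N: "dJ K u u = 0"
  shows "J K u = (1 / 2 - 1 / q) * bil u u + (\<integral>x. f x (u x) * u x / q - F x (u x) \<partial>leb)"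
proof -
  have "J K u = bil u u / 2 - (\<integral>x. F x (u x) \<partial>leb) + 1 / q * (\<integral>x. K x * \<bar>u x\<bar> powr q \<partial>leb)"
    using energy_split[OF K u] energy_K0 by simp
  also have "(\<integral>x. K x * \<bar>u x\<bar> powr q \<partial>leb) = (\<integral>x. f x (u x) * u x \<partial>leb) - bil u u"
    using derivative_split[OF K u] N by simp
  finally show ?thesis
    using integrable_F[OF u] integrable_f_times[OF u u] by (simp add: algebra_simps diff_divide_distrib)
qed

lemma AR_integrand_nonneg: "AE x in leb. 0 \<le> f x (u x) * u x / q - F x (u x)"
  using AE_good by eventually_elim (use Ambrosetti_Rabinowitz qp in \<open>simp add: field_simps\<close>)

lemma energy_ray_le:
  assumes v: "v \<in> H" and N: "dJ K0 v v = 0" and t: "0 \<le> t"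
  shows "J K0 (\<lambda>x. t * v x) \<le> J K0 v"
proof -
  have tv: "(\<lambda>x. t * v x) \<in> H" by (rule frac_sobolev_cmult[OF v])
  have b: "bil v v = (\<integral>x. f x (v x) * v x \<partial>leb)" using N by (simp add: dJ_def g_K0)
  have bt: "bil (\<lambda>x. t * v x) (\<lambda>x. t * v x) = t\<^sup>2 * bil v v"
    by (simp add: bil_cmult bil_commute[of "\<lambda>x. t * v x"] power2_eq_square)
  have i1: "integrable leb (\<lambda>x. F x (v x) - f x (v x) * v x / 2)"
    using integrable_F[OF v] integrable_f_times[OF v v] by simp
  have i2: "integrable leb (\<lambda>x. F x (t * v x) - t\<^sup>2 * (f x (v x) * v x) / 2)"
    using integrable_F[OF tv] integrable_f_times[OF v v] by simp
  have "(\<integral>x. F x (v x) - f x (v x) * v x / 2 \<partial>leb) \<le> (\<integral>x. F x (t * v x) - t\<^sup>2 * (f x (v x) * v x) / 2 \<partial>leb)"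
    by (rule integral_mono_AE[OF i1 i2]) (use AE_good in \<open>eventually_elim, intro F_ray_inequality t\<close>)
  then have "(\<integral>x. F x (v x) \<partial>leb) - bil v v / 2 \<le> (\<integral>x. F x (t * v x) \<partial>leb) - t\<^sup>2 * bil v v / 2"
    using integrable_F[OF tv] integrable_F[OF v] integrable_f_times[OF v v] by (simp add: b)
  then show ?thesis by (simp add: energy_K0 bt)
qed

lemma nonzero_square_pos:
  assumes v: "v \<in> H" and nz: "\<not> (AE x in lebesgue. v x = 0)"
  shows "0 < (\<integral>x. (v x)\<^sup>2 \<partial>leb)"
proof -
  have "(\<integral>x. (v x)\<^sup>2 \<partial>leb) \<noteq> 0"
    using nz integral_nonneg_eq_0_iff_AE[OF frac_sobolev_integrable_square[OF v]] by auto
  then show ?thesis using integral_square_nonneg[of leb v] by linarith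
qed

lemma bil_pos:
  assumes v: "v \<in> H" and nz: "\<not> (AE x in lebesgue. v x = 0)"
  shows "0 < bil v v"
proof -
  obtain m where "m > 0" "m * (\<integral>x. (v x)\<^sup>2 \<partial>leb) \<le> bil v v" using bil_equivalent v by blast
  then show ?thesis using nonzero_square_pos[OF v nz] by (smt (verit) mult_pos_pos)
qed

text \<open>By (F3), \<open>F\<close> dominates every multiple of the square where the argument is large.\<close>

lemma energy_negative_far_out:
  assumes v: "v \<in> H" and nz: "\<not> (AE x in lebesgue. v x = 0)"
  obtains T where "T > 0" "J K0 (\<lambda>x. T * v x) < 0"
proof -
  let ?I = "\<integral>x. (v x)\<^sup>2 \<partial>leb"
  have I: "?I > 0" by (rule nonzero_square_pos[OF v nz])
  have vm: "v \<in> borel_measurable leb" by (rule frac_sobolev_measurable[OF v])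
  have b: "bil v v > 0" by (rule bil_pos[OF v nz])
  \<comment> \<open>With half of the square integral of \<open>v\<close>, the multiple \<open>M\<close> still outweighs \<open>bil v v / 2\<close>.\<close>
  define M where "M = (bil v v + 1) / ?I"
  have M: "M > 0" using b I by (simp add: M_def)
  have MI: "M * ?I = bil v v + 1" using I by (simp add: M_def)
  obtain R0 where R0: "R0 > 0" "\<And>x u. \<bar>u\<bar> > R0 \<Longrightarrow> F x u / \<bar>u\<bar> powr q \<ge> M"
    using F3 unfolding cond_F3_def by blast
  define R where "R = max R0 1"
  have FR: "M * u\<^sup>2 \<le> F x u" if "\<bar>u\<bar> > R" for x u
  proof -
    have u: "\<bar>u\<bar> > R0" "\<bar>u\<bar> > 1" using that by (auto simp: R_def)
    have "u\<^sup>2 = \<bar>u\<bar> powr 2" by (simp add: powr_two)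
    also have "\<dots> \<le> \<bar>u\<bar> powr q" using u qp by (intro powr_mono) auto
    finally have "M * u\<^sup>2 \<le> M * \<bar>u\<bar> powr q" using M by simp
    also have "\<dots> \<le> F x u" using R0(2)[OF u(1), of x] u by (simp add: le_divide_eq)
    finally show ?thesis .
  qed
  let ?c = "\<lambda>n x. if R < real n * \<bar>v x\<bar> then (v x)\<^sup>2 else 0"
  have c_meas: "?c n \<in> borel_measurable leb" for n using vm by measurable
  have i2: "integrable leb (\<lambda>x. (v x)\<^sup>2)" by (rule frac_sobolev_integrable_square[OF v])
  have "(\<lambda>n. \<integral>x. ?c n x \<partial>leb) \<longlonglongrightarrow> ?I"
  proof (rule integral_dominated_convergence[where w="\<lambda>x. (v x)\<^sup>2"])
    show "AE x in leb. (\<lambda>n. ?c n x) \<longlonglongrightarrow> (v x)\<^sup>2"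
    proof (rule AE_I2)
      fix x
      show "(\<lambda>n. ?c n x) \<longlonglongrightarrow> (v x)\<^sup>2"
      proof (cases "v x = 0")
        case False
        obtain N where N: "R / \<bar>v x\<bar> < real N" using reals_Archimedean2 by blast
        have "?c n x = (v x)\<^sup>2" if "n \<ge> N" for n
        proof -
          have "R / \<bar>v x\<bar> < real n" using N that by simp
          then show ?thesis using False by (simp add: field_simps)
        qed
        then have "\<forall>\<^sub>F n in sequentially. ?c n x = (v x)\<^sup>2" unfolding eventually_sequentially by blast
        then show ?thesis by (rule tendsto_eventually)
      qed simp
    qed
  qed (use c_meas i2 vm in auto)
  then have "\<forall>\<^sub>F n in sequentially. ?I / 2 < (\<integral>x. ?c n x \<partial>leb)"
    using I by (intro order_tendstoD(1)) auto
  with eventually_gt_at_top[of 0] have "\<forall>\<^sub>F n in sequentially. 0 < n \<and> ?I / 2 < (\<integral>x. ?c n x \<partial>leb)"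
    by eventually_elim simp
  then obtain n where n: "n > 0" "?I / 2 < (\<integral>x. ?c n x \<partial>leb)" by (auto simp: eventually_sequentially)
  let ?T = "real n"
  have tv: "(\<lambda>x. ?T * v x) \<in> H" by (rule frac_sobolev_cmult[OF v])
  have ic: "integrable leb (?c n)"
    by (rule Bochner_Integration.integrable_bound[OF i2]) (use c_meas in auto)
  have "(\<integral>x. M * ?T\<^sup>2 * ?c n x \<partial>leb) \<le> (\<integral>x. F x (?T * v x) \<partial>leb)"
  proof (rule integral_mono_AE)
    show "AE x in leb. M * ?T\<^sup>2 * ?c n x \<le> F x (?T * v x)"
      using AE_good
    proof eventually_elim
      case (elim x)
      then show ?case
        using FR[of "?T * v x" x] F_nonneg[of x "?T * v x"] by (auto simp: power_mult_distrib abs_mult mult_ac)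
    qed
  qed (use ic integrable_F[OF tv] in auto)
  then have "M * ?T\<^sup>2 * (\<integral>x. ?c n x \<partial>leb) \<le> (\<integral>x. F x (?T * v x) \<partial>leb)" by simp
  moreover have "M * ?T\<^sup>2 * (?I / 2) \<le> M * ?T\<^sup>2 * (\<integral>x. ?c n x \<partial>leb)"
    using n M by (intro mult_left_mono) auto
  moreover have "M * ?T\<^sup>2 * (?I / 2) = ?T\<^sup>2 * (bil v v + 1) / 2" using MI by (simp add: mult_ac)
  moreover have "bil (\<lambda>x. ?T * v x) (\<lambda>x. ?T * v x) = ?T\<^sup>2 * bil v v"
    by (simp add: bil_cmult bil_commute[of "\<lambda>x. ?T * v x"] power2_eq_square)
  ultimately have "J K0 (\<lambda>x. ?T * v x) \<le> ?T\<^sup>2 * bil v v / 2 - ?T\<^sup>2 * (bil v v + 1) / 2"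
    unfolding energy_K0 by linarith
  also have "\<dots> = - (?T\<^sup>2 / 2)" by (simp add: algebra_simps)
  also have "\<dots> < 0" using n by simp
  finally show ?thesis using that[of ?T] n by simp
qed

lemma energy_ray:
  assumes "cond_K K" "v \<in> H"
  shows "J K (\<lambda>x. t * v x) = J K0 (\<lambda>x. t * v x) + \<bar>t\<bar> powr q / q * (\<integral>x. K x * \<bar>v x\<bar> powr q \<partial>leb)"
proof -
  have "(\<lambda>x. K x * \<bar>t * v x\<bar> powr q) = (\<lambda>x. \<bar>t\<bar> powr q * (K x * \<bar>v x\<bar> powr q))"
    by (simp add: abs_mult powr_mult mult_ac)
  then show ?thesis using energy_split[OF assms(1) frac_sobolev_cmult[OF assms(2)], of t] by simp
qed

text \<open>
  Near the origin the quadratic part dominates: \<open>F x u\<close> is at most a small multiple of \<open>u\<^sup>2\<close> plus a multiple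
  of \<open>\<bar>u\<bar>\<^sup>p\<close>.
\<close>

lemma energy_positive_near_zero:
  assumes v: "v \<in> H" and nz: "\<not> (AE x in lebesgue. v x = 0)" and T: "T > 0"
  obtains t where "0 < t" "t < T" "0 < J K0 (\<lambda>x. t * v x)"
proof -
  obtain m where m: "m > 0" "m * (\<integral>x. (v x)\<^sup>2 \<partial>leb) \<le> bil v v" using bil_equivalent v by blast
  obtain C where C: "C > 0" "\<And>x t. good x \<Longrightarrow> f x t * t \<le> m / 4 * t\<^sup>2 + C * \<bar>t\<bar> powr p"
    using f_small_growth[of "m / 4"] m by auto
  let ?P = "\<integral>x. \<bar>v x\<bar> powr p \<partial>leb"
  have b: "bil v v > 0" by (rule bil_pos[OF v nz])
  have "(\<lambda>n. 1 / real (Suc n)) \<longlonglongrightarrow> 0" using LIMSEQ_inverse_real_of_nat by (simp add: inverse_eq_divide)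
  note l = this
  have "(\<lambda>n. C * \<bar>1 / real (Suc n)\<bar> powr (p - 2) * ?P) \<longlonglongrightarrow> C * \<bar>0\<bar> powr (p - 2) * ?P"
    using qp by (intro tendsto_mult tendsto_const tendsto_abs_powr l) auto
  then have "\<forall>\<^sub>F n in sequentially. C * \<bar>1 / real (Suc n)\<bar> powr (p - 2) * ?P < bil v v / 4"
    using b by (intro order_tendstoD(2)) auto
  moreover have "\<forall>\<^sub>F n in sequentially. 1 / real (Suc n) < T" using l T by (rule order_tendstoD(2))
  ultimately have "\<forall>\<^sub>F n in sequentially. C * \<bar>1 / real (Suc n)\<bar> powr (p - 2) * ?P < bil v v / 4 \<and> 1 / real (Suc n) < T"
    by eventually_elim simp
  then obtain n where n: "C * \<bar>1 / real (Suc n)\<bar> powr (p - 2) * ?P < bil v v / 4" "1 / real (Suc n) < T"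
    by (auto simp: eventually_sequentially)
  define t where "t = 1 / real (Suc n)"
  have t: "0 < t" "t < T" "C * t powr (p - 2) * ?P < bil v v / 4" using n by (auto simp: t_def)
  have tv: "(\<lambda>x. t * v x) \<in> H" by (rule frac_sobolev_cmult[OF v])
  have i2: "integrable leb (\<lambda>x. (v x)\<^sup>2)" by (rule frac_sobolev_integrable_square[OF v])
  have ip: "integrable leb (\<lambda>x. \<bar>v x\<bar> powr p)" by (rule integrable_Lp[OF v])
  have "(\<integral>x. F x (t * v x) \<partial>leb) \<le> (\<integral>x. t\<^sup>2 * (m / 4 * (v x)\<^sup>2 + C * t powr (p - 2) * \<bar>v x\<bar> powr p) \<partial>leb)"
  proof (rule integral_mono_AE)
    show "AE x in leb. F x (t * v x) \<le> t\<^sup>2 * (m / 4 * (v x)\<^sup>2 + C * t powr (p - 2) * \<bar>v x\<bar> powr p)"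
      using AE_good
    proof eventually_elim
      case (elim x)
      have "F x (t * v x) \<le> q * F x (t * v x)"
        using mult_right_mono[of 1 q "F x (t * v x)"] F_nonneg[OF elim, of "t * v x"] qp by simp
      also have "\<dots> \<le> f x (t * v x) * (t * v x)" by (rule Ambrosetti_Rabinowitz[OF elim])
      also have "\<dots> \<le> m / 4 * (t * v x)\<^sup>2 + C * \<bar>t * v x\<bar> powr p" by (rule C(2)[OF elim])
      also have "\<bar>t * v x\<bar> powr p = t\<^sup>2 * t powr (p - 2) * \<bar>v x\<bar> powr p"
        using t powr_add[of t 2 "p - 2"] powr_two[of t] by (simp add: abs_mult powr_mult)
      finally show ?case by (simp add: power_mult_distrib algebra_simps)
    qed
  qed (use i2 ip integrable_F[OF tv] in auto)
  also have "\<dots> = t\<^sup>2 * (m / 4 * (\<integral>x. (v x)\<^sup>2 \<partial>leb) + C * t powr (p - 2) * ?P)" using i2 ip by simp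
  also have "\<dots> < t\<^sup>2 * (bil v v / 4 + bil v v / 4)"
    using t m by (intro mult_strict_left_mono add_le_less_mono) auto
  finally have "(\<integral>x. F x (t * v x) \<partial>leb) < t\<^sup>2 * bil v v / 2" by simp
  moreover have "bil (\<lambda>x. t * v x) (\<lambda>x. t * v x) = t\<^sup>2 * bil v v"
    by (simp add: bil_cmult bil_commute[of "\<lambda>x. t * v x"] power2_eq_square)
  ultimately have "0 < J K0 (\<lambda>x. t * v x)" by (simp add: energy_K0)
  then show ?thesis using that t by blast
qed

text \<open>
  The energy along the ray is positive for small \<open>t > 0\<close> and negative at \<open>T\<close>, so that it has an interior
  maximum, where the derivative in the direction \<open>v\<close> vanishes.
\<close>

lemma nehari_on_ray:
  assumes K: "cond_K K" and v: "v \<in> H" and nz: "\<not> (AE x in lebesgue. v x = 0)"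
    and T: "T > 0" "J K (\<lambda>x. T * v x) < 0"
  obtains t where "0 < t" "t < T" "(\<lambda>x. t * v x) \<in> nehari \<alpha> q V f K"
proof -
  define \<psi> where "\<psi> = (\<lambda>t. J K (\<lambda>x. t * v x))"
  have d: "(\<psi> has_real_derivative dJ K (\<lambda>x. t * v x) v) (at t)" for t
    unfolding \<psi>_def
    by (rule has_frechet_derivative_along_ray[OF energy_frechet[OF K frac_sobolev_cmult[OF v]] v])
  obtain k where k: "AE x in leb. \<bar>K x\<bar> \<le> k" using cond_K_bound[OF K] .
  have ge: "J K0 (\<lambda>x. t * v x) \<le> \<psi> t" for t
    unfolding \<psi>_def energy_ray[OF K v, of t] using K_powr_integral(2)[OF K k v] qp by simp
  obtain s where s: "0 < s" "s < T" "0 < J K0 (\<lambda>x. s * v x)" using energy_positive_near_zero[OF v nz T(1)] .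
  have "continuous_on {0..T} \<psi>" 
    using DERIV_isCont[OF d] by (intro continuous_at_imp_continuous_on) simp
  then obtain t where t: "t \<in> {0..T}" "\<And>r. r \<in> {0..T} \<Longrightarrow> \<psi> r \<le> \<psi> t"
    using continuous_attains_sup[of "{0..T}" \<psi>] T by auto
  have pos: "0 < \<psi> t" using t(2)[of s] ge[of s] s by simp
  have "AE x in leb. F x 0 = 0" using primitive_zero by simp
  then have "\<psi> 0 = 0"
    using energy_ray[OF K v, of 0] bil_cmult[of "\<lambda>x. 0 * v x" 0 v] primitive_zero by (simp add: \<psi>_def energy_K0)
  moreover have "\<psi> T < 0" using T by (simp add: \<psi>_def)
  ultimately have tt: "0 < t" "t < T" using t(1) pos by (auto simp: less_le)
  have "dJ K (\<lambda>x. t * v x) v = 0"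
  proof (rule DERIV_local_max[OF d])
    show "0 < min t (T - t)" using tt by simp
    show "\<forall>y. \<bar>t - y\<bar> < min t (T - t) \<longrightarrow> \<psi> y \<le> \<psi> t"
    proof (intro allI impI t(2))
      fix y assume "\<bar>t - y\<bar> < min t (T - t)"
      then have "\<bar>t - y\<bar> < t" "\<bar>t - y\<bar> < T - t" by simp_all
      then show "y \<in> {0..T}" by (simp add: abs_less_iff)
    qed
  qed
  then have "dJ K (\<lambda>x. t * v x) (\<lambda>x. t * v x) = 0"
    using energy_frechet[OF K frac_sobolev_cmult[OF v, of t]] v unfolding has_frechet_derivative_def by simp
  moreover have "\<not> (AE x in lebesgue. t * v x = 0)" using nz tt by simp
  ultimately have "(\<lambda>x. t * v x) \<in> nehari \<alpha> q V f K"
    using frac_sobolev_cmult[OF v, of t] by (simp add: nehari_iff[OF K])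
  then show ?thesis using that tt by blast
qed

text \<open>
  On every Nehari manifold, the quadratic part is controlled by the \<open>L\<^sup>p\<close> norm, which by Sobolev's
  inequality is of higher order.
\<close>

lemma nehari_Lp_lower_bound:
  obtains \<delta> where "\<delta> > 0"
    "\<And>K w. cond_K K \<Longrightarrow> w \<in> H \<Longrightarrow> \<not> (AE x in lebesgue. w x = 0) \<Longrightarrow> dJ K w w = 0 \<Longrightarrow> \<delta> \<le> (\<integral>x. \<bar>w x\<bar> powr p \<partial>leb)"
proof -
  obtain m where m: "m > 0" "\<And>u. u \<in> H \<Longrightarrow> m * (nrm u)\<^sup>2 \<le> bil u u" "\<And>u. u \<in> H \<Longrightarrow> m * (\<integral>x. (u x)\<^sup>2 \<partial>leb) \<le> bil u u"
    using bil_equivalent by blast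
  obtain S where S: "S > 0" "\<And>u. u \<in> H \<Longrightarrow> (\<integral>x. \<bar>u x\<bar> powr p \<partial>leb) \<le> S * nrm u powr p" using Sobolev_ex by blast
  obtain C where C: "C > 0" "\<And>x t. good x \<Longrightarrow> f x t * t \<le> m / 2 * t\<^sup>2 + C * \<bar>t\<bar> powr p"
    using f_small_growth[of "m / 2"] m by auto
  define A where "A = 2 * C * S * (1 / m) powr (p / 2)"
  have A: "A > 0" using C S m by (simp add: A_def)
  define b0 where "b0 = (1 / A) powr (2 / (p - 2))"
  have b0: "b0 > 0" using A by (simp add: b0_def)
  show ?thesis
  proof (rule that[of "b0 / (2 * C)"])
    show "b0 / (2 * C) > 0" using b0 C by simp
    fix K w assume K: "cond_K K" and w: "w \<in> H" and nz: "\<not> (AE x in lebesgue. w x = 0)" and N: "dJ K w w = 0"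
    let ?b = "bil w w" and ?P = "\<integral>x. \<bar>w x\<bar> powr p \<partial>leb"
    have b: "?b > 0" by (rule bil_pos[OF w nz])
    obtain k where k: "AE x in leb. \<bar>K x\<bar> \<le> k" using cond_K_bound[OF K] .
    have i2: "integrable leb (\<lambda>x. (w x)\<^sup>2)" by (rule frac_sobolev_integrable_square[OF w])
    have ip: "integrable leb (\<lambda>x. \<bar>w x\<bar> powr p)" by (rule integrable_Lp[OF w])
    have "?b \<le> (\<integral>x. f x (w x) * w x \<partial>leb)"
      using derivative_split[OF K w] N K_powr_integral(2)[OF K k w] by linarith
    also have "\<dots> \<le> (\<integral>x. m / 2 * (w x)\<^sup>2 + C * \<bar>w x\<bar> powr p \<partial>leb)"
      by (rule integral_mono_AE) (use integrable_f_times[OF w w] i2 ip AE_good C in \<open>auto elim!: eventually_mono\<close>)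
    also have "\<dots> = m / 2 * (\<integral>x. (w x)\<^sup>2 \<partial>leb) + C * ?P" using i2 ip by simp
    finally have bP: "?b \<le> 2 * C * ?P" using m(3)[OF w] by simp
    have "(nrm w)\<^sup>2 \<le> ?b * (1 / m)" using m(2)[OF w] m(1) by (simp add: field_simps)
    then have "((nrm w)\<^sup>2) powr (p / 2) \<le> (?b * (1 / m)) powr (p / 2)" using qp by (intro powr_mono2) auto
    moreover have "((nrm w)\<^sup>2) powr (p / 2) = nrm w powr p"
      using powr_powr[of "nrm w" 2 "p/2"] powr_two[OF frac_sobolev_norm_nonneg, of \<alpha> w] by simp
    moreover have "(?b * (1 / m)) powr (p / 2) = ?b powr (p / 2) * (1 / m) powr (p / 2)"
      by (rule powr_mult)
    ultimately have "nrm w powr p \<le> ?b powr (p / 2) * (1 / m) powr (p / 2)" by (simp only:)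
    then have "2 * C * (S * nrm w powr p) \<le> 2 * C * (S * (?b powr (p / 2) * (1 / m) powr (p / 2)))"
      using C S by (intro mult_left_mono) auto
    moreover have "2 * C * ?P \<le> 2 * C * (S * nrm w powr p)" using S(2)[OF w] C by (intro mult_left_mono) auto
    ultimately have "?b \<le> A * ?b powr (p / 2)" using bP by (simp add: A_def mult_ac)
    also have "?b powr (p / 2) = ?b * ?b powr ((p - 2) / 2)"
      using b powr_mult_base[of ?b "(p - 2) / 2"] by (simp add: field_simps)
    finally have "1 / A \<le> ?b powr ((p - 2) / 2)" using b A by (simp add: field_simps)
    then have "(1 / A) powr (2 / (p - 2)) \<le> (?b powr ((p - 2) / 2)) powr (2 / (p - 2))"
      using A qp by (intro powr_mono2) auto
    moreover have "(p - 2) / 2 * (2 / (p - 2)) = 1" using qp by simp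
    ultimately have "b0 \<le> ?b"
      using b by (simp add: b0_def powr_powr del: times_divide_eq_left times_divide_eq_right)
    then show "b0 / (2 * C) \<le> ?P" using bP C by (simp add: field_simps)
  qed
qed

end

section \<open>Convergence of ground states\<close>

context semilinear_problem
begin

lemma ground_state_minimal:
  assumes "ground_state \<alpha> q V f K w" and "v \<in> nehari \<alpha> q V f K"
  shows "J K w \<le> J K v"
proof -
  have "ereal (J K w) = (INF v\<in>nehari \<alpha> q V f K. ereal (J K v))" using assms(1) by (simp add: ground_state_def)
  also have "\<dots> \<le> ereal (J K v)" by (rule INF_lower[OF assms(2)])
  finally show ?thesis by simp
qed

text \<open>
  Adding a small \<open>K\<close> moves the point where the ray through \<open>v\<close> meets the Nehari manifold, but keeps it
  in a fixed interval, on which the energies differ by a multiple of the norm of \<open>K\<close>.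
\<close>

lemma ground_level_upper_bound:
  assumes K: "\<And>n. cond_K (K n)" and \<kappa>: "\<And>n. AE x in leb. \<bar>K n x\<bar> \<le> \<kappa> n" "\<kappa> \<longlonglongrightarrow> 0"
    and gs: "\<And>n. ground_state \<alpha> q V f (K n) (u n)"
    and v: "v \<in> H" "\<not> (AE x in lebesgue. v x = 0)"
    and T: "T > 0" "J K0 (\<lambda>x. T * v x) < 0"
    and S: "\<And>t. 0 \<le> t \<Longrightarrow> t \<le> T \<Longrightarrow> J K0 (\<lambda>x. t * v x) \<le> S" and e: "e > 0"
  shows "\<forall>\<^sub>F n in sequentially. J (K n) (u n) \<le> S + e"
proof -
  let ?I = "\<integral>x. \<bar>v x\<bar> powr q \<partial>leb"
  have I0: "0 \<le> ?I" by (rule Bochner_Integration.integral_nonneg) simp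
  have "(\<lambda>n. T powr q / q * (\<kappa> n * ?I)) \<longlonglongrightarrow> T powr q / q * (0 * ?I)"
    by (intro tendsto_mult tendsto_const \<kappa>(2))
  then have "\<forall>\<^sub>F n in sequentially. T powr q / q * (\<kappa> n * ?I) < min e (- J K0 (\<lambda>x. T * v x))"
    using e T by (intro order_tendstoD(2)[of _ "T powr q / q * (0 * ?I)"]) auto
  then show ?thesis
  proof eventually_elim
    case (elim n)
    have le: "J (K n) (\<lambda>x. t * v x) \<le> J K0 (\<lambda>x. t * v x) + T powr q / q * (\<kappa> n * ?I)" if t: "0 \<le> t" "t \<le> T" for t
    proof -
      have "\<bar>t\<bar> powr q / q * (\<integral>x. K n x * \<bar>v x\<bar> powr q \<partial>leb) \<le> T powr q / q * (\<kappa> n * ?I)"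
        using t qp K_powr_integral(2,3)[OF K \<kappa>(1) v(1), of n]
        by (intro mult_mono divide_right_mono powr_mono2) auto
      then show ?thesis using energy_ray[OF K v(1), of n t] by simp
    qed
    have "J (K n) (\<lambda>x. T * v x) < 0" using le[of T] T elim by simp
    then obtain t where t: "0 < t" "t < T" "(\<lambda>x. t * v x) \<in> nehari \<alpha> q V f (K n)"
      using nehari_on_ray[OF K v T(1)] by blast
    have "J (K n) (u n) \<le> J (K n) (\<lambda>x. t * v x)" by (rule ground_state_minimal[OF gs t(3)])
    also have "\<dots> \<le> J K0 (\<lambda>x. t * v x) + T powr q / q * (\<kappa> n * ?I)" using t by (intro le) auto
    also have "\<dots> \<le> S + e" using S[of t] t elim by simp
    finally show ?case .
  qed
qed

lemma sq_integrable_V_times: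
  assumes v: "v \<in> H"
  shows "sq_integrable leb (\<lambda>x. V x * v x)"
proof -
  obtain V0 V1 where V: "0 < V0" "V0 \<le> V1" "AE x in leb. V0 \<le> V x \<and> V x \<le> V1" using V_bounds .
  have m: "(\<lambda>x. V x * v x) \<in> borel_measurable leb" using V_measurable frac_sobolev_measurable[OF v] by simp
  have i: "integrable leb (\<lambda>x. V1\<^sup>2 * (v x)\<^sup>2)" using frac_sobolev_integrable_square[OF v] by simp
  have "integrable leb (\<lambda>x. (V x * v x)\<^sup>2)"
  proof (rule Bochner_Integration.integrable_bound[OF i])
    show "AE x in leb. norm ((V x * v x)\<^sup>2) \<le> norm (V1\<^sup>2 * (v x)\<^sup>2)"
      using V(3)
    proof eventually_elim
      case (elim x)
      then have "(V x)\<^sup>2 \<le> V1\<^sup>2" using V(1) by (intro power_mono) auto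
      then show ?case by (simp add: power_mult_distrib mult_right_mono)
    qed
  qed (use m in simp)
  then show ?thesis using m by (simp add: sq_integrable_def)
qed

lemma bil_tendsto:
  assumes w: "\<And>n. w n \<in> H" and B: "\<And>n. nrm (w n) \<le> B"
    and w0: "w0 \<in> H" and lim: "AE x in leb. (\<lambda>n. w n x) \<longlonglongrightarrow> w0 x"
    and v: "v \<in> H"
  shows "(\<lambda>n. bil (w n) v) \<longlonglongrightarrow> bil w0 v"
proof -
  have b: "(\<integral>x. (w n x)\<^sup>2 \<partial>leb) \<le> B\<^sup>2" "gagliardo \<alpha> (w n) \<le> B\<^sup>2" for n
    using integral_square_le_norm[of "w n" \<alpha>] gagliardo_le_norm[of \<alpha> "w n"]
      power_mono[OF B frac_sobolev_norm_nonneg, of n 2] by linarith+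
  have "(\<lambda>n. \<integral>x. w n x * (V x * v x) \<partial>leb) \<longlonglongrightarrow> (\<integral>x. w0 x * (V x * v x) \<partial>leb)"
    by (rule AE_convergent_imp_weakly_convergent(3)[where B="B\<^sup>2", OF _ b(1) _ lim])
       (use w w0 sq_integrable_V_times[OF v] frac_sobolev_sq_integrable frac_sobolev_measurable in blast)+
  then have l1: "(\<lambda>n. \<integral>x. V x * (w n x * v x) \<partial>leb) \<longlonglongrightarrow> (\<integral>x. V x * (w0 x * v x) \<partial>leb)"
    by (simp only: mult.left_commute)
  have l2: "(\<lambda>n. \<integral>z. diff_quot \<alpha> (w n) z * diff_quot \<alpha> v z \<partial>(leb \<Otimes>\<^sub>M leb))
      \<longlonglongrightarrow> (\<integral>z. diff_quot \<alpha> w0 z * diff_quot \<alpha> v z \<partial>(leb \<Otimes>\<^sub>M leb))"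
  proof (rule AE_convergent_imp_weakly_convergent(3)[where B="B\<^sup>2"])
    show "AE z in leb \<Otimes>\<^sub>M leb. (\<lambda>n. diff_quot \<alpha> (w n) z) \<longlonglongrightarrow> diff_quot \<alpha> w0 z"
      by (rule AE_convergent_diff_quot[OF lim])
    show "(\<integral>z. (diff_quot \<alpha> (w n) z)\<^sup>2 \<partial>(leb \<Otimes>\<^sub>M leb)) \<le> B\<^sup>2" for n using b(2)[of n] by (simp add: gagliardo_eq)
  qed (use w w0 v in \<open>auto simp: frac_sobolev_iff sq_integrable_def\<close>)
  show ?thesis unfolding bil_def by (intro tendsto_add tendsto_mult tendsto_const l1 l2)
qed

text \<open>
  The three parts of the derivative converge separately: the form weakly, the part with \<open>f\<close> by almost dominated
  convergence, and the part with \<open>K n\<close> is at most the bound for \<open>K n\<close> times a constant.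
\<close>

lemma critical_limit:
  assumes K: "\<And>n. cond_K (K n)" and \<kappa>: "\<And>n. AE x in leb. \<bar>K n x\<bar> \<le> \<kappa> n" "\<kappa> \<longlonglongrightarrow> 0"
    and w: "\<And>n. w n \<in> H" and B: "\<And>n. nrm (w n) \<le> B"
    and w0: "w0 \<in> H" and lim: "AE x in leb. (\<lambda>n. w n x) \<longlonglongrightarrow> w0 x"
    and crit: "\<And>n v. v \<in> H \<Longrightarrow> dJ (K n) (w n) v = 0" and v: "v \<in> H"
  shows "dJ K0 w0 v = 0"
proof -
  obtain C S where "superposition \<alpha> p C S (G K0) (g K0)" using superposition_G[OF cond_K_zero] .
  then interpret sup: superposition \<alpha> p C S "G K0" "g K0" .
  have l1: "(\<lambda>n. bil (w n) v) \<longlonglongrightarrow> bil w0 v" by (rule bil_tendsto[OF w B w0 lim v])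
  have l2: "(\<lambda>n. \<integral>x. g K0 x (w n x) * v x \<partial>leb) \<longlonglongrightarrow> (\<integral>x. g K0 x (w0 x) * v x \<partial>leb)"
    by (rule sup.integral_g_times_tendsto[OF w B w0 lim v])
  define k where "k = (\<lambda>n x. K n x * (sgn (w n x) * \<bar>w n x\<bar> powr (q - 1)) * v x)"
  let ?Iv = "\<integral>x. \<bar>v x\<bar> powr q \<partial>leb"
  have B0: "B \<ge> 0" using B[of 0] frac_sobolev_norm_nonneg[of \<alpha> "w 0"] by linarith
  define M where "M = B\<^sup>2 + S * B powr p + ?Iv"
  have eq: "bil (w n) v - (\<integral>x. g K0 x (w n x) * v x \<partial>leb) = - (\<integral>x. k n x \<partial>leb)"
    and kb: "\<bar>\<integral>x. k n x \<partial>leb\<bar> \<le> \<bar>\<kappa> n\<bar> * M" for n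
  proof -
    have wq: "integrable leb (\<lambda>x. \<bar>w n x\<bar> powr q)" and vq: "integrable leb (\<lambda>x. \<bar>v x\<bar> powr q)"
      using integrable_Lq w v by blast+
    have ib: "integrable leb (\<lambda>x. \<bar>\<kappa> n\<bar> * (\<bar>w n x\<bar> powr q + \<bar>v x\<bar> powr q))" using wq vq by simp
    have km: "k n \<in> borel_measurable leb"
      unfolding k_def using cond_K_measurable[OF K[of n]] frac_sobolev_measurable[OF w[of n]] frac_sobolev_measurable[OF v] by measurable
    have le: "AE x in leb. \<bar>k n x\<bar> \<le> \<bar>\<kappa> n\<bar> * (\<bar>w n x\<bar> powr q + \<bar>v x\<bar> powr q)"
      using \<kappa>(1)[of n]
    proof eventually_elim
      case (elim x)
      have "\<bar>w n x\<bar> powr (q - 1) * \<bar>v x\<bar> \<le> \<bar>w n x\<bar> powr q + \<bar>v x\<bar> powr q"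
        using powr_product_le[of q 1 "w n x" "v x"] qp by simp
      then have "\<bar>K n x\<bar> * (\<bar>w n x\<bar> powr (q - 1) * \<bar>v x\<bar>) \<le> \<bar>\<kappa> n\<bar> * (\<bar>w n x\<bar> powr q + \<bar>v x\<bar> powr q)"
        using elim by (intro mult_mono) auto
      moreover have "\<bar>k n x\<bar> \<le> \<bar>K n x\<bar> * (\<bar>w n x\<bar> powr (q - 1) * \<bar>v x\<bar>)"
        by (simp add: k_def abs_mult sgn_if)
      ultimately show ?case by linarith
    qed
    have ik: "integrable leb (k n)"
      by (rule Bochner_Integration.integrable_bound[OF ib km]) (use le in \<open>eventually_elim, simp\<close>)
    have "(\<integral>x. g (K n) x (w n x) * v x \<partial>leb) = (\<integral>x. g K0 x (w n x) * v x - k n x \<partial>leb)"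
      by (rule Bochner_Integration.integral_cong) (simp_all add: g_def k_def left_diff_distrib)
    then have "(\<integral>x. g (K n) x (w n x) * v x \<partial>leb) = (\<integral>x. g K0 x (w n x) * v x \<partial>leb) - (\<integral>x. k n x \<partial>leb)"
      using sup.integrable_g_times(1)[OF w[of n] v] ik by simp
    then show "bil (w n) v - (\<integral>x. g K0 x (w n x) * v x \<partial>leb) = - (\<integral>x. k n x \<partial>leb)"
      using crit[OF v, of n] by (simp add: dJ_def)
    have "\<bar>\<integral>x. k n x \<partial>leb\<bar> \<le> (\<integral>x. \<bar>k n x\<bar> \<partial>leb)" by (rule integral_abs_bound)
    also have "\<dots> \<le> (\<integral>x. \<bar>\<kappa> n\<bar> * (\<bar>w n x\<bar> powr q + \<bar>v x\<bar> powr q) \<partial>leb)"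
      by (rule integral_mono_AE[OF integrable_abs[OF ik] ib le])
    also have "\<dots> = \<bar>\<kappa> n\<bar> * ((\<integral>x. \<bar>w n x\<bar> powr q \<partial>leb) + ?Iv)" using wq vq by simp
    also have "\<dots> \<le> \<bar>\<kappa> n\<bar> * M"
    proof (intro mult_left_mono)
      have "(\<integral>x. (w n x)\<^sup>2 \<partial>leb) \<le> B\<^sup>2"
        using integral_square_le_norm[of "w n" \<alpha>] power_mono[OF B frac_sobolev_norm_nonneg, of n 2] by linarith
      moreover have "S * nrm (w n) powr p \<le> S * B powr p"
        using sup.S qp B frac_sobolev_norm_nonneg by (intro mult_left_mono powr_mono2) auto
      ultimately show "(\<integral>x. \<bar>w n x\<bar> powr q \<partial>leb) + ?Iv \<le> M"
        using integrable_Lq(2)[OF w[of n]] sup.Sobolev[OF w[of n]] unfolding M_def by linarith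
    qed simp
    finally show "\<bar>\<integral>x. k n x \<partial>leb\<bar> \<le> \<bar>\<kappa> n\<bar> * M" .
  qed
  have "(\<lambda>n. \<bar>\<kappa> n\<bar> * M) \<longlonglongrightarrow> \<bar>0\<bar> * M" by (intro tendsto_intros \<kappa>(2))
  then have kM: "(\<lambda>n. \<bar>\<kappa> n\<bar> * M) \<longlonglongrightarrow> 0" by simp
  have "(\<lambda>n. - (\<integral>x. k n x \<partial>leb)) \<longlonglongrightarrow> 0"
    by (rule Lim_null_comparison[OF _ kM]) (use kb in simp)
  moreover have "(\<lambda>n. - (\<integral>x. k n x \<partial>leb)) \<longlonglongrightarrow> dJ K0 w0 v"
    unfolding eq[symmetric] dJ_def by (intro tendsto_diff l1 l2)
  ultimately show ?thesis using LIMSEQ_unique by blast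
qed

text \<open>
  The level of the limit is at most the limit of the levels. If it is not smaller, then neither of the two
  lower semicontinuous terms can lose anything in the limit, and the convergence is strong.
\<close>

lemma energy_limit:
  assumes K: "\<And>n. cond_K (K n)" and w: "\<And>n. w n \<in> H" and B: "\<And>n. nrm (w n) \<le> B"
    and w0: "w0 \<in> H" and lim: "AE x in leb. (\<lambda>n. w n x) \<longlonglongrightarrow> w0 x"
    and N: "\<And>n. dJ (K n) (w n) (w n) = 0" and N0: "dJ K0 w0 w0 = 0"
  shows "\<And>e. e > 0 \<Longrightarrow> \<forall>\<^sub>F n in sequentially. J K0 w0 \<le> J (K n) (w n) + e"
    and "(\<And>e. e > 0 \<Longrightarrow> \<forall>\<^sub>F n in sequentially. J (K n) (w n) \<le> J K0 w0 + e) \<Longrightarrow>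
      (\<lambda>n. nrm (\<lambda>x. w n x - w0 x)) \<longlonglongrightarrow> 0"
proof -
  define \<theta> where "\<theta> = 1 / 2 - 1 / q"
  have \<theta>: "\<theta> > 0" using qp by (simp add: \<theta>_def field_simps)
  define a where "a = (\<lambda>u. \<integral>x. f x (u x) * u x / q - F x (u x) \<partial>leb)"
  have En: "J (K n) (w n) = \<theta> * bil (w n) (w n) + a (w n)" for n
    using energy_on_nehari[OF K w N] by (simp add: \<theta>_def a_def)
  have E0: "J K0 w0 = \<theta> * bil w0 w0 + a w0"
    using energy_on_nehari[OF cond_K_zero w0 N0] by (simp add: \<theta>_def a_def)
  have ints: "integrable leb (\<lambda>x. f x (u x) * u x / q - F x (u x))" if "u \<in> H" for u
    using integrable_f_times[OF that that] integrable_F[OF that] by simp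
  have lim_a: "AE x in leb. (\<lambda>n. f x (w n x) * w n x / q - F x (w n x)) \<longlonglongrightarrow> f x (w0 x) * w0 x / q - F x (w0 x)"
    using lim AE_good
  proof eventually_elim
    case (elim x)
    have "isCont (f x) (w0 x)" "isCont (F x) (w0 x)"
      using elim(2) DERIV_isCont[OF primitive_derivative] by (auto simp: good_def continuous_on_eq_continuous_at)
    then show ?case using elim(1) qp
      by (intro tendsto_diff tendsto_divide tendsto_mult tendsto_const isCont_tendsto_compose[where g="f x"]
          isCont_tendsto_compose[where g="F x"]) auto
  qed
  have lsc_a: "\<forall>\<^sub>F n in sequentially. a w0 \<le> a (w n) + e" if "e > 0" for e
    unfolding a_def
    by (rule Fatou_eventually[OF ints[OF w] AR_integrand_nonneg borel_measurable_integrable[OF ints[OF w0]] lim_a that])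
  have bl: "(\<lambda>n. bil (w n) w0) \<longlonglongrightarrow> bil w0 w0" by (rule bil_tendsto[OF w B w0 lim w0])
  have diff: "bil (\<lambda>x. w n x - w0 x) (\<lambda>x. w n x - w0 x) = bil (w n) (w n) - 2 * bil (w n) w0 + bil w0 w0" for n
    using bil_square_add[OF w w0, of n "-1"] by simp
  have close: "\<forall>\<^sub>F n in sequentially. \<bar>bil (w n) w0 - bil w0 w0\<bar> \<le> e" if "e > 0" for e
    using tendstoD[OF bl that] by eventually_elim (simp add: dist_real_def)
  have lsc_b: "\<forall>\<^sub>F n in sequentially. bil w0 w0 \<le> bil (w n) (w n) + e" if "e > 0" for e
  proof -
    have "e / 2 > 0" using that by simp
    from close[OF this] show ?thesis
    proof eventually_elim
      case (elim n)
      have "0 \<le> bil (\<lambda>x. w n x - w0 x) (\<lambda>x. w n x - w0 x)" by (intro bil_nonneg frac_sobolev_diff w w0)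
      then show ?case using elim unfolding diff by linarith
    qed
  qed
  show "\<forall>\<^sub>F n in sequentially. J K0 w0 \<le> J (K n) (w n) + e" if e: "e > 0" for e
  proof -
    have "e / (2 * \<theta>) > 0" "e / 2 > 0" using e \<theta> by simp_all
    from lsc_b[OF this(1)] lsc_a[OF this(2)] show ?thesis
    proof eventually_elim
      case (elim n)
      have "\<theta> * bil w0 w0 \<le> \<theta> * (bil (w n) (w n) + e / (2 * \<theta>))" using elim(1) \<theta> by (intro mult_left_mono) auto
      also have "\<dots> = \<theta> * bil (w n) (w n) + e / 2" using \<theta> by (simp add: distrib_left)
      finally show ?case using elim(2) unfolding En E0 by linarith
    qed
  qed
  assume up: "\<And>e. e > 0 \<Longrightarrow> \<forall>\<^sub>F n in sequentially. J (K n) (w n) \<le> J K0 w0 + e"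
  obtain m where m: "m > 0" "\<And>u. u \<in> H \<Longrightarrow> m * (nrm u)\<^sup>2 \<le> bil u u" using bil_equivalent by blast
  show "(\<lambda>n. nrm (\<lambda>x. w n x - w0 x)) \<longlonglongrightarrow> 0"
  proof (rule LIMSEQ_I)
    fix r :: real assume r: "r > 0"
    \<comment> \<open>The constants add up to \<open>e / 2 + e / 3 < m r\<^sup>2\<close> for the form at the difference.\<close>
    define e where "e = m * r\<^sup>2 / 2"
    have e: "e > 0" using m r by (simp add: e_def)
    have p1: "e * \<theta> / 4 > 0" "e / 6 > 0" using e \<theta> by simp_all
    have "\<forall>\<^sub>F n in sequentially. nrm (\<lambda>x. w n x - w0 x) < r"
      using up[OF p1(1)] lsc_a[OF p1(1)] close[OF p1(2)]
    proof eventually_elim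
      case (elim n)
      have d: "(\<lambda>x. w n x - w0 x) \<in> H" by (intro frac_sobolev_diff w w0)
      have "\<theta> * bil (w n) (w n) \<le> \<theta> * bil w0 w0 + e * \<theta> / 2" using elim(1,2) unfolding En E0 by linarith
      also have "\<dots> = \<theta> * (bil w0 w0 + e / 2)" by (simp add: algebra_simps)
      finally have "bil (w n) (w n) \<le> bil w0 w0 + e / 2" using \<theta> by simp
      then have "bil (\<lambda>x. w n x - w0 x) (\<lambda>x. w n x - w0 x) \<le> e / 2 + e / 3"
        using elim(3) unfolding diff by linarith
      then have "m * (nrm (\<lambda>x. w n x - w0 x))\<^sup>2 < m * r\<^sup>2"
        using m(2)[OF d] e by (simp add: e_def)
      then have "(nrm (\<lambda>x. w n x - w0 x))\<^sup>2 < r\<^sup>2" using m(1) by simp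
      then show ?case using r by (intro power_less_imp_less_base[of _ 2 r]) auto
    qed
    then show "\<exists>n0. \<forall>n\<ge>n0. norm (nrm (\<lambda>x. w n x - w0 x) - 0) < r"
      by (simp add: eventually_sequentially frac_sobolev_norm_nonneg)
  qed
qed

theorem ground_states_converge:
  assumes K: "\<And>n. cond_K (K n)" and Klim: "(\<lambda>n. Linf_norm (K n)) \<longlonglongrightarrow> 0"
    and gs: "\<And>n. ground_state \<alpha> q V f (K n) (u n)"
  shows "\<exists>z :: nat \<Rightarrow> real ^ 'n. \<exists>u0 :: real ^ 'n \<Rightarrow> real. \<exists>\<sigma> :: nat \<Rightarrow> nat.
           (\<forall>n. z n \<in> int_lattice) \<and> ground_state \<alpha> q V f K0 u0 \<and> strict_mono \<sigma> \<and>
           (\<lambda>k. nrm (\<lambda>x. u (\<sigma> k) (x - z (\<sigma> k)) - u0 x)) \<longlonglongrightarrow> 0"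
proof -
  have "\<exists>k. Linf_norm (K n) = ereal k \<and> (AE x in leb. \<bar>K n x\<bar> \<le> k)" for n
    using K[of n] Linf_bound[of "K n"] by (auto simp: cond_K_def)
  then obtain \<kappa> where \<kappa>0: "\<And>n. Linf_norm (K n) = ereal (\<kappa> n)" and \<kappa>1: "\<And>n. AE x in leb. \<bar>K n x\<bar> \<le> \<kappa> n"
    by metis
  have \<kappa>2: "\<kappa> \<longlonglongrightarrow> 0" using Klim unfolding \<kappa>0 by (simp add: zero_ereal_def)
  have un: "u n \<in> H" "\<not> (AE x in lebesgue. u n x = 0)" "dJ (K n) (u n) (u n) = 0" for n
    using gs[of n] nehari_iff[OF K[of n], of "u n"] by (auto simp: ground_state_def)
  have ucrit: "has_frechet_derivative \<alpha> (J (K n)) (u n) (\<lambda>_. 0)" for n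
    using gs[of n] by (simp add: ground_state_def)
  obtain m where m: "m > 0" "\<And>u. u \<in> H \<Longrightarrow> m * (nrm u)\<^sup>2 \<le> bil u u" using bil_equivalent by blast
  define \<theta> where "\<theta> = 1 / 2 - 1 / q"
  have \<theta>: "\<theta> > 0" using qp by (simp add: \<theta>_def field_simps)
  \<comment> \<open>Any fixed nonzero function gives a bound on the levels.\<close>
  obtain T where T: "T > 0" "J K0 (\<lambda>x. T * u 0 x) < 0" using energy_negative_far_out[OF un(1,2)] .
  define S0 where "S0 = T\<^sup>2 * bil (u 0) (u 0) / 2"
  have "J K0 (\<lambda>x. t * u 0 x) \<le> S0" if t: "0 \<le> t" "t \<le> T" for t
  proof -
    have "0 \<le> (\<integral>x. F x (t * u 0 x) \<partial>leb)"
      by (rule integral_nonneg_AE) (use AE_good in \<open>eventually_elim, intro F_nonneg\<close>)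
    moreover have "bil (\<lambda>x. t * u 0 x) (\<lambda>x. t * u 0 x) = t\<^sup>2 * bil (u 0) (u 0)"
      by (simp add: bil_cmult bil_commute[of "\<lambda>x. t * u 0 x"] power2_eq_square)
    moreover have "t\<^sup>2 * bil (u 0) (u 0) \<le> T\<^sup>2 * bil (u 0) (u 0)"
      using t by (intro mult_right_mono power_mono bil_nonneg un) auto
    ultimately show ?thesis unfolding energy_K0 S0_def by linarith
  qed
  then have "\<forall>\<^sub>F n in sequentially. J (K n) (u n) \<le> S0 + 1"
    using T by (intro ground_level_upper_bound[OF K \<kappa>1 \<kappa>2 gs un(1,2)]) auto
  then obtain n0 where n0: "\<And>n. n \<ge> n0 \<Longrightarrow> J (K n) (u n) \<le> S0 + 1" by (auto simp: eventually_sequentially)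
  define B where "B = sqrt (\<bar>S0 + 1\<bar> / (\<theta> * m))"
  have uB: "nrm (u n) \<le> B" if "n \<ge> n0" for n
  proof -
    have "0 \<le> (\<integral>x. f x (u n x) * u n x / q - F x (u n x) \<partial>leb)" by (rule integral_nonneg_AE[OF AR_integrand_nonneg])
    then have "\<theta> * bil (u n) (u n) \<le> \<bar>S0 + 1\<bar>"
      using energy_on_nehari[OF K[of n] un(1,3)[of n]] n0[OF that] unfolding \<theta>_def by linarith
    moreover have "\<theta> * (m * (nrm (u n))\<^sup>2) \<le> \<theta> * bil (u n) (u n)" using m(2)[OF un(1)] \<theta> by (intro mult_left_mono) auto
    ultimately have "(\<theta> * m) * (nrm (u n))\<^sup>2 \<le> \<bar>S0 + 1\<bar>" by (simp only: mult.assoc)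
    then have "(nrm (u n))\<^sup>2 \<le> \<bar>S0 + 1\<bar> / (\<theta> * m)"
      using mult_pos_pos[OF \<theta> m(1)] by (simp add: pos_le_divide_eq mult.commute)
    then show ?thesis unfolding B_def by (rule real_le_rsqrt)
  qed
  obtain \<delta> where \<delta>: "\<delta> > 0" "\<And>n. \<delta> \<le> (\<integral>x. \<bar>u n x\<bar> powr p \<partial>leb)"
    using nehari_Lp_lower_bound K un by metis
  obtain d where d: "d > 0" "\<And>v. v \<in> H \<Longrightarrow> nrm v \<le> B \<Longrightarrow> \<delta> \<le> (\<integral>x. \<bar>v x\<bar> powr p \<partial>leb) \<Longrightarrow>
      \<exists>z\<in>int_lattice. d \<le> (\<integral>x. indicator unit_cell x * (v (x + z))\<^sup>2 \<partial>leb)"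
    using nonvanishing[OF \<alpha>(1,3) qp(3) subcritical \<delta>(1), of B] by blast
  have "\<exists>z. z \<in> int_lattice \<and> d \<le> (\<integral>x. indicator unit_cell x * (u (n + n0) (x + z))\<^sup>2 \<partial>leb)" for n
    using d(2)[OF un(1) uB[of "n + n0"] \<delta>(2)] by auto
  \<comment> \<open>The translation by \<open>y n\<close> brings a unit cell of mass at least \<open>d\<close> to the origin.\<close>
  then obtain y where y: "\<And>n. y n \<in> int_lattice" "\<And>n. d \<le> (\<integral>x. indicator unit_cell x * (u (n + n0) (x + y n))\<^sup>2 \<partial>leb)"
    by metis
  define w where "w = (\<lambda>n x. u (n + n0) (x + y n))"
  have wH: "w n \<in> H" and wB: "nrm (w n) \<le> B" for n
    using frac_sobolev_translation(1,3)[OF un(1)] uB[of "n + n0"] by (simp_all add: w_def)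
  have wcrit: "dJ (K (n + n0)) (w n) v = 0" if "v \<in> H" for n v
    using critical_translation[OF K un(1) y(1)[of n] ucrit, of "n + n0"] critical_iff[OF K wH] that by (auto simp: w_def)
  have wJ: "J (K (n + n0)) (w n) = J (K (n + n0)) (u (n + n0))" for n
    unfolding w_def by (rule energy_translation[OF K un(1) y(1)])
  obtain r u0 where r: "strict_mono r" and u0: "u0 \<in> H" and lim: "AE x in leb. (\<lambda>n. w (r n) x) \<longlonglongrightarrow> u0 x"
    using AE_convergent_subsequence[where u=w and B=B and \<alpha>=\<alpha>, OF \<alpha>(1) wH wB] by blast
  define \<sigma> where "\<sigma> = (\<lambda>n. r n + n0)"
  have \<sigma>: "strict_mono \<sigma>" using r by (simp add: \<sigma>_def strict_mono_def)
  define K' where "K' = (\<lambda>n. K (\<sigma> n))"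
  define w' where "w' = (\<lambda>n. w (r n))"
  have K': "cond_K (K' n)" and \<kappa>': "AE x in leb. \<bar>K' n x\<bar> \<le> \<kappa> (\<sigma> n)" and w'H: "w' n \<in> H" and w'B: "nrm (w' n) \<le> B"
    for n using K \<kappa>1 wH wB by (simp_all add: K'_def w'_def)
  have w'crit: "dJ (K' n) (w' n) v = 0" if "v \<in> H" for n v using wcrit[OF that] by (simp add: K'_def w'_def \<sigma>_def)
  have w'J: "J (K' n) (w' n) = J (K (\<sigma> n)) (u (\<sigma> n))" for n using wJ by (simp add: K'_def w'_def \<sigma>_def)
  have lim': "AE x in leb. (\<lambda>n. w' n x) \<longlonglongrightarrow> u0 x" using lim by (simp add: w'_def)
  have \<kappa>'2: "(\<lambda>n. \<kappa> (\<sigma> n)) \<longlonglongrightarrow> 0" using LIMSEQ_subseq_LIMSEQ[OF \<kappa>2 \<sigma>] by (simp add: o_def)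
  have u0crit: "dJ K0 u0 v = 0" if "v \<in> H" for v
    by (rule critical_limit[OF K' \<kappa>' \<kappa>'2 w'H w'B u0 lim' w'crit that])
  obtain S where S: "S > 0" "\<And>u. u \<in> H \<Longrightarrow> (\<integral>x. \<bar>u x\<bar> powr p \<partial>leb) \<le> S * nrm u powr p" using Sobolev_ex by blast
  have u0nz: "\<not> (AE x in lebesgue. u0 x = 0)"
  proof (rule AE_limit_nonzero[OF qp(3) _ _ _ lim' d(1)])
    show "(\<integral>x. \<bar>w' n x\<bar> powr p \<partial>leb) \<le> S * B powr p" for n
    proof -
      have "S * nrm (w' n) powr p \<le> S * B powr p"
        using S qp w'B frac_sobolev_norm_nonneg by (intro mult_left_mono powr_mono2) auto
      then show ?thesis using S(2)[OF w'H[of n]] by linarith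
    qed
    show "d \<le> (\<integral>x. indicator unit_cell x * (w' n x)\<^sup>2 \<partial>leb)" for n using y(2) by (simp add: w'_def w_def)
  qed (use w'H frac_sobolev_measurable integrable_Lp in blast)+
  have u0N: "u0 \<in> nehari \<alpha> q V f K0" using u0 u0nz u0crit by (simp add: nehari_iff[OF cond_K_zero])
  have upper: "\<forall>\<^sub>F n in sequentially. J (K' n) (w' n) \<le> J K0 v + e" if v: "v \<in> nehari \<alpha> q V f K0" and e: "e > 0" for v e
  proof -
    have v': "v \<in> H" "\<not> (AE x in lebesgue. v x = 0)" "dJ K0 v v = 0" using v by (simp_all add: nehari_iff[OF cond_K_zero])
    obtain T where T: "T > 0" "J K0 (\<lambda>x. T * v x) < 0" using energy_negative_far_out[OF v'(1,2)] .
    have "\<forall>\<^sub>F n in sequentially. J (K n) (u n) \<le> J K0 v + e"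
      by (rule ground_level_upper_bound[OF K \<kappa>1 \<kappa>2 gs v'(1,2) T energy_ray_le[OF v'(1,3)] e])
    then have "\<forall>\<^sub>F n in sequentially. J (K (\<sigma> n)) (u (\<sigma> n)) \<le> J K0 v + e"
      by (rule eventually_compose_filterlim[OF _ filterlim_subseq[OF \<sigma>]])
    then show ?thesis by (simp add: w'J)
  qed
  note EL = energy_limit[OF K' w'H w'B u0 lim' w'crit[OF w'H] u0crit[OF u0]]
  have least: "J K0 u0 \<le> J K0 v" if v: "v \<in> nehari \<alpha> q V f K0" for v
  proof (rule field_le_epsilon)
    fix e :: real assume "e > 0"
    then have "e / 2 > 0" by simp
    then have "\<forall>\<^sub>F n in sequentially. J K0 u0 \<le> J (K' n) (w' n) + e / 2" "\<forall>\<^sub>F n in sequentially. J (K' n) (w' n) \<le> J K0 v + e / 2"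
      using EL(1) upper[OF v] by blast+
    then have "\<forall>\<^sub>F n in sequentially. J K0 u0 \<le> J K0 v + e" by eventually_elim linarith
    then show "J K0 u0 \<le> J K0 v + e" by simp
  qed
  have u0gs: "ground_state \<alpha> q V f K0 u0"
    unfolding ground_state_def
  proof (intro conjI u0N)
    show "has_frechet_derivative \<alpha> (J K0) u0 (\<lambda>_. 0)" using u0crit by (simp add: critical_iff[OF cond_K_zero u0])
    show "ereal (J K0 u0) = (INF v\<in>nehari \<alpha> q V f K0. ereal (J K0 v))"
      by (rule antisym) (use least u0N in \<open>auto intro: INF_greatest INF_lower\<close>)
  qed
  have conv: "(\<lambda>n. nrm (\<lambda>x. w' n x - u0 x)) \<longlonglongrightarrow> 0"
    by (rule EL(2)) (rule upper[OF u0N])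
  \<comment> \<open>Below \<open>n0\<close> there is no norm bound and no distinguished cell; these indices are not in the range of \<open>\<sigma>\<close>.\<close>
  define z where "z = (\<lambda>n. if n0 \<le> n then - y (n - n0) else 0)"
  have "z n \<in> int_lattice" for n using y(1) by (auto simp: z_def int_lattice_def)
  moreover have "w' n x = u (\<sigma> n) (x - z (\<sigma> n))" for n x by (simp add: w'_def w_def \<sigma>_def z_def)
  ultimately show ?thesis using u0gs \<sigma> conv by (intro exI[of _ z] exI[of _ u0] exI[of _ \<sigma>]) simp
qed

end

theorem theorem1p3:
  fixes \<alpha> q p :: real
    and V Vper :: "real ^ 'n \<Rightarrow> real"
    and f :: "real ^ 'n \<Rightarrow> real \<Rightarrow> real"
    and K u :: "nat \<Rightarrow> real ^ 'n \<Rightarrow> real"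
  assumes "0 < \<alpha>" and "\<alpha> < 2" and "real CARD('n) > \<alpha>"
    and "cond_V \<alpha> V (\<lambda>_. 0) Vper"
    and "cond_F1 \<alpha> q p f" and "cond_F2 f" and "cond_F3 q f" and "cond_F4 q f" and "cond_F5 p f"
    and "\<And>n. cond_K (K n)"
    and "(\<lambda>n. Linf_norm (K n)) \<longlonglongrightarrow> 0"
    and "\<And>n. ground_state \<alpha> q V f (K n) (u n)"
  shows "\<exists>z :: nat \<Rightarrow> real ^ 'n. \<exists>u0 :: real ^ 'n \<Rightarrow> real. \<exists>\<sigma> :: nat \<Rightarrow> nat.
           (\<forall>n. z n \<in> int_lattice) \<and>
           ground_state \<alpha> q V f (\<lambda>_. 0) u0 \<and>
           strict_mono \<sigma> \<and>
           (\<lambda>k. frac_sobolev_norm \<alpha> (\<lambda>x. u (\<sigma> k) (x - z (\<sigma> k)) - u0 x)) \<longlonglongrightarrow> 0"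
proof -
  interpret semilinear_problem \<alpha> q p V Vper f
    by unfold_locales (use assms in auto)
  show ?thesis by (rule ground_states_converge[OF assms(10-12)])
qed

end
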